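(* Let $\mathcal{Q}$ be a quasianalytic class. Let $U,V$ be open neighbourhoods of the origin in $\mathbb{R}^n$, with coordinates $x=(x_1,\dots,x_n)$ and $y=(y_1,\dots,y_n)$, respectively, and assume that every coordinate hyperplane $\{x\in U: x_i=0\}$ is connected. Let $\sigma:U\to V$ be a $\mathcal{Q}$-mapping with $\sigma(0)=0$ such that the Jacobian determinant $\det(\partial\sigma/\partial x)$ is a monomial (in $x_1,\dots,x_n$) times an invertible factor in $\mathcal{Q}(U)$. Let $f\in\mathcal{Q}(U)$ and let $H\in\mathcal{F}_0$ be a formal power series centred at $0\in V$ such that $\hat f_0=H\circ\hat\sigma_0$. Then, for all $\beta\in\mathbb{N}^n$, there exists $f_\beta\in\mathcal{Q}(U)$ such that $f_0=f$ (where the subscript $0$ denotes the zero multiindex) and: (1) for all $a\in U$, $\hat f_a=H_a\circ\hat\sigma_a$, where $H_a\in\mathcal{F}_{\sigma(a)}$ denotes the formal power series $$H_a:=\sum_{\beta\in\mathbb{N}^n}\frac{f_\beta(a)}{\beta!}y^\beta$$ centred at $\sigma(a)$ (i.e. here $y$ denotes the coordinates centred at $\sigma(a)$); (2) each $f_\beta$, $\beta\in\mathbb{N}^n$, and therefore also $H_a\in\mathcal{F}_{\sigma(a)}$ (as a function of $a$), is constant on connected components of the fibres of $\sigma$.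
   Context: $\mathcal{F}_a$ denotes the ring of formal power series centred at $a\in\mathbb{R}^n$ (isomorphic to $\mathbb{R}[[x_1,\dots,x_n]]$). For a $\mathcal{C}^\infty$ function or mapping $f$ near $a$, $\hat f_a(x)=\sum_{\alpha}(\partial^{|\alpha|}f/\partial x^\alpha)(a)\,x^\alpha/\alpha!$ is its formal Taylor expansion at $a$. Quasianalytic classes. A class $\mathcal{Q}$ assigns to every open $U\subset\mathbb{R}^n$ (every $n$) a subalgebra $\mathcal{Q}(U)\subset\mathcal{C}^\infty(U)$ containing the restrictions of polynomials, closed under composition with $\mathcal{Q}$-mappings (mappings with components in $\mathcal{Q}$), and forming a sheaf of local $\mathbb{R}$-algebras. It is quasianalytic if: (i) if $f\in\mathcal{Q}(U)$ vanishes on $\{x_i=c\}$, $c\in\mathbb{R}$, then $f=(x_i-c)h$ with $h\in\mathcal{Q}(U)$; (ii) if $\varphi:U\to V$ is a $\mathcal{Q}$-mapping between open subsets of $\mathbb{R}^n$ with invertible Jacobian matrix at $c\in U$, then $\varphi$ has a local inverse at $c$ that is a $\mathcal{Q}$-mapping; (iii) if $f\in\mathcal{Q}(U)$ has zero Taylor expansion at a point of $U$, then $f$ is identically zero near that point. *)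

theory Defs
  imports "HOL-Analysis.Analysis" "Jordan_Normal_Form.Determinant"
begin

(* Conventions.  Since a quasianalytic class involves all dimensions simultaneously, R^n is the
   library's Euclidean_space n, i.e. the sequences x :: nat => real with x i = 0 for i >= n;
   coordinates are numbered 0, ..., n-1.  Its topology is the one induced from the type
   nat => real, so type-class notions (continuous_on, connected, components) apply: *)

lemma Euclidean_space_eq_top_of_set:
  "Euclidean_space n = top_of_set {x. \<forall>i\<ge>n. x i = 0}"
  by (simp add: Euclidean_space_def euclidean_product_topology)

section \<open>Multi-indices and formal power series\<close>

definition multiidx :: "nat \<Rightarrow> (nat \<Rightarrow> nat) set" where
  "multiidx n = {\<alpha>. \<forall>i\<ge>n. \<alpha> i = 0}"

definition mdeg :: "nat \<Rightarrow> (nat \<Rightarrow> nat) \<Rightarrow> nat" where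
  "mdeg n \<alpha> = (\<Sum>i<n. \<alpha> i)"

definition mfact :: "nat \<Rightarrow> (nat \<Rightarrow> nat) \<Rightarrow> real" where
  "mfact n \<alpha> = (\<Prod>i<n. fact (\<alpha> i))"

definition mpow :: "nat \<Rightarrow> (nat \<Rightarrow> real) \<Rightarrow> (nat \<Rightarrow> nat) \<Rightarrow> real" where
  "mpow n x \<alpha> = (\<Prod>i<n. x i ^ \<alpha> i)"

(* A formal power series in n variables (centred at any given point) is its family of
   coefficients; only those indexed by multiidx n are meaningful. *)
type_synonym mps = "(nat \<Rightarrow> nat) \<Rightarrow> real"

definition mps_eq :: "nat \<Rightarrow> mps \<Rightarrow> mps \<Rightarrow> bool" where
  "mps_eq n F G \<longleftrightarrow> (\<forall>\<gamma>\<in>multiidx n. F \<gamma> = G \<gamma>)"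

definition mps_one :: mps where
  "mps_one = (\<lambda>\<gamma>. if \<gamma> = (\<lambda>_. 0) then 1 else 0)"

(* {..\<gamma>} refers to the pointwise order on multi-indices. *)
definition mps_mult :: "mps \<Rightarrow> mps \<Rightarrow> mps" where
  "mps_mult F G = (\<lambda>\<gamma>. \<Sum>\<alpha>\<in>{..\<gamma>}. F \<alpha> * G (\<lambda>i. \<gamma> i - \<alpha> i))"

definition mps_monom :: "nat \<Rightarrow> (nat \<Rightarrow> mps) \<Rightarrow> (nat \<Rightarrow> nat) \<Rightarrow> mps" where
  "mps_monom n G \<beta> = foldr (\<lambda>i. mps_mult (G i) ^^ \<beta> i) [0..<n] mps_one"

(* Substitution H o (G 0, ..., G (n-1)) = sum over \<beta> of H_\<beta> G^\<beta>, for series G i without constant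
   term.  The coefficient at \<gamma> only receives contributions from |\<beta>| <= |\<gamma>|; see
   mps_monom_low_order below. *)
definition mps_compose :: "nat \<Rightarrow> mps \<Rightarrow> (nat \<Rightarrow> mps) \<Rightarrow> mps" where
  "mps_compose n H G =
     (\<lambda>\<gamma>. \<Sum>\<beta> | \<beta> \<in> multiidx n \<and> mdeg n \<beta> \<le> mdeg n \<gamma>. H \<beta> * mps_monom n G \<beta> \<gamma>)"

lemma mps_mult_low_order:
  assumes F: "\<And>\<gamma>. \<gamma> \<in> multiidx n \<Longrightarrow> mdeg n \<gamma> < k \<Longrightarrow> F \<gamma> = 0"
    and G: "\<And>\<gamma>. \<gamma> \<in> multiidx n \<Longrightarrow> mdeg n \<gamma> < l \<Longrightarrow> G \<gamma> = 0"
    and \<gamma>: "\<gamma> \<in> multiidx n" "mdeg n \<gamma> < k + l"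
  shows "mps_mult F G \<gamma> = 0"
  unfolding mps_mult_def
proof (rule sum.neutral, rule ballI)
  fix \<alpha> assume "\<alpha> \<in> {..\<gamma>}"
  then have le: "\<alpha> i \<le> \<gamma> i" for i by (simp add: le_fun_def)
  have mem: "\<alpha> \<in> multiidx n" "(\<lambda>i. \<gamma> i - \<alpha> i) \<in> multiidx n"
    using \<gamma>(1) le by (auto simp: multiidx_def) (metis le_zero_eq)
  have "mdeg n \<alpha> + mdeg n (\<lambda>i. \<gamma> i - \<alpha> i) = mdeg n \<gamma>"
    unfolding mdeg_def sum.distrib[symmetric] using le by simp
  then have "mdeg n \<alpha> < k \<or> mdeg n (\<lambda>i. \<gamma> i - \<alpha> i) < l" using \<gamma>(2) by linarith
  then show "F \<alpha> * G (\<lambda>i. \<gamma> i - \<alpha> i) = 0" using F G mem by auto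
qed

lemma mps_monom_low_order:
  assumes G: "\<And>i. i < n \<Longrightarrow> G i (\<lambda>_. 0) = 0"
    and \<gamma>: "\<gamma> \<in> multiidx n" "mdeg n \<gamma> < mdeg n \<beta>"
  shows "mps_monom n G \<beta> \<gamma> = 0"
proof -
  have G1: "G i \<gamma> = 0" if "i < n" "\<gamma> \<in> multiidx n" "mdeg n \<gamma> < 1" for i \<gamma>
  proof -
    have "\<gamma> j = 0" for j using that(2,3) by (cases "j < n") (auto simp: mdeg_def multiidx_def)
    then have "\<gamma> = (\<lambda>_. 0)" by auto
    then show ?thesis using G that(1) by simp
  qed
  have pow: "(mps_mult (G i) ^^ k) F \<gamma> = 0"
    if "i < n" "\<And>\<gamma>. \<gamma> \<in> multiidx n \<Longrightarrow> mdeg n \<gamma> < l \<Longrightarrow> F \<gamma> = 0"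
      "\<gamma> \<in> multiidx n" "mdeg n \<gamma> < k + l" for i k F l \<gamma>
    using that(3,4)
  proof (induction k arbitrary: \<gamma>)
    case (Suc k)
    show ?case unfolding funpow.simps comp_def
      by (rule mps_mult_low_order[of n 1 _ "k + l"]) (use G1 that(1) Suc in auto)
  qed (use that(2) in auto)
  have "foldr (\<lambda>i. mps_mult (G i) ^^ \<beta> i) is mps_one \<gamma> = 0"
    if "set is \<subseteq> {..<n}" "\<gamma> \<in> multiidx n" "mdeg n \<gamma> < (\<Sum>i\<leftarrow>is. \<beta> i)" for "is" \<gamma>
    using that
  proof (induction "is" arbitrary: \<gamma>)
    case (Cons i "is")
    show ?case unfolding foldr.simps comp_def
      by (rule pow[of i "sum_list (map \<beta> is)"]) (use Cons in auto)
  qed simp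
  from this[of "[0..<n]" \<gamma>] show ?thesis
    using \<gamma> by (auto simp: mps_monom_def mdeg_def interv_sum_list_conv_sum_set_nat
        lessThan_atLeast0)
qed

section \<open>Partial derivatives, smooth functions, Taylor expansions\<close>

definition partial_deriv :: "nat \<Rightarrow> ((nat \<Rightarrow> real) \<Rightarrow> real) \<Rightarrow> (nat \<Rightarrow> real) \<Rightarrow> real" where
  "partial_deriv i f = (\<lambda>x. deriv (\<lambda>t. f (x(i := t))) (x i))"

(* C^infinity: all iterated partial derivatives (in any order) exist and are continuous.
   U is meant to be open in R^n, so that only the values of f on U matter. *)
definition smooth_on :: "nat \<Rightarrow> (nat \<Rightarrow> real) set \<Rightarrow> ((nat \<Rightarrow> real) \<Rightarrow> real) \<Rightarrow> bool" where
  "smooth_on n U f \<longleftrightarrow>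
     (\<forall>is. set is \<subseteq> {..<n} \<longrightarrow>
        continuous_on U (foldr partial_deriv is f) \<and>
        (\<forall>i<n. \<forall>x\<in>U. (\<lambda>t. foldr partial_deriv is f (x(i := t))) differentiable at (x i)))"

definition mpartial :: "nat \<Rightarrow> (nat \<Rightarrow> nat) \<Rightarrow> ((nat \<Rightarrow> real) \<Rightarrow> real) \<Rightarrow> (nat \<Rightarrow> real) \<Rightarrow> real" where
  "mpartial n \<alpha> f = foldr (\<lambda>i. partial_deriv i ^^ \<alpha> i) [0..<n] f"

definition taylor :: "nat \<Rightarrow> ((nat \<Rightarrow> real) \<Rightarrow> real) \<Rightarrow> (nat \<Rightarrow> real) \<Rightarrow> mps" where
  "taylor n f a = (\<lambda>\<alpha>. mpartial n \<alpha> f a / mfact n \<alpha>)"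

(* The Taylor expansion at a of a mapping, in target coordinates centred at \<phi>(a): its components
   have no constant term, and can be substituted into series centred at \<phi>(a). *)
definition taylor_map :: "nat \<Rightarrow> ((nat \<Rightarrow> real) \<Rightarrow> nat \<Rightarrow> real) \<Rightarrow> (nat \<Rightarrow> real) \<Rightarrow> nat \<Rightarrow> mps" where
  "taylor_map n \<phi> a = (\<lambda>i. taylor n (\<lambda>x. \<phi> x i - \<phi> a i) a)"

definition jacobian_matrix :: "nat \<Rightarrow> ((nat \<Rightarrow> real) \<Rightarrow> nat \<Rightarrow> real) \<Rightarrow> (nat \<Rightarrow> real) \<Rightarrow> real Matrix.mat" where
  "jacobian_matrix n \<phi> a = Matrix.mat n n (\<lambda>(i, j). partial_deriv j (\<lambda>x. \<phi> x i) a)"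

definition polynomial_fun :: "nat \<Rightarrow> ((nat \<Rightarrow> real) \<Rightarrow> real) \<Rightarrow> bool" where
  "polynomial_fun n p \<longleftrightarrow>
     (\<exists>A c. finite A \<and> A \<subseteq> multiidx n \<and> (\<forall>x. p x = (\<Sum>\<alpha>\<in>A. c \<alpha> * mpow n x \<alpha>)))"

section \<open>Quasianalytic classes\<close>

(* Q n U is the algebra assigned to the open set U of R^n.  Its elements are represented by total
   functions of which only the values on U matter (see the axiom cong). *)
type_synonym fun_class = "nat \<Rightarrow> (nat \<Rightarrow> real) set \<Rightarrow> ((nat \<Rightarrow> real) \<Rightarrow> real) set"

definition Q_mapping ::
  "fun_class \<Rightarrow> nat \<Rightarrow> (nat \<Rightarrow> real) set \<Rightarrow> nat \<Rightarrow> (nat \<Rightarrow> real) set \<Rightarrow>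
   ((nat \<Rightarrow> real) \<Rightarrow> nat \<Rightarrow> real) \<Rightarrow> bool" where
  "Q_mapping Q m U n V \<phi> \<longleftrightarrow> \<phi> ` U \<subseteq> V \<and> (\<forall>i<n. (\<lambda>x. \<phi> x i) \<in> Q m U)"

definition unit_in :: "fun_class \<Rightarrow> nat \<Rightarrow> (nat \<Rightarrow> real) set \<Rightarrow> ((nat \<Rightarrow> real) \<Rightarrow> real) \<Rightarrow> bool" where
  "unit_in Q n U f \<longleftrightarrow> f \<in> Q n U \<and> (\<exists>g\<in>Q n U. \<forall>x\<in>U. f x * g x = 1)"

(* The germ of f at a is a unit of the stalk of Q at a. *)
definition unit_germ :: "fun_class \<Rightarrow> nat \<Rightarrow> (nat \<Rightarrow> real) \<Rightarrow> ((nat \<Rightarrow> real) \<Rightarrow> real) \<Rightarrow> bool" where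
  "unit_germ Q n a f \<longleftrightarrow> (\<exists>W. openin (Euclidean_space n) W \<and> a \<in> W \<and> unit_in Q n W f)"

locale smooth_class =
  fixes Q :: fun_class
  assumes cong:
      "\<lbrakk>openin (Euclidean_space n) U; f \<in> Q n U; \<And>x. x \<in> U \<Longrightarrow> g x = f x\<rbrakk> \<Longrightarrow> g \<in> Q n U"
    and smooth:
      "\<lbrakk>openin (Euclidean_space n) U; f \<in> Q n U\<rbrakk> \<Longrightarrow> smooth_on n U f"
    and polynomial:
      "\<lbrakk>openin (Euclidean_space n) U; polynomial_fun n p\<rbrakk> \<Longrightarrow> p \<in> Q n U"
    and add:
      "\<lbrakk>openin (Euclidean_space n) U; f \<in> Q n U; g \<in> Q n U\<rbrakk> \<Longrightarrow> (\<lambda>x. f x + g x) \<in> Q n U"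
    and mult:
      "\<lbrakk>openin (Euclidean_space n) U; f \<in> Q n U; g \<in> Q n U\<rbrakk> \<Longrightarrow> (\<lambda>x. f x * g x) \<in> Q n U"
    and scale:
      "\<lbrakk>openin (Euclidean_space n) U; f \<in> Q n U\<rbrakk> \<Longrightarrow> (\<lambda>x. c * f x) \<in> Q n U"
    and compose:
      "\<lbrakk>openin (Euclidean_space m) U; openin (Euclidean_space n) V;
        Q_mapping Q m U n V \<phi>; f \<in> Q n V\<rbrakk> \<Longrightarrow> (\<lambda>x. f (\<phi> x)) \<in> Q m U"
    and restrict:
      "\<lbrakk>openin (Euclidean_space n) U; openin (Euclidean_space n) W; W \<subseteq> U; f \<in> Q n U\<rbrakk>
        \<Longrightarrow> f \<in> Q n W"
    and glue:
      "\<lbrakk>\<And>W. W \<in> \<W> \<Longrightarrow> openin (Euclidean_space n) W; \<And>W. W \<in> \<W> \<Longrightarrow> f \<in> Q n W\<rbrakk>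
        \<Longrightarrow> f \<in> Q n (\<Union>\<W>)"
    \<comment> \<open>The stalks are local rings: the sum of two non-units is a non-unit.  (The germ of the
        constant 0 is not a unit, and products of non-units with arbitrary germs are non-units,
        in any case.)\<close>
    and local_stalk:
      "\<lbrakk>openin (Euclidean_space n) U; a \<in> U; f \<in> Q n U; g \<in> Q n U;
        \<not> unit_germ Q n a f; \<not> unit_germ Q n a g\<rbrakk> \<Longrightarrow> \<not> unit_germ Q n a (\<lambda>x. f x + g x)"
begin

(* The maximal ideal of the stalk at a consists of the germs vanishing at a. *)
lemma unit_germ_iff:
  assumes U: "openin (Euclidean_space n) U" "a \<in> U" and f: "f \<in> Q n U"
  shows "unit_germ Q n a f \<longleftrightarrow> f a \<noteq> 0"
proof
  show "unit_germ Q n a f \<Longrightarrow> f a \<noteq> 0"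
    unfolding unit_germ_def unit_in_def by force
next
  have const: "(\<lambda>x. c) \<in> Q n U" for c
  proof (rule polynomial[OF U(1)])
    show "polynomial_fun n (\<lambda>x. c)" unfolding polynomial_fun_def
      by (rule exI[of _ "{\<lambda>_. 0}"], rule exI[of _ "\<lambda>_. c"]) (simp add: multiidx_def mpow_def)
  qed
  assume nz: "f a \<noteq> 0"
  show "unit_germ Q n a f"
  proof (rule ccontr)
    assume nu: "\<not> unit_germ Q n a f"
    let ?g = "\<lambda>x. f a + (- 1) * f x"
    have g: "?g \<in> Q n U" by (intro add scale const U f)
    have "\<not> unit_germ Q n a ?g" unfolding unit_germ_def unit_in_def by force
    from local_stalk[OF U f g nu this] have "\<not> unit_germ Q n a (\<lambda>x. f a)" by simp
    moreover have "unit_germ Q n a (\<lambda>x. f a)"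
      unfolding unit_germ_def unit_in_def
      by (intro exI[of _ U] conjI U const bexI[of _ "\<lambda>x. 1 / f a"]) (use nz in auto)
    ultimately show False by blast
  qed
qed

end

locale quasianalytic_class = smooth_class +
  assumes division:
      "\<lbrakk>openin (Euclidean_space n) U; i < n; f \<in> Q n U; \<And>x. x \<in> U \<Longrightarrow> x i = c \<Longrightarrow> f x = 0\<rbrakk>
        \<Longrightarrow> \<exists>h\<in>Q n U. \<forall>x\<in>U. f x = (x i - c) * h x"
    and inverse_map:
      "\<lbrakk>openin (Euclidean_space n) U; openin (Euclidean_space n) V; Q_mapping Q n U n V \<phi>;
        b \<in> U; invertible_mat (jacobian_matrix n \<phi> b)\<rbrakk>
        \<Longrightarrow> \<exists>U' V' \<psi>. openin (Euclidean_space n) U' \<and> b \<in> U' \<and> U' \<subseteq> U \<and>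
              openin (Euclidean_space n) V' \<and> V' \<subseteq> V \<and> \<phi> ` U' \<subseteq> V' \<and>
              Q_mapping Q n V' n U' \<psi> \<and> (\<forall>x\<in>U'. \<psi> (\<phi> x) = x) \<and> (\<forall>y\<in>V'. \<phi> (\<psi> y) = y)"
    and quasianalytic:
      "\<lbrakk>openin (Euclidean_space n) U; f \<in> Q n U; a \<in> U; mps_eq n (taylor n f a) (\<lambda>_. 0)\<rbrakk>
        \<Longrightarrow> \<exists>W. openin (Euclidean_space n) W \<and> a \<in> W \<and> W \<subseteq> U \<and> (\<forall>x\<in>W. f x = 0)"

end

theory Submission
  imports Defs
begin

text \<open>The functions sought are the iterated derivatives of \<open>f\<close> along the target coordinates.
  Cramer's rule expresses \<open>det(\<partial>\<sigma>/\<partial>x) \<cdot> f\<^sub>j\<close>, where \<open>\<partial>f/\<partial>x\<^sub>i = \<Sum>\<^sub>j f\<^sub>j \<partial>\<sigma>\<^sub>j/\<partial>x\<^sub>i\<close>, by functions of the class;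
  the formal chain rule shows that its Taylor expansion at the origin is divisible by the monomial,
  and since the hyperplanes \<open>x\<^sub>i = 0\<close> are connected, quasianalyticity on them and the division axiom
  make the function itself divisible, with a quotient that again is formally a composite with \<open>\<sigma>\<close>.
  The derivations commute where the determinant is nonzero, hence everywhere.  At an arbitrary point
  \<open>a\<close> the system \<open>\<partial>f\<^sub>\<beta>/\<partial>x\<^sub>i = \<Sum>\<^sub>j f\<^bsub>\<beta>+j\<^esub> \<partial>\<sigma>\<^sub>j/\<partial>x\<^sub>i\<close> and the values \<open>f\<^sub>\<beta>(a)\<close> determine all Taylor
  expansions, and the series \<open>H\<^sub>a \<circ> \<sigma>\<close> solve the same system.

  For points \<open>x, a\<close> of one fibre the system also gives \<open>f\<^sub>\<beta>(x) - f\<^sub>\<beta>(a) = O(|x - a|\<^sup>m)\<close> for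
  every \<open>m\<close>, locally uniformly.  With \<open>m = n + 1\<close> the image of a component under \<open>f\<^sub>\<beta>\<close> is a connected
  null set of reals, so it is a point.\<close>

section \<open>Formal power series\<close>

text \<open>The relation between \<open>f\<close> and \<open>H\<close> is given at the single point
  0, and \<open>H\<close> is only formal, so nothing on the target can be differentiated. Formal
  information at 0 reaches the rest of \<open>U\<close> through exact division by the monomial. This
  is why the functions to iterate on are those whose expansion at 0 is some series composed with
  \<open>\<sigma>\<close>, the outer series being free to change. Where the determinant vanishes,
  the linear system does not determine its solution pointwise; identities are therefore proved after
  multiplication by the determinant, which is then cancelled by continuity across the hyperplanes.
  The hypotheses say nothing about curves inside a fibre, so values at two of its points are not
  compared by integrating along it. They are compared along coordinate segments that may leave the
  fibre: subtracting from \<open>f_\<beta>(x)\<close> its Taylor polynomial in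
  \<open>\<sigma>(x) - \<sigma>(a)\<close> leaves a function that stays small along the segments and
  is the plain difference of the two values once \<open>x\<close> is back on the fibre.\<close>

lemma finite_multiidx_deg: "finite {\<beta> \<in> multiidx n. mdeg n \<beta> \<le> N}"
proof (rule finite_subset)
  show "{\<beta> \<in> multiidx n. mdeg n \<beta> \<le> N} \<subseteq> {\<beta>. \<forall>i. if i \<in> {..<n} then \<beta> i \<in> {..N} else \<beta> i = 0}"
  proof clarify
    fix \<beta> i assume "\<beta> \<in> multiidx n" "mdeg n \<beta> \<le> N"
    moreover have "\<beta> i \<le> mdeg n \<beta>" if "i < n"
      unfolding mdeg_def by (rule member_le_sum) (use that in auto)
    ultimately show "if i \<in> {..<n} then \<beta> i \<in> {..N} else \<beta> i = 0"
      by (auto simp: multiidx_def)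
  qed
  have "finite {\<beta>. \<forall>i. (i \<in> {..<n} \<longrightarrow> \<beta> i \<in> {..N}) \<and> (i \<notin> {..<n} \<longrightarrow> \<beta> i = (0::nat))}"
    by (rule finite_set_of_finite_funs) auto
  then show "finite {\<beta>. \<forall>i. if i \<in> {..<n} then \<beta> i \<in> {..N} else \<beta> i = (0::nat)}"
    by (rule back_subst[of finite]) auto
qed

lemma mdeg_mono: "\<alpha> \<le> \<gamma> \<Longrightarrow> mdeg n \<alpha> \<le> mdeg n \<gamma>"
  by (auto simp: mdeg_def le_fun_def intro: sum_mono)

lemma multiidx_le: "\<gamma> \<in> multiidx n \<Longrightarrow> \<alpha> \<le> \<gamma> \<Longrightarrow> \<alpha> \<in> multiidx n"
  by (auto simp: multiidx_def le_fun_def) (metis le_zero_eq)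

lemma finite_le_multiidx: "\<gamma> \<in> multiidx n \<Longrightarrow> finite {..\<gamma>}"
  by (rule finite_subset[OF _ finite_multiidx_deg[of n "mdeg n \<gamma>"]])
    (simp add: subset_eq multiidx_le mdeg_mono)

abbreviation up :: "(nat \<Rightarrow> nat) \<Rightarrow> nat \<Rightarrow> nat \<Rightarrow> nat" where
  "up \<gamma> i \<equiv> \<gamma>(i := Suc (\<gamma> i))"

lemma up_multiidx: "i < n \<Longrightarrow> up \<gamma> i \<in> multiidx n \<longleftrightarrow> \<gamma> \<in> multiidx n"
  by (auto simp: multiidx_def)

lemma mdeg_up: "i < n \<Longrightarrow> mdeg n (up \<gamma> i) = Suc (mdeg n \<gamma>)"
  by (simp add: mdeg_def sum.remove[of "{..<n}" i])

text \<open>Makes the support condition of \<open>mseries\<close> stable under the index shift in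
  \<open>mderiv\<close>.\<close>

lemma finite_atMost_up: "finite {..up \<gamma> i} \<longleftrightarrow> finite {..\<gamma>}"
proof
  assume "finite {..up \<gamma> i}"
  then show "finite {..\<gamma>}" by (rule finite_subset[rotated]) (auto simp: le_fun_def le_Suc_eq)
next
  assume fin: "finite {..\<gamma>}"
  have "{..up \<gamma> i} \<subseteq> (\<lambda>(\<alpha>, k). \<alpha>(i := k)) ` ({..\<gamma>} \<times> {..Suc (\<gamma> i)})"
  proof
    fix \<alpha> assume a: "\<alpha> \<in> {..up \<gamma> i}"
    have "\<alpha> = (\<alpha>(i := 0))(i := \<alpha> i)" by simp
    moreover have "\<alpha>(i := 0) \<le> \<gamma>" using a by (auto simp: le_fun_def dest: spec split: if_splits)
    moreover have "\<alpha> i \<le> Suc (\<gamma> i)" using a by (auto simp: le_fun_def dest: spec[of _ i])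
    ultimately show "\<alpha> \<in> (\<lambda>(\<alpha>, k). \<alpha>(i := k)) ` ({..\<gamma>} \<times> {..Suc (\<gamma> i)})"
      by (intro image_eqI[of _ _ "(\<alpha>(i := 0), \<alpha> i)"]) auto
  qed
  then show "finite {..up \<gamma> i}" by (rule finite_subset) (use fin in auto)
qed

lemma multiidx_cases:
  assumes "\<gamma> \<in> multiidx n"
  obtains "\<gamma> = (\<lambda>_. 0)" | i \<delta> where "i < n" "\<delta> \<in> multiidx n" "\<gamma> = up \<delta> i"
proof (cases "\<gamma> = (\<lambda>_. 0)")
  case False
  then obtain i where i: "\<gamma> i \<noteq> 0" by auto
  then have "i < n" using assms by (metis (mono_tags, lifting) mem_Collect_eq multiidx_def not_le)
  moreover have "\<gamma>(i := \<gamma> i - 1) \<in> multiidx n" using assms by (auto simp: multiidx_def)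
  moreover have "\<gamma> = up (\<gamma>(i := \<gamma> i - 1)) i" using i by auto
  ultimately show ?thesis using that(2) by blast
qed (use that in blast)

lemma multiidx_induct [consumes 1, case_names zero up]:
  assumes "\<gamma> \<in> multiidx n" "P (\<lambda>_. 0)"
    and "\<And>i \<gamma>. i < n \<Longrightarrow> \<gamma> \<in> multiidx n \<Longrightarrow> P \<gamma> \<Longrightarrow> P (up \<gamma> i)"
  shows "P \<gamma>"
  using assms(1)
proof (induction "mdeg n \<gamma>" arbitrary: \<gamma> rule: less_induct)
  case less
  from less.prems show ?case
  proof (cases rule: multiidx_cases)
    case (2 i \<delta>)
    then show ?thesis using assms(3) less.hyps by (simp add: mdeg_up)
  qed (use assms in simp)
qed

text \<open>Series in finitely many, but an unspecified number of variables.  Without the support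
  condition \<open>1\<close> would not be neutral.\<close>

typedef mseries = "{F :: mps. \<forall>\<gamma>. infinite {..\<gamma>} \<longrightarrow> F \<gamma> = 0}"
  morphisms mcoeff Abs_mseries
  by (rule exI[of _ "\<lambda>_. 0"]) simp

setup_lifting type_definition_mseries

lemma mseries_eqI: 
  assumes "\<And>\<gamma>. finite {..\<gamma>} \<Longrightarrow> mcoeff F \<gamma> = mcoeff G \<gamma>"
  shows "F = G"
proof -
  have "mcoeff F \<gamma> = mcoeff G \<gamma>" for \<gamma>
    using assms[of \<gamma>] mcoeff[of F] mcoeff[of G] by (cases "finite {..\<gamma>}") auto
  then show ?thesis by (simp add: mcoeff_inject[symmetric] fun_eq_iff)
qed

lemma atMost_zero_fun: "{..(\<lambda>_::nat. 0 :: nat)} = {\<lambda>_. 0}"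
  by (auto simp: le_fun_def)

lemma finite_atMost_zero: "finite {..(\<lambda>_::nat. 0 :: nat)}"
  by (simp add: atMost_zero_fun)

text \<open>Both sides sum over the ways to write \<open>\<gamma>\<close> as a sum of three
  multi-indices; the reindexing sends \<open>(\<alpha>, \<beta>)\<close> with
  \<open>\<beta> \<le> \<alpha>\<close> to \<open>(\<beta>, \<alpha> - \<beta>)\<close>. Finiteness
  is needed to merge the double sums.\<close>

lemma mps_mult_assoc:
  assumes "finite {..\<gamma>}"
  shows "mps_mult (mps_mult F G) H \<gamma> = mps_mult F (mps_mult G H) \<gamma>"
proof -
  have fin: "finite {..\<alpha>}" if "\<alpha> \<le> \<gamma>" for \<alpha>
    using assms by (rule finite_subset[rotated]) (use that in auto)
  have "mps_mult (mps_mult F G) H \<gamma> =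
      (\<Sum>(\<alpha>, \<beta>)\<in>(SIGMA \<alpha>:{..\<gamma>}. {..\<alpha>}). F \<beta> * (G (\<lambda>i. \<alpha> i - \<beta> i) * H (\<lambda>i. \<gamma> i - \<alpha> i)))"
    unfolding mps_mult_def sum_distrib_right mult.assoc
    by (rule sum.Sigma) (use assms fin in auto)
  also have "\<dots> = (\<Sum>(\<beta>, \<delta>)\<in>(SIGMA \<beta>:{..\<gamma>}. {..(\<lambda>i. \<gamma> i - \<beta> i)}).
      F \<beta> * (G \<delta> * H (\<lambda>i. \<gamma> i - \<beta> i - \<delta> i)))"
  proof (rule sum.reindex_bij_witness[where
        i = "\<lambda>(\<beta>, \<delta>). (\<lambda>i. \<beta> i + \<delta> i, \<beta>)" and j = "\<lambda>(\<alpha>, \<beta>). (\<beta>, \<lambda>i. \<alpha> i - \<beta> i)"], goal_cases)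
    case (1 a)
    then show ?case by (auto simp: le_fun_def split: prod.splits)
  next
    case (2 a)
    then show ?case by (auto simp: le_fun_def split: prod.splits intro: diff_le_mono)
      (meson order_trans)
  next
    case (3 a)
    then show ?case by (auto simp: le_fun_def split: prod.splits)
  next
    case (4 a)
    then show ?case 
      by (auto simp: le_fun_def split: prod.splits) (metis add.commute le_diff_conv2)
  next
    case (5 a)
    have "(\<lambda>i. \<gamma> i - \<beta> i - (\<alpha> i - \<beta> i)) = (\<lambda>i. \<gamma> i - \<alpha> i)" if "\<beta> \<le> \<alpha>" for \<alpha> \<beta>
      using that by (auto simp: le_fun_def)
    then show ?case using 5 by (auto split: prod.splits)
  qed
  also have "\<dots> = mps_mult F (mps_mult G H) \<gamma>"
    unfolding mps_mult_def sum_distrib_left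
    by (rule sum.Sigma[symmetric]) (use assms fin in \<open>auto simp: le_fun_def\<close>)
  finally show ?thesis .
qed

lemma mps_mult_commute: "mps_mult F G \<gamma> = mps_mult G F \<gamma>"
  unfolding mps_mult_def
  by (rule sum.reindex_bij_witness[where i = "\<lambda>\<alpha> i. \<gamma> i - \<alpha> i" and j = "\<lambda>\<alpha> i. \<gamma> i - \<alpha> i"])
    (auto simp: le_fun_def)

lemma mps_mult_one:
  assumes "finite {..\<gamma>}" shows "mps_mult mps_one F \<gamma> = F \<gamma>"
proof -
  have "mps_mult mps_one F \<gamma> = (\<Sum>\<alpha>\<in>{..\<gamma>}. if \<alpha> = (\<lambda>_. 0) then F \<gamma> else 0)"
    unfolding mps_mult_def mps_one_def by (rule sum.cong) auto
  also have "\<dots> = F \<gamma>" using assms by (simp add: le_fun_def)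
  finally show ?thesis .
qed

instantiation mseries :: comm_ring_1
begin

lift_definition zero_mseries :: mseries is "\<lambda>_. 0" by simp
lift_definition one_mseries :: mseries is mps_one
  using finite_atMost_zero by (auto simp: mps_one_def)
lift_definition plus_mseries :: "mseries \<Rightarrow> mseries \<Rightarrow> mseries" is "\<lambda>F G \<gamma>. F \<gamma> + G \<gamma>" by simp
lift_definition uminus_mseries :: "mseries \<Rightarrow> mseries" is "\<lambda>F \<gamma>. - F \<gamma>" by simp
lift_definition minus_mseries :: "mseries \<Rightarrow> mseries \<Rightarrow> mseries" is "\<lambda>F G \<gamma>. F \<gamma> - G \<gamma>" by simp
lift_definition times_mseries :: "mseries \<Rightarrow> mseries \<Rightarrow> mseries" is mps_mult
  by (simp add: mps_mult_def)

instance
proof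
  fix a b c :: mseries
  show "a * b * c = a * (b * c)"
    by (rule mseries_eqI, transfer) (rule mps_mult_assoc)
  show "a * b = b * a"
    by (rule mseries_eqI, transfer) (rule mps_mult_commute)
  show "1 * a = a"
    by (rule mseries_eqI, transfer) (rule mps_mult_one)
  show "(a + b) * c = a * c + b * c"
    by (rule mseries_eqI, transfer) (simp add: mps_mult_def distrib_right sum.distrib)
  show "a + b + c = a + (b + c)" "a + b = b + a" "0 + a = a" "- a + a = 0" "a - b = a + - b"
    by (transfer; simp add: fun_eq_iff)+
  show "(0 :: mseries) \<noteq> 1"
    by transfer (auto simp: mps_one_def fun_eq_iff)
qed

end

section \<open>Coefficients and formal partial derivatives of series\<close>

lemma mcoeff_0 [simp]: "mcoeff 0 \<gamma> = 0" by transfer simp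
lemma mcoeff_1: "mcoeff 1 \<gamma> = (if \<gamma> = (\<lambda>_. 0) then 1 else 0)" by transfer (simp add: mps_one_def)
lemma mcoeff_add [simp]: "mcoeff (F + G) \<gamma> = mcoeff F \<gamma> + mcoeff G \<gamma>" by transfer simp
lemma mcoeff_sum [simp]: "mcoeff (sum f A) \<gamma> = (\<Sum>x\<in>A. mcoeff (f x) \<gamma>)"
  by (induction A rule: infinite_finite_induct) auto
lemma mcoeff_mult: "mcoeff (F * G) \<gamma> = (\<Sum>\<alpha>\<in>{..\<gamma>}. mcoeff F \<alpha> * mcoeff G (\<lambda>i. \<gamma> i - \<alpha> i))"
  by transfer (simp add: mps_mult_def)
lemma mcoeff_infinite: "infinite {..\<gamma>} \<Longrightarrow> mcoeff F \<gamma> = 0" by transfer simp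

lemma mcoeff_mult_zero: "mcoeff (F * G) (\<lambda>_. 0) = mcoeff F (\<lambda>_. 0) * mcoeff G (\<lambda>_. 0)"
  by (simp add: mcoeff_mult atMost_zero_fun)

lift_definition mconst :: "real \<Rightarrow> mseries" is "\<lambda>c \<gamma>. c * mps_one \<gamma>"
  using finite_atMost_zero by (auto simp: mps_one_def)

lemma mcoeff_mconst: "mcoeff (mconst c) \<gamma> = (if \<gamma> = (\<lambda>_. 0) then c else 0)"
  by transfer (simp add: mps_one_def)

lemma mcoeff_mconst_mult [simp]: "mcoeff (mconst c * F) \<gamma> = c * mcoeff F \<gamma>"
proof (cases "finite {..\<gamma>}")
  case True
  have "mcoeff (mconst c * F) \<gamma> = (\<Sum>\<alpha>\<in>{..\<gamma>}. if \<alpha> = (\<lambda>_. 0) then c * mcoeff F \<gamma> else 0)"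
    unfolding mcoeff_mult mcoeff_mconst by (rule sum.cong) auto
  also have "\<dots> = c * mcoeff F \<gamma>" using True by (simp add: le_fun_def)
  finally show ?thesis .
qed (simp add: mcoeff_infinite)

lemma of_nat_mconst: "of_nat k = mconst (of_nat k)"
  by (induction k; rule mseries_eqI) (auto simp: mcoeff_mconst mcoeff_1)

lift_definition mderiv :: "nat \<Rightarrow> mseries \<Rightarrow> mseries" is "\<lambda>i F \<gamma>. real (Suc (\<gamma> i)) * F (up \<gamma> i)"
  by (simp add: finite_atMost_up)

lemma mcoeff_mderiv: "mcoeff (mderiv i F) \<gamma> = real (Suc (\<gamma> i)) * mcoeff F (up \<gamma> i)"
  by transfer simp

lemma mderiv_add [simp]: "mderiv i (F + G) = mderiv i F + mderiv i G"
  by (rule mseries_eqI) (simp add: mcoeff_mderiv algebra_simps)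

lemma mderiv_zero [simp]: "mderiv i 0 = 0"
  by (rule mseries_eqI) (simp add: mcoeff_mderiv)

lemma mderiv_one [simp]: "mderiv i 1 = 0"
  by (rule mseries_eqI) (simp add: mcoeff_mderiv mcoeff_1 fun_eq_iff exI[of _ i])

lemma mderiv_sum [simp]: "mderiv i (sum f A) = (\<Sum>x\<in>A. mderiv i (f x))"
  by (induction A rule: infinite_finite_induct) auto

text \<open>In the coefficient at \<open>up \<gamma> i\<close>, the factor
  \<open>\<gamma> i + 1\<close> splits into \<open>\<alpha> i\<close> and
  \<open>\<gamma> i + 1 - \<alpha> i\<close>. The first share falls on \<open>F\<close> and, after
  lowering \<open>\<alpha> i\<close> by one, gives \<open>mderiv i F * G\<close>; the second falls
  on \<open>G\<close>.\<close>

lemma mderiv_mult: "mderiv i (F * G) = mderiv i F * G + F * mderiv i G"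
proof (rule mseries_eqI)
  fix \<gamma> :: "nat \<Rightarrow> nat" assume fin: "finite {..\<gamma>}"
  then have fin': "finite {..up \<gamma> i}" by (simp add: finite_atMost_up)
  let ?c = "\<lambda>\<alpha>. mcoeff F \<alpha> * mcoeff G (\<lambda>j. up \<gamma> i j - \<alpha> j)"
  have "mcoeff (mderiv i (F * G)) \<gamma> = (\<Sum>\<alpha>\<in>{..up \<gamma> i}. real (Suc (\<gamma> i)) * ?c \<alpha>)"
    by (simp add: mcoeff_mderiv mcoeff_mult sum_distrib_left)
  also have "\<dots> = (\<Sum>\<alpha>\<in>{..up \<gamma> i}. real (\<alpha> i) * ?c \<alpha>) +
      (\<Sum>\<alpha>\<in>{..up \<gamma> i}. real (Suc (\<gamma> i) - \<alpha> i) * ?c \<alpha>)"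
    unfolding sum.distrib[symmetric]
  proof (rule sum.cong[OF refl])
    fix \<alpha> assume "\<alpha> \<in> {..up \<gamma> i}"
    then have "\<alpha> i \<le> Suc (\<gamma> i)" by (auto simp: le_fun_def dest: spec[of _ i])
    then show "real (Suc (\<gamma> i)) * ?c \<alpha> = real (\<alpha> i) * ?c \<alpha> + real (Suc (\<gamma> i) - \<alpha> i) * ?c \<alpha>"
      by (simp add: of_nat_diff algebra_simps)
  qed
  also have "(\<Sum>\<alpha>\<in>{..up \<gamma> i}. real (\<alpha> i) * ?c \<alpha>) = (\<Sum>\<alpha>\<in>{\<alpha>\<in>{..up \<gamma> i}. \<alpha> i \<noteq> 0}. real (\<alpha> i) * ?c \<alpha>)"
    by (rule sum.mono_neutral_right) (use fin' in auto)
  also have "\<dots> = (\<Sum>\<alpha>\<in>{..\<gamma>}. real (Suc (\<alpha> i)) * mcoeff F (up \<alpha> i) * mcoeff G (\<lambda>j. \<gamma> j - \<alpha> j))"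
  proof (rule sum.reindex_bij_witness[where i = "\<lambda>\<alpha>. up \<alpha> i" and j = "\<lambda>\<alpha>. \<alpha>(i := \<alpha> i - 1)"], goal_cases)
    case (5 \<alpha>)
    then have "(\<lambda>j. \<gamma> j - (\<alpha>(i := \<alpha> i - Suc 0)) j) = (\<lambda>j. up \<gamma> i j - \<alpha> j)" by auto
    with 5 show ?case by (auto simp: fun_upd_idem)
  qed (auto simp: le_fun_def split: if_splits)
  also have "\<dots> = mcoeff (mderiv i F * G) \<gamma>"
    by (simp add: mcoeff_mult mcoeff_mderiv)
  \<comment> \<open>The indices dropped here have \<open>\<alpha> i = \<gamma> i + 1\<close>, where
    the weight is 0.\<close>
  also have "(\<Sum>\<alpha>\<in>{..up \<gamma> i}. real (Suc (\<gamma> i) - \<alpha> i) * ?c \<alpha>) = (\<Sum>\<alpha>\<in>{..\<gamma>}. real (Suc (\<gamma> i) - \<alpha> i) * ?c \<alpha>)"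
  proof (rule sum.mono_neutral_right[OF fin'])
    show "\<forall>\<alpha>\<in>{..up \<gamma> i} - {..\<gamma>}. real (Suc (\<gamma> i) - \<alpha> i) * ?c \<alpha> = 0"
    proof
      fix \<alpha> assume a: "\<alpha> \<in> {..up \<gamma> i} - {..\<gamma>}"
      then obtain j where "\<not> \<alpha> j \<le> \<gamma> j" by (auto simp: le_fun_def)
      moreover have "\<alpha> j \<le> up \<gamma> i j" using a by (auto simp: le_fun_def simp del: fun_upd_apply)
      ultimately have "\<alpha> i = Suc (\<gamma> i)" by (cases "j = i") auto
      then show "real (Suc (\<gamma> i) - \<alpha> i) * ?c \<alpha> = 0" by simp
    qed
  qed (auto simp: le_fun_def le_Suc_eq)
  also have "\<dots> = mcoeff (F * mderiv i G) \<gamma>"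
    unfolding mcoeff_mult mcoeff_mderiv
  proof (rule sum.cong[OF refl])
    fix \<alpha> assume "\<alpha> \<in> {..\<gamma>}"
    then have le: "\<alpha> i \<le> \<gamma> i" by (simp add: le_fun_def)
    then have "(\<lambda>j. up \<gamma> i j - \<alpha> j) = up (\<lambda>j. \<gamma> j - \<alpha> j) i" by (auto simp: Suc_diff_le)
    with le show "real (Suc (\<gamma> i) - \<alpha> i) * ?c \<alpha> =
        mcoeff F \<alpha> * (real (Suc (\<gamma> i - \<alpha> i)) * mcoeff G (up (\<lambda>j. \<gamma> j - \<alpha> j) i))"
      by (simp add: Suc_diff_le)
  qed
  finally show "mcoeff (mderiv i (F * G)) \<gamma> = mcoeff (mderiv i F * G + F * mderiv i G) \<gamma>" by simp
qed

lemma mderiv_mconst_mult [simp]: "mderiv i (mconst c * F) = mconst c * mderiv i F"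
  by (rule mseries_eqI) (simp add: mcoeff_mderiv)

lemma mderiv_power: "mderiv i (F ^ k) = of_nat k * F ^ (k - 1) * mderiv i F"
proof (induction k)
  case (Suc k)
  then show ?case by (cases k) (auto simp: mderiv_mult algebra_simps)
qed simp

lemma mderiv_prod:
  "finite A \<Longrightarrow> mderiv i (prod f A) = (\<Sum>j\<in>A. mderiv i (f j) * prod f (A - {j}))"
proof (induction A rule: finite_induct)
  case (insert a A)
  have "(\<Sum>j\<in>A. mderiv i (f j) * prod f (insert a A - {j})) = (\<Sum>j\<in>A. f a * (mderiv i (f j) * prod f (A - {j})))"
  proof (rule sum.cong[OF refl])
    fix j assume "j \<in> A"
    then have "insert a A - {j} = insert a (A - {j})" using insert by auto
    then show "mderiv i (f j) * prod f (insert a A - {j}) = f a * (mderiv i (f j) * prod f (A - {j}))"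
      using insert by (simp add: mult.left_commute)
  qed
  then show ?case using insert by (simp add: mderiv_mult sum_distrib_left)
qed simp

text \<open>Setting the meaningless coefficients to 0 turns \<open>mps_eq n\<close> into equality in
  a commutative ring, so that ring identities can be used for \<open>mps\<close>.\<close>

definition trunc :: "nat \<Rightarrow> mps \<Rightarrow> mseries" where
  "trunc n F = Abs_mseries (\<lambda>\<gamma>. if \<gamma> \<in> multiidx n then F \<gamma> else 0)"

lemma mcoeff_trunc: "mcoeff (trunc n F) \<gamma> = (if \<gamma> \<in> multiidx n then F \<gamma> else 0)"
  unfolding trunc_def by (subst Abs_mseries_inverse) (auto intro: finite_le_multiidx)

lemma mps_eq_iff_trunc: "mps_eq n F G \<longleftrightarrow> trunc n F = trunc n G"
proof
  show "mps_eq n F G \<Longrightarrow> trunc n F = trunc n G"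
    by (rule mseries_eqI) (auto simp: mcoeff_trunc mps_eq_def)
  show "trunc n F = trunc n G \<Longrightarrow> mps_eq n F G"
    by (metis mcoeff_trunc mps_eq_def)
qed

text \<open>A multi-index outside \<open>multiidx n\<close> is never the sum of two inside, so both
  sides vanish there.\<close>

lemma trunc_mult: "trunc n (mps_mult F G) = trunc n F * trunc n G"
proof (rule mseries_eqI)
  fix \<gamma> :: "nat \<Rightarrow> nat" assume fin: "finite {..\<gamma>}"
  show "mcoeff (trunc n (mps_mult F G)) \<gamma> = mcoeff (trunc n F * trunc n G) \<gamma>"
  proof (cases "\<gamma> \<in> multiidx n")
    case True
    have "(\<lambda>i. \<gamma> i - \<alpha> i) \<in> multiidx n" for \<alpha> using True by (auto simp: multiidx_def)
    then show ?thesis using True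
      by (auto simp: mcoeff_trunc mcoeff_mult mps_mult_def intro!: sum.cong dest: multiidx_le)
  next
    case False
    have "mcoeff (trunc n F) \<alpha> * mcoeff (trunc n G) (\<lambda>i. \<gamma> i - \<alpha> i) = 0" for \<alpha>
      using False by (auto simp: mcoeff_trunc multiidx_def)
    then have "mcoeff (trunc n F * trunc n G) \<gamma> = 0"
      unfolding mcoeff_mult by (intro sum.neutral) blast
    then show ?thesis using False by (simp add: mcoeff_trunc)
  qed
qed

lemma trunc_one: "trunc n mps_one = 1"
  by (rule mseries_eqI) (auto simp: mcoeff_trunc mcoeff_1 mps_one_def multiidx_def)

definition mprod :: "nat \<Rightarrow> (nat \<Rightarrow> mseries) \<Rightarrow> (nat \<Rightarrow> nat) \<Rightarrow> mseries" where
  "mprod n g \<beta> = (\<Prod>i<n. g i ^ \<beta> i)"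

lemma trunc_monom: "trunc n (mps_monom n G \<beta>) = mprod n (\<lambda>i. trunc n (G i)) \<beta>"
proof -
  have pow: "trunc n ((mps_mult (G i) ^^ k) F) = trunc n (G i) ^ k * trunc n F" for i k F
    by (induction k) (simp_all add: trunc_mult mult.assoc)
  have "trunc n (foldr (\<lambda>i. mps_mult (G i) ^^ \<beta> i) is mps_one) =
      (\<Prod>i\<leftarrow>is. trunc n (G i) ^ \<beta> i)" for "is"
    by (induction "is") (simp_all add: trunc_one pow)
  then show ?thesis
    by (simp add: mps_monom_def mprod_def prod.distinct_set_conv_list[symmetric] lessThan_atLeast0)
qed

text \<open>For \<open>\<beta> j = 0\<close> the exponent \<open>\<beta> j - 1\<close> is truncated
  to 0, but the factor \<open>of_nat (\<beta> j)\<close> removes the term.\<close>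

lemma mderiv_mprod:
  "mderiv i (mprod n g \<beta>) = (\<Sum>j<n. of_nat (\<beta> j) * (mprod n g (\<beta>(j := \<beta> j - 1)) * mderiv i (g j)))"
  unfolding mprod_def mderiv_prod[OF finite_lessThan]
proof (rule sum.cong[OF refl])
  fix j assume j: "j \<in> {..<n}"
  have "(\<Prod>k<n. g k ^ (\<beta>(j := \<beta> j - 1)) k) = g j ^ (\<beta> j - 1) * (\<Prod>k\<in>{..<n} - {j}. g k ^ \<beta> k)"
    using j by (subst prod.remove[of _ j]) (auto intro!: prod.cong)
  then show "mderiv i (g j ^ \<beta> j) * (\<Prod>k\<in>{..<n} - {j}. g k ^ \<beta> k) =
      of_nat (\<beta> j) * ((\<Prod>k<n. g k ^ (\<beta>(j := \<beta> j - 1)) k) * mderiv i (g j))"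
    by (simp add: mderiv_power algebra_simps)
qed

section \<open>Substitution of series and the formal chain rule\<close>

definition mcompose :: "nat \<Rightarrow> mps \<Rightarrow> (nat \<Rightarrow> mps) \<Rightarrow> mseries" where
  "mcompose n H G = trunc n (mps_compose n H G)"

text \<open>With a fixed bound on the outer degree, substitution is one finite sum of ring elements,
  to which the rules for \<open>mderiv\<close> apply; in \<open>mps_compose\<close> the bound varies
  with the coefficient.\<close>

definition mcompose_upto :: "nat \<Rightarrow> nat \<Rightarrow> mps \<Rightarrow> (nat \<Rightarrow> mseries) \<Rightarrow> mseries" where
  "mcompose_upto N n H g = (\<Sum>\<beta> | \<beta> \<in> multiidx n \<and> mdeg n \<beta> \<le> N. mconst (H \<beta>) * mprod n g \<beta>)"

text \<open>The inner series have no constant term, so outer degrees above that of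
  \<open>\<gamma>\<close> contribute nothing to the coefficient at \<open>\<gamma>\<close> and the
  bound may be raised to \<open>N\<close>.\<close>

lemma mcoeff_mcompose:
  assumes G: "\<And>i. i < n \<Longrightarrow> G i (\<lambda>_. 0) = 0" and \<gamma>: "\<gamma> \<in> multiidx n" "mdeg n \<gamma> \<le> N"
  shows "mcoeff (mcompose n H G) \<gamma> = mcoeff (mcompose_upto N n H (\<lambda>i. trunc n (G i))) \<gamma>"
proof -
  have "mcoeff (mcompose n H G) \<gamma> =
      (\<Sum>\<beta> | \<beta> \<in> multiidx n \<and> mdeg n \<beta> \<le> mdeg n \<gamma>. H \<beta> * mps_monom n G \<beta> \<gamma>)"
    using \<gamma> by (simp add: mcompose_def mcoeff_trunc mps_compose_def)
  also have "\<dots> = (\<Sum>\<beta> | \<beta> \<in> multiidx n \<and> mdeg n \<beta> \<le> N. H \<beta> * mps_monom n G \<beta> \<gamma>)"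
    by (rule sum.mono_neutral_left[OF finite_multiidx_deg])
      (use \<gamma> mps_monom_low_order[of n G \<gamma>] G in \<open>auto simp: not_le\<close>)
  also have "\<dots> = (\<Sum>\<beta> | \<beta> \<in> multiidx n \<and> mdeg n \<beta> \<le> N. H \<beta> * mcoeff (trunc n (mps_monom n G \<beta>)) \<gamma>)"
    using \<gamma> by (simp add: mcoeff_trunc)
  finally show ?thesis by (simp add: mcompose_upto_def trunc_monom)
qed

definition mps_deriv :: "nat \<Rightarrow> mps \<Rightarrow> mps" where
  "mps_deriv i F \<gamma> = real (Suc (\<gamma> i)) * F (up \<gamma> i)"

text \<open>Differentiating a monomial lowers the outer degree by one; the sum over
  \<open>\<beta>\<close> with \<open>\<beta> j \<noteq> 0\<close> is reindexed by
  \<open>up \<alpha> j\<close> with \<open>\<alpha>\<close> of degree at most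
  \<open>N\<close>.\<close>

lemma mderiv_mcompose_upto:
  "mderiv i (mcompose_upto (Suc N) n H g) = (\<Sum>j<n. mcompose_upto N n (mps_deriv j H) g * mderiv i (g j))"
proof -
  let ?B = "\<lambda>N. {\<beta>. \<beta> \<in> multiidx n \<and> mdeg n \<beta> \<le> N}"
  let ?t = "\<lambda>\<beta> j. mconst (H \<beta>) * (of_nat (\<beta> j) * (mprod n g (\<beta>(j := \<beta> j - 1)) * mderiv i (g j)))"
  have "mderiv i (mcompose_upto (Suc N) n H g) = (\<Sum>j<n. \<Sum>\<beta>\<in>?B (Suc N). ?t \<beta> j)"
    unfolding mcompose_upto_def mderiv_sum mderiv_mconst_mult mderiv_mprod sum_distrib_left
    by (rule sum.swap)
  also have "\<dots> = (\<Sum>j<n. mcompose_upto N n (mps_deriv j H) g * mderiv i (g j))"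
  proof (rule sum.cong[OF refl])
    fix j assume "j \<in> {..<n}"
    then have j: "j < n" by simp
    have "(\<Sum>\<beta>\<in>?B (Suc N). ?t \<beta> j) = (\<Sum>\<beta>\<in>{\<beta> \<in> ?B (Suc N). \<beta> j \<noteq> 0}. ?t \<beta> j)"
      by (rule sum.mono_neutral_right) (use finite_multiidx_deg in auto)
    also have "\<dots> = (\<Sum>\<beta>\<in>?B N. mconst (mps_deriv j H \<beta>) * mprod n g \<beta> * mderiv i (g j))"
    proof (rule sum.reindex_bij_witness[where i = "\<lambda>\<alpha>. up \<alpha> j" and j = "\<lambda>\<alpha>. \<alpha>(j := \<alpha> j - 1)"], goal_cases)
      case (2 \<alpha>)
      then have "up (\<alpha>(j := \<alpha> j - 1)) j = \<alpha>" by auto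
      then show ?case using 2 j mdeg_up[OF j, of "\<alpha>(j := \<alpha> j - 1)"]
        by (auto simp: multiidx_def)
    next
      case (5 \<alpha>)
      then have "mps_deriv j H (\<alpha>(j := \<alpha> j - 1)) = H \<alpha> * real (\<alpha> j)"
        by (simp add: mps_deriv_def fun_upd_idem)
      moreover have "mconst (H \<alpha> * real (\<alpha> j)) = mconst (H \<alpha>) * of_nat (\<alpha> j)"
        unfolding of_nat_mconst by (rule mseries_eqI) (auto simp: mcoeff_mconst)
      ultimately show ?case by (simp add: mult.assoc)
    qed (use j in \<open>auto simp: up_multiidx mdeg_up\<close>)
    finally show "(\<Sum>\<beta>\<in>?B (Suc N). ?t \<beta> j) = mcompose_upto N n (mps_deriv j H) g * mderiv i (g j)"
      by (simp add: mcompose_upto_def sum_distrib_right)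
  qed
  finally show ?thesis .
qed

lemma mcoeff_mult_cong:
  assumes "\<And>\<alpha>. \<alpha> \<le> \<gamma> \<Longrightarrow> mcoeff F \<alpha> = mcoeff F' \<alpha>"
  shows "mcoeff (F * G) \<gamma> = mcoeff (F' * G) \<gamma>"
  unfolding mcoeff_mult by (rule sum.cong) (use assms in auto)

text \<open>The coefficient at \<open>\<gamma>\<close> on the left reads the composite at
  \<open>up \<gamma> i\<close>, one degree higher. This is exactly the loss of one in the bound when
  the truncated substitution is differentiated, so bound \<open>Suc N\<close> on the left matches
  \<open>N\<close> on the right.\<close>

theorem mderiv_mcompose:
  assumes G: "\<And>i. i < n \<Longrightarrow> G i (\<lambda>_. 0) = 0" and i: "i < n"
  shows "mderiv i (mcompose n H G) =
    (\<Sum>j<n. mcompose n (mps_deriv j H) G * mderiv i (trunc n (G j)))"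
proof (rule mseries_eqI)
  fix \<gamma> :: "nat \<Rightarrow> nat"
  show "mcoeff (mderiv i (mcompose n H G)) \<gamma> =
    mcoeff (\<Sum>j<n. mcompose n (mps_deriv j H) G * mderiv i (trunc n (G j))) \<gamma>"
  proof (cases "\<gamma> \<in> multiidx n")
    case True
    let ?N = "mdeg n \<gamma>" and ?g = "\<lambda>i. trunc n (G i)"
    have "mcoeff (mderiv i (mcompose n H G)) \<gamma> = mcoeff (mderiv i (mcompose_upto (Suc ?N) n H ?g)) \<gamma>"
      unfolding mcoeff_mderiv using True i
      by (subst mcoeff_mcompose[where N = "Suc ?N" and G = G]) (use G in \<open>auto simp: up_multiidx mdeg_up\<close>)
    also have "\<dots> = (\<Sum>j<n. mcoeff (mcompose_upto ?N n (mps_deriv j H) ?g * mderiv i (?g j)) \<gamma>)"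
      by (simp add: mderiv_mcompose_upto)
    also have "\<dots> = (\<Sum>j<n. mcoeff (mcompose n (mps_deriv j H) G * mderiv i (?g j)) \<gamma>)"
      by (intro sum.cong refl mcoeff_mult_cong mcoeff_mcompose[symmetric] G)
        (use True multiidx_le mdeg_mono in auto)
    finally show ?thesis by simp
  next
    case False
    then obtain k where k: "k \<ge> n" "\<gamma> k \<noteq> 0" by (auto simp: multiidx_def)
    have "mcoeff (mcompose n (mps_deriv j H) G) \<alpha> * mcoeff (mderiv i (trunc n (G j))) (\<lambda>i. \<gamma> i - \<alpha> i) = 0"
      for j \<alpha>
    proof (cases "\<alpha> k = 0")
      case True
      then have "(\<lambda>i. \<gamma> i - \<alpha> i) \<notin> multiidx n" using k by (auto simp: multiidx_def)
      then show ?thesis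
        using up_multiidx[OF i, of "\<lambda>i. \<gamma> i - \<alpha> i"] by (simp add: mcoeff_mderiv mcoeff_trunc)
    next
      case False
      then have "\<alpha> \<notin> multiidx n" using k by (auto simp: multiidx_def)
      then show ?thesis by (simp add: mcompose_def mcoeff_trunc)
    qed
    then have "mcoeff (mcompose n (mps_deriv j H) G * mderiv i (trunc n (G j))) \<gamma> = 0" for j
      unfolding mcoeff_mult by (intro sum.neutral) blast
    then show ?thesis using False i by (simp add: mcoeff_mderiv mcompose_def mcoeff_trunc up_multiidx)
  qed
qed

lemma mcompose_const: "mcoeff (mcompose n H G) (\<lambda>_. 0) = H (\<lambda>_. 0)"
proof -
  have "{\<beta> \<in> multiidx n. mdeg n \<beta> \<le> mdeg n (\<lambda>_. 0)} = {\<lambda>_. 0}"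
    by (auto simp: mdeg_def multiidx_def fun_eq_iff) (metis lessThan_iff not_le)
  moreover have "mps_monom n G (\<lambda>_. 0) = mps_one"
  proof -
    have "foldr (\<lambda>i. mps_mult (G i) ^^ 0) is F = F" for "is" F by (induction "is") auto
    then show ?thesis by (simp add: mps_monom_def)
  qed
  ultimately show ?thesis
    by (simp add: mcompose_def mcoeff_trunc mps_compose_def mps_one_def) (simp add: multiidx_def)
qed

section \<open>The variables as series, and recovery of a series from its derivatives\<close>

lift_definition mvar :: "nat \<Rightarrow> mseries" is "\<lambda>i \<gamma>. if \<gamma> = up (\<lambda>_. 0) i then 1 else 0"
  using finite_atMost_zero finite_atMost_up by auto

lemma mcoeff_mvar: "mcoeff (mvar i) \<gamma> = (if \<gamma> = up (\<lambda>_. 0) i then 1 else 0)"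
  by transfer simp

lemma mcoeff_mvar_mult: "mcoeff (mvar i * F) \<gamma> = (if \<gamma> i = 0 then 0 else mcoeff F (\<gamma>(i := \<gamma> i - 1)))"
proof (cases "finite {..\<gamma>}")
  case True
  have "mcoeff (mvar i * F) \<gamma> = (\<Sum>\<alpha>\<in>{..\<gamma>}. if \<alpha> = up (\<lambda>_. 0) i then mcoeff F (\<gamma>(i := \<gamma> i - 1)) else 0)"
    unfolding mcoeff_mult mcoeff_mvar
    by (rule sum.cong) (auto intro!: arg_cong[where f = "mcoeff F"])
  also have "\<dots> = (if up (\<lambda>_. 0) i \<le> \<gamma> then mcoeff F (\<gamma>(i := \<gamma> i - 1)) else 0)"
    using True by simp
  also have "up (\<lambda>_. 0) i \<le> \<gamma> \<longleftrightarrow> \<gamma> i \<noteq> 0" by (auto simp: le_fun_def)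
  finally show ?thesis by simp
next
  case False
  have "infinite {..\<gamma>(i := \<gamma> i - 1)}" if "\<gamma> i \<noteq> 0"
    using False finite_atMost_up[of "\<gamma>(i := \<gamma> i - 1)" i] that by (simp add: fun_upd_idem)
  with False show ?thesis by (simp add: mcoeff_infinite)
qed

text \<open>Multiplication by a variable only shifts coefficients. With this,
  \<open>monomial_division\<close> strips the variables of a monomial one at a time.\<close>

lemma mvar_mult_cancel:
  assumes "mvar i * F = mvar i * G" shows "F = G"
proof (rule mseries_eqI)
  fix \<gamma>
  from assms have "mcoeff (mvar i * F) (up \<gamma> i) = mcoeff (mvar i * G) (up \<gamma> i)" by simp
  then show "mcoeff F \<gamma> = mcoeff G \<gamma>" by (simp add: mcoeff_mvar_mult)
qed

lemma mderiv_mvar: "mderiv j (mvar i) = (if i = j then 1 else 0)"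
  by (rule mseries_eqI) (auto simp: mcoeff_mderiv mcoeff_mvar mcoeff_1 fun_eq_iff)

text \<open>Each coefficient of positive degree is a coefficient of some derivative divided by a
  positive integer.\<close>

lemma mderiv_eqI:
  assumes "\<And>\<gamma>. \<gamma> \<notin> multiidx n \<Longrightarrow> mcoeff F \<gamma> = mcoeff G \<gamma>"
    and "mcoeff F (\<lambda>_. 0) = mcoeff G (\<lambda>_. 0)" "\<And>i. i < n \<Longrightarrow> mderiv i F = mderiv i G"
  shows "F = G"
proof (rule mseries_eqI)
  fix \<gamma> show "mcoeff F \<gamma> = mcoeff G \<gamma>"
  proof (cases "\<gamma> \<in> multiidx n")
    case True
    then show ?thesis
    proof (cases rule: multiidx_cases)
      case (2 i \<delta>)
      then show ?thesis using assms(3)[of i] mcoeff_mderiv[of i F \<delta>] mcoeff_mderiv[of i G \<delta>] by simp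
    qed (use assms in simp)
  qed (use assms in simp)
qed

section \<open>Partial derivatives and Taylor expansions\<close>

definition box_nbhd :: "nat \<Rightarrow> (nat \<Rightarrow> real) \<Rightarrow> real \<Rightarrow> (nat \<Rightarrow> real) set" where
  "box_nbhd n p r = {x. (\<forall>i\<ge>n. x i = 0) \<and> (\<forall>i<n. \<bar>x i - p i\<bar> < r)}"

lemma openin_Euclidean_space_iff:
  "openin (Euclidean_space n) U \<longleftrightarrow> (\<exists>T. open T \<and> U = {x. \<forall>i\<ge>n. x i = 0} \<inter> T)"
  by (simp add: Euclidean_space_eq_top_of_set openin_open)

lemma openin_Euclidean_space_zero:
  "openin (Euclidean_space n) U \<Longrightarrow> x \<in> U \<Longrightarrow> i \<ge> n \<Longrightarrow> x i = 0"
  by (auto simp: openin_Euclidean_space_iff)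

lemma open_coordinate_box: "open {x :: nat \<Rightarrow> real. \<forall>i<n. \<bar>x i - p i\<bar> < r}"
proof -
  have "open (\<Inter>i\<in>{..<n}. {x :: nat \<Rightarrow> real. \<bar>x i - p i\<bar> < r})"
    by (intro open_INT finite_lessThan ballI open_Collect_less continuous_intros
        continuous_on_product_then_coordinatewise[OF continuous_on_id])
  also have "(\<Inter>i\<in>{..<n}. {x :: nat \<Rightarrow> real. \<bar>x i - p i\<bar> < r}) = {x. \<forall>i<n. \<bar>x i - p i\<bar> < r}" by auto
  finally show ?thesis .
qed

lemma openin_imp_box_nbhd:
  assumes "openin (Euclidean_space n) U" "p \<in> U"
  obtains r where "r > 0" "box_nbhd n p r \<subseteq> U"
proof -
  obtain T where T: "open T" "U = {x. \<forall>i\<ge>n. x i = 0} \<inter> T"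
    using assms(1) by (auto simp: openin_Euclidean_space_iff)
  have "openin (product_topology (\<lambda>i::nat. euclidean :: real topology) UNIV) T" "p \<in> T"
    using T assms(2) by (auto simp: euclidean_product_topology)
  from product_topology_open_contains_basis[OF this]
  obtain X where X: "p \<in> (\<Pi>\<^sub>E i\<in>UNIV. X i)" "\<And>i. open (X i)" "(\<Pi>\<^sub>E i\<in>UNIV. X i) \<subseteq> T"
    by auto
  have "\<exists>r>0. \<forall>y. \<bar>y - p i\<bar> < r \<longrightarrow> y \<in> X i" for i
    using X(1) X(2)[of i] unfolding open_dist by (auto simp: dist_real_def PiE_iff)
  then obtain r where r: "\<And>i. r i > 0" "\<And>i y. \<bar>y - p i\<bar> < r i \<Longrightarrow> y \<in> X i" by metis
  \<comment> \<open>Coordinates from \<open>n\<close> on agree with those of \<open>p\<close>, so a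
    minimum over the first \<open>n\<close> radii suffices; the inserted 1 keeps it defined for
    \<open>n = 0\<close>.\<close>
  define \<rho> where "\<rho> = Min (insert 1 (r ` {..<n}))"
  have "\<rho> > 0" using r(1) by (auto simp: \<rho>_def)
  moreover have "\<rho> \<le> r i" if "i < n" for i using that by (auto simp: \<rho>_def)
  then have "box_nbhd n p \<rho> \<subseteq> U"
  proof (intro subsetI)
    fix x assume x: "x \<in> box_nbhd n p \<rho>"
    have "x i \<in> X i" for i
    proof (cases "i < n")
      case True
      then show ?thesis using x r(2)[of "x i" i] \<open>\<And>i. i < n \<Longrightarrow> \<rho> \<le> r i\<close>
        by (fastforce simp: box_nbhd_def)
    next
      case False
      then have "x i = p i" using x assms(2) T(2) by (simp add: box_nbhd_def)
      then show ?thesis using X(1) by (auto simp: PiE_iff)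
    qed
    then show "x \<in> U" using X(3) x T(2) by (auto simp: PiE_iff box_nbhd_def)
  qed
  ultimately show ?thesis using that by blast
qed

lemma box_nbhd_mono: "r \<le> s \<Longrightarrow> box_nbhd n p r \<subseteq> box_nbhd n p s"
  by (fastforce simp: box_nbhd_def)

lemma continuous_on_box_nbhd:
  fixes g :: "(nat \<Rightarrow> real) \<Rightarrow> real"
  assumes "openin (Euclidean_space n) U" "continuous_on U g" "p \<in> U" "e > 0"
  obtains r where "r > 0" "box_nbhd n p r \<subseteq> U" "\<And>x. x \<in> box_nbhd n p r \<Longrightarrow> \<bar>g x - g p\<bar> < e"
proof -
  have "openin (top_of_set U) (U \<inter> g -` ball (g p) e)"
    using assms(2) by (intro continuous_openin_preimage_gen) auto
  then have "openin (Euclidean_space n) (U \<inter> g -` ball (g p) e)"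
    using assms(1) unfolding Euclidean_space_eq_top_of_set by (rule openin_trans)
  then obtain r where "r > 0" "box_nbhd n p r \<subseteq> U \<inter> g -` ball (g p) e"
    using assms by (elim openin_imp_box_nbhd[where p = p]) auto
  then show ?thesis using that by (fastforce simp: dist_real_def subset_iff abs_minus_commute)
qed

lemma openin_Euclidean_space_preimage:
  assumes "openin (Euclidean_space n) U" "\<And>k. continuous_on {z. \<forall>i\<ge>m. z i = 0} (\<lambda>z. \<phi> z k)"
    and "\<And>z k. \<lbrakk>\<forall>i\<ge>m. z i = 0; k \<ge> n\<rbrakk> \<Longrightarrow> \<phi> z k = 0"
  shows "openin (Euclidean_space m) {z. (\<forall>i\<ge>m. z i = 0) \<and> \<phi> z \<in> U}"
proof -
  let ?E = "{z :: nat \<Rightarrow> real. \<forall>i\<ge>m. z i = 0}"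
  obtain T where T: "open T" "U = {x. \<forall>i\<ge>n. x i = 0} \<inter> T"
    using assms(1) by (auto simp: openin_Euclidean_space_iff)
  have "continuous_on ?E \<phi>" by (rule continuous_on_coordinatewise_then_product) (rule assms)
  then have "openin (top_of_set ?E) (?E \<inter> \<phi> -` T)"
    using T by (intro continuous_openin_preimage_gen)
  also have "?E \<inter> \<phi> -` T = {z. (\<forall>i\<ge>m. z i = 0) \<and> \<phi> z \<in> U}" using assms(3) T by auto
  finally show ?thesis by (simp add: Euclidean_space_eq_top_of_set)
qed

lemma eventually_line_in_openin:
  assumes "openin (Euclidean_space n) U" "x \<in> U" "i < n"
  shows "eventually (\<lambda>t. x(i := t) \<in> U) (nhds (x i))"
proof -
  obtain r where r: "r > 0" "box_nbhd n x r \<subseteq> U" using assms openin_imp_box_nbhd by blast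
  have "x(i := t) \<in> U" if "dist t (x i) < r" for t
    using that r assms openin_Euclidean_space_zero[OF assms(1,2)]
    by (auto simp: box_nbhd_def dist_real_def subset_iff)
  then show ?thesis using r(1) by (auto simp: eventually_nhds_metric)
qed

section \<open>Partial derivatives of smooth functions\<close>

lemma partial_deriv_eqI:
  "((\<lambda>t. f (x(i := t))) has_real_derivative D) (at (x i)) \<Longrightarrow> partial_deriv i f x = D"
  unfolding partial_deriv_def by (rule DERIV_imp_deriv)

lemma partial_deriv_cong:
  assumes "openin (Euclidean_space n) U" "x \<in> U" "i < n" "\<And>y. y \<in> U \<Longrightarrow> f y = g y"
  shows "partial_deriv i f x = partial_deriv i g x"
  unfolding partial_deriv_def
  by (rule deriv_cong_ev, rule eventually_mono[OF eventually_line_in_openin])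
    (use assms in auto)

lemma smooth_on_continuous: "smooth_on n U f \<Longrightarrow> continuous_on U f"
  unfolding smooth_on_def by (drule spec[of _ "[]"]) auto

lemma smooth_on_partial: 
  assumes "smooth_on n U f" "i < n"
  shows "smooth_on n U (partial_deriv i f)"
  unfolding smooth_on_def
proof (intro allI impI)
  fix js assume "set js \<subseteq> {..<n}"
  then show "continuous_on U (foldr partial_deriv js (partial_deriv i f)) \<and> (\<forall>ia<n. \<forall>x\<in>U.
      (\<lambda>t. foldr partial_deriv js (partial_deriv i f) (x(ia := t))) differentiable at (x ia))"
    using assms(1)[unfolded smooth_on_def, rule_format, of "js @ [i]"] assms(2) by simp
qed

lemma smooth_on_line_deriv:
  assumes "smooth_on n U f" "i < n" "x(i := t) \<in> U"
  shows "((\<lambda>s. f (x(i := s))) has_real_derivative partial_deriv i f (x(i := t))) (at t)"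
proof -
  have "(\<lambda>s. f (x(i := s))) differentiable at t"
    using assms(1)[unfolded smooth_on_def, rule_format, of "[]"] assms(2,3) by fastforce
  then show ?thesis
    by (simp add: partial_deriv_def DERIV_deriv_iff_real_differentiable)
qed

lemma smooth_on_deriv:
  "\<lbrakk>smooth_on n U f; i < n; x \<in> U\<rbrakk>
    \<Longrightarrow> ((\<lambda>s. f (x(i := s))) has_real_derivative partial_deriv i f x) (at (x i))"
  using smooth_on_line_deriv[of n U f i x "x i"] by simp

text \<open>The mean value theorem is applied in direction \<open>i\<close> to the increment in
  direction \<open>j\<close>, and then in direction \<open>j\<close> to the resulting increment of
  the \<open>i\<close>-th derivative.\<close>

lemma second_difference_mvt:
  assumes f: "smooth_on n U f" and ij: "i < n" "j < n" "i \<noteq> j" and h: "h > 0"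
    and U: "\<And>s t. \<lbrakk>x i \<le> s; s \<le> x i + h; x j \<le> t; t \<le> x j + h\<rbrakk> \<Longrightarrow> x(i := s, j := t) \<in> U"
  obtains s t where "x i < s" "s < x i + h" "x j < t" "t < x j + h"
    "f (x(i := x i + h, j := x j + h)) - f (x(i := x i + h)) - f (x(j := x j + h)) + f x =
      h * h * partial_deriv j (partial_deriv i f) (x(i := s, j := t))"
proof -
  let ?\<phi> = "\<lambda>s. f (x(i := s, j := x j + h)) - f (x(i := s, j := x j))"
  let ?\<phi>' = "\<lambda>s. partial_deriv i f (x(i := s, j := x j + h)) - partial_deriv i f (x(i := s, j := x j))"
  have "DERIV ?\<phi> s :> ?\<phi>' s" if "x i \<le> s" "s \<le> x i + h" for s
  proof (rule DERIV_diff)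
    have twist: "x(i := s, j := t) = x(j := t, i := s)" for s t
      using ij(3) by (rule fun_upd_twist)
    have line: "((\<lambda>s. f ((x(j := t))(i := s))) has_real_derivative
        partial_deriv i f ((x(j := t))(i := s))) (at s)" if "x j \<le> t" "t \<le> x j + h" for t
      by (rule smooth_on_line_deriv[OF f]) (use ij U[of s t] that \<open>x i \<le> s\<close> \<open>s \<le> x i + h\<close> in
        \<open>auto simp: fun_upd_twist\<close>)
    then show "((\<lambda>s. f (x(i := s, j := x j + h))) has_real_derivative
        partial_deriv i f (x(i := s, j := x j + h))) (at s)"
      "((\<lambda>s. f (x(i := s, j := x j))) has_real_derivative
        partial_deriv i f (x(i := s, j := x j))) (at s)"
      using line[of "x j + h"] line[of "x j"] h unfolding twist by simp_all
  qed
  from MVT2[of "x i" "x i + h" ?\<phi>, OF _ this] h obtain s where s: "x i < s" "s < x i + h"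
    "?\<phi> (x i + h) - ?\<phi> (x i) = h * ?\<phi>' s" by auto
  have "DERIV (\<lambda>t. partial_deriv i f (x(i := s, j := t))) t :>
      partial_deriv j (partial_deriv i f) (x(i := s, j := t))" if "x j \<le> t" "t \<le> x j + h" for t
    by (rule smooth_on_line_deriv[OF smooth_on_partial[OF f ij(1)] ij(2)]) (use U s that in auto)
  from MVT2[of "x j" "x j + h", OF _ this] h obtain t where t: "x j < t" "t < x j + h"
    "?\<phi>' s = h * partial_deriv j (partial_deriv i f) (x(i := s, j := t))" by auto
  have "f (x(i := x i + h, j := x j + h)) - f (x(i := x i + h)) - f (x(j := x j + h)) + f x =
      ?\<phi> (x i + h) - ?\<phi> (x i)" using ij(3) by (simp add: fun_upd_idem)
  with s t show ?thesis by (intro that[of s t]) auto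
qed

text \<open>The second difference is symmetric in \<open>i\<close> and \<open>j\<close>. Hence the
  two mixed derivatives agree at two possibly different points of an arbitrarily small cube at
  \<open>x\<close>, and continuity moves both values to \<open>x\<close>.\<close>

theorem partial_deriv_commute:
  assumes U: "openin (Euclidean_space n) U" and f: "smooth_on n U f" and ij: "i < n" "j < n" and x: "x \<in> U"
  shows "partial_deriv i (partial_deriv j f) x = partial_deriv j (partial_deriv i f) x"
proof (cases "i = j")
  case False
  let ?A = "partial_deriv i (partial_deriv j f)" and ?B = "partial_deriv j (partial_deriv i f)"
  have "\<bar>?A x - ?B x\<bar> < e" if "e > 0" for e :: real
  proof -
    have "continuous_on U ?A" "continuous_on U ?B"
      using f ij by (auto intro: smooth_on_continuous smooth_on_partial)
    then obtain r1 r2 where r: "r1 > 0" "r2 > 0" "box_nbhd n x r1 \<subseteq> U" 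
      "\<And>y. y \<in> box_nbhd n x r1 \<Longrightarrow> \<bar>?A y - ?A x\<bar> < e / 2"
      "\<And>y. y \<in> box_nbhd n x r2 \<Longrightarrow> \<bar>?B y - ?B x\<bar> < e / 2"
      using continuous_on_box_nbhd[OF U _ x, of _ "e / 2"] \<open>e > 0\<close>
      by (metis half_gt_zero)
    define h where "h = min r1 r2 / 2"
    have h: "h > 0" "h < r1" "h < r2" using r by (auto simp: h_def)
    have box: "x(i := s, j := t) \<in> box_nbhd n x \<rho>"
      if "x i \<le> s" "s \<le> x i + h" "x j \<le> t" "t \<le> x j + h" "h < \<rho>" for s t \<rho>
      using that ij h openin_Euclidean_space_zero[OF U x] by (auto simp: box_nbhd_def)
    obtain s t where 1: "x i < s" "s < x i + h" "x j < t" "t < x j + h"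
      "f (x(i := x i + h, j := x j + h)) - f (x(i := x i + h)) - f (x(j := x j + h)) + f x =
        h * h * ?B (x(i := s, j := t))"
      using second_difference_mvt[OF f ij False h(1), of x] box[of _ _ r1] r h by blast
    obtain t' s' where 2: "x i < s'" "s' < x i + h" "x j < t'" "t' < x j + h"
      "f (x(j := x j + h, i := x i + h)) - f (x(j := x j + h)) - f (x(i := x i + h)) + f x =
        h * h * ?A (x(j := t', i := s'))"
      using second_difference_mvt[OF f ij(2,1) False[symmetric] h(1), of x] box[of _ _ r1] r h
        fun_upd_twist[OF False] by (smt (verit, ccfv_SIG) subsetD)
    have "h * h * ?B (x(i := s, j := t)) = h * h * ?A (x(i := s', j := t'))"
      using 1(5) 2(5) unfolding fun_upd_twist[OF False] by linarith
    then have "?B (x(i := s, j := t)) = ?A (x(i := s', j := t'))" using h by simp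
    moreover have "\<bar>?A (x(i := s', j := t')) - ?A x\<bar> < e / 2"
      by (intro r box) (use 1 2 h in auto)
    moreover have "\<bar>?B (x(i := s, j := t)) - ?B x\<bar> < e / 2"
      by (intro r box) (use 1 2 h in auto)
    ultimately show ?thesis by linarith
  qed
  then show ?thesis by (metis eq_iff_diff_eq_0 zero_less_abs_iff less_irrefl)
qed simp

text \<open>Shared by \<open>partial_deriv\<close> on smooth functions and by \<open>tderiv\<close>
  on formal composites. In both cases the operators commute only on \<open>U\<close> and only for
  functions in \<open>S\<close>, so the argument runs in the relation \<open>eq\<close>, equality on
  \<open>U\<close> between members of \<open>S\<close>.\<close>

lemma commuting_operators_foldr:
  fixes D :: "nat \<Rightarrow> ('a \<Rightarrow> 'b) \<Rightarrow> 'a \<Rightarrow> 'b"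
  assumes closed: "\<And>i g. i < n \<Longrightarrow> g \<in> S \<Longrightarrow> D i g \<in> S"
    and cong: "\<And>i g h x. \<lbrakk>i < n; g \<in> S; h \<in> S; \<And>x. x \<in> U \<Longrightarrow> g x = h x; x \<in> U\<rbrakk> \<Longrightarrow> D i g x = D i h x"
    and comm: "\<And>i j g x. \<lbrakk>i < n; j < n; g \<in> S; x \<in> U\<rbrakk> \<Longrightarrow> D i (D j g) x = D j (D i g) x"
    and f: "f \<in> S"
  shows "foldr (\<lambda>i. D i ^^ \<beta> i) [0..<n] f \<in> S" (is ?closed)
    and "\<And>i x. i < n \<Longrightarrow> x \<in> U \<Longrightarrow>
      D i (foldr (\<lambda>i. D i ^^ \<beta> i) [0..<n] f) x = foldr (\<lambda>k. D k ^^ up \<beta> i k) [0..<n] f x"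
    and "\<And>i x. i < n \<Longrightarrow> x \<in> U \<Longrightarrow>
      foldr (\<lambda>i. D i ^^ \<beta> i) [0..<n] (D i f) x = foldr (\<lambda>k. D k ^^ up \<beta> i k) [0..<n] f x"
proof -
  define eq where "eq g h \<longleftrightarrow> g \<in> S \<and> h \<in> S \<and> (\<forall>x\<in>U. g x = h x)" for g h
  have eq_refl: "eq g g" if "g \<in> S" for g using that by (simp add: eq_def)
  have eq_trans [trans]: "eq g k" if "eq g h" "eq h k" for g h k using that by (simp add: eq_def)
  have eq_sym: "eq g h" if "eq h g" for g h using that by (simp add: eq_def)
  have eq_cong: "eq (D i g) (D i h)" if "eq g h" "i < n" for g h i
    using that closed cong unfolding eq_def by blast
  have pow_cong: "eq ((D i ^^ k) g) ((D i ^^ k) h)" if "eq g h" "i < n" for g h i k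
    using that by (induction k) (auto intro: eq_cong)
  have pow_S: "(D i ^^ k) g \<in> S" if "g \<in> S" "i < n" for g i k
    using pow_cong[OF eq_refl] that by (auto simp: eq_def)
  have comm_pow: "eq (D i ((D j ^^ k) g)) ((D j ^^ k) (D i g))" if "i < n" "j < n" "g \<in> S" for i j k g
  proof (induction k)
    case 0
    then show ?case using that closed by (simp add: eq_refl)
  next
    case (Suc k)
    have "eq (D i (D j ((D j ^^ k) g))) (D j (D i ((D j ^^ k) g)))"
      using that comm closed pow_S by (auto simp: eq_def)
    also have "eq \<dots> (D j ((D j ^^ k) (D i g)))" using Suc that by (intro eq_cong)
    finally show ?case by simp
  qed
  let ?F = "\<lambda>\<beta>. foldr (\<lambda>i. D i ^^ \<beta> i)"
  have F_S: "?F \<beta> js g \<in> S" if "set js \<subseteq> {..<n}" "g \<in> S" for js g \<beta>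
    using that by (induction js) (auto intro: pow_S)
  have comm_F: "eq (D i (?F \<beta> js g)) (?F \<beta> js (D i g))"
    if "set js \<subseteq> {..<n}" "g \<in> S" "i < n" for i js g \<beta>
    using that
  proof (induction js)
    case (Cons j js)
    have "eq (D i ((D j ^^ \<beta> j) (?F \<beta> js g))) ((D j ^^ \<beta> j) (D i (?F \<beta> js g)))"
      using Cons.prems by (intro comm_pow F_S) auto
    also have "eq \<dots> ((D j ^^ \<beta> j) (?F \<beta> js (D i g)))"
      using Cons by (intro pow_cong) auto
    finally show ?case by simp
  qed (auto intro: eq_refl closed)
  have up_F: "eq (?F \<beta> js (D i g)) (?F (up \<beta> i) js g)"
    if "set js \<subseteq> {..<n}" "g \<in> S" "i \<in> set js" "distinct js" for i js g
    using that
  proof (induction js)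
    case (Cons j js)
    show ?case
    proof (cases "i = j")
      case True
      have "foldr (\<lambda>k. D k ^^ up \<beta> i k) js g = ?F \<beta> js g"
        by (rule foldr_cong) (use True Cons.prems in auto)
      then have "?F (up \<beta> i) (j # js) g = (D i ^^ \<beta> i) (D i (?F \<beta> js g))"
        using True by (simp add: funpow_swap1 del: fun_upd_apply) (simp add: funpow_swap1)
      moreover have "eq ((D i ^^ \<beta> i) (D i (?F \<beta> js g))) ((D i ^^ \<beta> i) (?F \<beta> js (D i g)))"
        using Cons.prems True by (intro pow_cong comm_F) auto
      ultimately show ?thesis using True by (simp add: eq_sym)
    next
      case False
      then show ?thesis using Cons by (auto intro!: pow_cong)
    qed
  qed simp
  have n: "set [0..<n] \<subseteq> {..<n}" by auto
  show ?closed using F_S n f by blast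
  fix i x assume i: "i < n" and x: "x \<in> U"
  have right: "eq (?F \<beta> [0..<n] (D i f)) (?F (up \<beta> i) [0..<n] f)" using i f by (intro up_F) auto
  then show "?F \<beta> [0..<n] (D i f) x = ?F (up \<beta> i) [0..<n] f x" using x by (simp add: eq_def)
  from eq_trans[OF comm_F[OF n f i] right]
  show "D i (?F \<beta> [0..<n] f) x = ?F (up \<beta> i) [0..<n] f x" using x by (simp add: eq_def)
qed

lemma mpartial_partial:
  assumes U: "openin (Euclidean_space n) U" and f: "smooth_on n U f" and "i < n" "x \<in> U"
  shows "mpartial n \<gamma> (partial_deriv i f) x = mpartial n (up \<gamma> i) f x"
  using commuting_operators_foldr(3)[where n = n and S = "{f. smooth_on n U f}" and D = partial_deriv
      and U = U and f = f and \<beta> = \<gamma>] partial_deriv_commute[OF U] partial_deriv_cong[OF U]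
    smooth_on_partial assms
  unfolding mpartial_def by blast

lemma mfact_up: "i < n \<Longrightarrow> mfact n (up \<gamma> i) = real (Suc (\<gamma> i)) * mfact n \<gamma>"
  by (simp add: mfact_def prod.remove[of "{..<n}" i])

lemma mfact_nonzero [simp]: "mfact n \<gamma> \<noteq> 0"
  by (simp add: mfact_def)

section \<open>Taylor expansions as elements of the ring of series\<close>

definition tay :: "nat \<Rightarrow> ((nat \<Rightarrow> real) \<Rightarrow> real) \<Rightarrow> (nat \<Rightarrow> real) \<Rightarrow> mseries" where
  "tay n f a = trunc n (taylor n f a)"

lemma mpartial_zero [simp]: "mpartial n (\<lambda>_. 0) f = f"
proof -
  have "foldr (\<lambda>i. partial_deriv i ^^ 0) is f = f" for "is" by (induction "is") auto
  then show ?thesis by (simp add: mpartial_def)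
qed

lemma mcoeff_tay_zero: "mcoeff (tay n f a) (\<lambda>_. 0) = f a"
  by (simp add: tay_def mcoeff_trunc taylor_def mfact_def multiidx_def)

lemma mcoeff_tay_outside: "\<gamma> \<notin> multiidx n \<Longrightarrow> mcoeff (tay n f a) \<gamma> = 0"
  by (simp add: tay_def mcoeff_trunc)

lemma mderiv_tay:
  assumes "openin (Euclidean_space n) U" "smooth_on n U f" "i < n" "a \<in> U"
  shows "mderiv i (tay n f a) = tay n (partial_deriv i f) a"
  by (rule mseries_eqI)
    (use assms in \<open>simp add: mcoeff_mderiv tay_def mcoeff_trunc taylor_def up_multiidx mfact_up mpartial_partial[OF assms(1,2)]\<close>)

lemma mpartial_cong:
  assumes "openin (Euclidean_space n) U" "x \<in> U" "\<And>y. y \<in> U \<Longrightarrow> f y = g y"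
  shows "mpartial n \<gamma> f x = mpartial n \<gamma> g x"
proof -
  have pow: "\<forall>y\<in>U. (partial_deriv i ^^ k) f y = (partial_deriv i ^^ k) g y"
    if "i < n" "\<forall>y\<in>U. f y = g y" for i k f g
    using that by (induction k) (auto intro: partial_deriv_cong[OF assms(1)])
  have "\<forall>y\<in>U. foldr (\<lambda>i. partial_deriv i ^^ \<gamma> i) is f y = foldr (\<lambda>i. partial_deriv i ^^ \<gamma> i) is g y"
    if "set is \<subseteq> {..<n}" for "is"
    using that by (induction "is") (use assms(3) pow in auto)
  from this[of "[0..<n]"] show ?thesis
    using assms(2) by (simp add: mpartial_def lessThan_atLeast0)
qed

lemma tay_cong:
  assumes "openin (Euclidean_space n) U" "a \<in> U" "\<And>y. y \<in> U \<Longrightarrow> f y = g y"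
  shows "tay n f a = tay n g a"
  using mpartial_cong[OF assms] by (simp add: tay_def taylor_def)

section \<open>Quasianalytic classes\<close>

context smooth_class
begin

lemma Q_const: "openin (Euclidean_space n) U \<Longrightarrow> (\<lambda>x. c) \<in> Q n U"
  by (rule polynomial) (auto simp: polynomial_fun_def multiidx_def mpow_def
      intro!: exI[of _ "{\<lambda>_. 0}"] exI[of _ "\<lambda>_. c"])

lemma Q_var:
  assumes U: "openin (Euclidean_space n) U"
  shows "(\<lambda>x. x i) \<in> Q n U"
proof (cases "i < n")
  case True
  have "polynomial_fun n (\<lambda>x. x i)" unfolding polynomial_fun_def
    by (rule exI[of _ "{up (\<lambda>_. 0) i}"], rule exI[of _ "\<lambda>_. 1"])
      (use True in \<open>simp add: multiidx_def mpow_def prod.remove[of "{..<n}" i]\<close>)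
  then show ?thesis by (rule polynomial[OF U])
next
  case False
  then show ?thesis
    by (intro cong[OF U Q_const[OF U, of 0]]) (use openin_Euclidean_space_zero[OF U] in auto)
qed

lemma Q_diff: "\<lbrakk>openin (Euclidean_space n) U; f \<in> Q n U; g \<in> Q n U\<rbrakk> \<Longrightarrow> (\<lambda>x. f x - g x) \<in> Q n U"
  using add[of n U f "\<lambda>x. (-1) * g x"] scale[of n U g "-1"] by simp

lemma Q_sum:
  "openin (Euclidean_space n) U \<Longrightarrow> (\<And>a. a \<in> A \<Longrightarrow> f a \<in> Q n U) \<Longrightarrow> (\<lambda>x. \<Sum>a\<in>A. f a x) \<in> Q n U"
  by (induction A rule: infinite_finite_induct) (simp_all add: Q_const add)

lemma Q_prod:
  "openin (Euclidean_space n) U \<Longrightarrow> (\<And>a. a \<in> A \<Longrightarrow> f a \<in> Q n U) \<Longrightarrow> (\<lambda>x. \<Prod>a\<in>A. f a x) \<in> Q n U"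
  by (induction A rule: infinite_finite_induct) (simp_all add: Q_const mult)

lemma Q_power: "openin (Euclidean_space n) U \<Longrightarrow> f \<in> Q n U \<Longrightarrow> (\<lambda>x. f x ^ k) \<in> Q n U"
  by (induction k) (simp_all add: Q_const mult)

lemma Q_mpow: "openin (Euclidean_space n) U \<Longrightarrow> (\<lambda>x. mpow n x \<mu>) \<in> Q n U"
  unfolding mpow_def by (intro Q_prod Q_power Q_var)

lemma Q_det:
  assumes "openin (Euclidean_space n) U" "\<And>p q. \<lbrakk>p < k; q < k\<rbrakk> \<Longrightarrow> a p q \<in> Q n U"
  shows "(\<lambda>x. Determinant.det (Matrix.mat k k (\<lambda>(p, q). a p q x))) \<in> Q n U"
proof -
  have less: "p i < k" if "p permutes {0..<k}" "i < k" for p i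
    using permutes_in_image[OF that(1), of i] that(2) by simp
  have "(\<lambda>x. \<Sum>p | p permutes {0..<k}. signof p * (\<Prod>i\<in>{0..<k}. a i (p i) x)) \<in> Q n U"
    using assms by (intro Q_sum scale Q_prod) (auto simp: less)
  then show ?thesis
    by (rule cong[OF assms(1)])
      (auto simp: Determinant.det_def less intro!: sum.cong prod.cong)
qed

text \<open>Entries of the adjugate are signed minors, so the numerators in Cramer's rule stay in
  the class.\<close>

lemma Q_adj:
  assumes U: "openin (Euclidean_space n) U" and a: "\<And>p q. \<lbrakk>p < k; q < k\<rbrakk> \<Longrightarrow> a p q \<in> Q n U"
    and ij: "i < k" "j < k"
  shows "(\<lambda>x. adj_mat (Matrix.mat k k (\<lambda>(p, q). a p q x)) $$ (i, j)) \<in> Q n U"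
proof -
  have "(\<lambda>x. (- 1) ^ (j + i) * Determinant.det (Matrix.mat (k - 1) (k - 1)
      (\<lambda>(p, q). a (if p < j then p else Suc p) (if q < i then q else Suc q) x))) \<in> Q n U"
    by (intro scale Q_det U a) (use ij in auto)
  then show ?thesis
  proof (rule cong[OF U])
    fix x
    have "mat_delete (Matrix.mat k k (\<lambda>(p, q). a p q x)) j i = Matrix.mat (k - 1) (k - 1)
        (\<lambda>(p, q). a (if p < j then p else Suc p) (if q < i then q else Suc q) x)"
      unfolding mat_delete_def by (rule Matrix.eq_matI) (use ij in auto)
    then show "adj_mat (Matrix.mat k k (\<lambda>(p, q). a p q x)) $$ (i, j) =
        (- 1) ^ (j + i) * Determinant.det (Matrix.mat (k - 1) (k - 1)
        (\<lambda>(p, q). a (if p < j then p else Suc p) (if q < i then q else Suc q) x))"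
      using ij by (simp add: adj_mat_def cofactor_def)
  qed
qed

lemma partial_deriv_add:
  assumes "openin (Euclidean_space n) U" "f \<in> Q n U" "g \<in> Q n U" "i < n" "x \<in> U"
  shows "partial_deriv i (\<lambda>x. f x + g x) x = partial_deriv i f x + partial_deriv i g x"
  using assms by (intro partial_deriv_eqI DERIV_add smooth_on_deriv smooth)

lemma partial_deriv_mult:
  assumes "openin (Euclidean_space n) U" "f \<in> Q n U" "g \<in> Q n U" "i < n" "x \<in> U"
  shows "partial_deriv i (\<lambda>x. f x * g x) x = partial_deriv i f x * g x + f x * partial_deriv i g x"
proof (rule partial_deriv_eqI)
  show "((\<lambda>t. f (x(i := t)) * g (x(i := t))) has_real_derivative
      partial_deriv i f x * g x + f x * partial_deriv i g x) (at (x i))"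
    using DERIV_mult[OF smooth_on_deriv[OF smooth[OF assms(1,2)] assms(4,5)]
        smooth_on_deriv[OF smooth[OF assms(1,3)] assms(4,5)]]
    by (simp add: algebra_simps)
qed

lemma partial_deriv_sum:
  assumes "openin (Euclidean_space n) U" "finite A" "\<And>a. a \<in> A \<Longrightarrow> f a \<in> Q n U" "i < n" "x \<in> U"
  shows "partial_deriv i (\<lambda>x. \<Sum>a\<in>A. f a x) x = (\<Sum>a\<in>A. partial_deriv i (f a) x)"
  using assms by (intro partial_deriv_eqI DERIV_sum smooth_on_deriv smooth) auto

lemma partial_deriv_var: "partial_deriv i (\<lambda>x. x j) x = (if i = j then 1 else 0)"
  by (rule partial_deriv_eqI) (auto intro: derivative_eq_intros)

lemma partial_deriv_const [simp]: "partial_deriv i (\<lambda>x. c) = (\<lambda>x. 0)"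
  by (simp add: partial_deriv_def)

lemma mpartial_zero_fun [simp]: "mpartial n \<gamma> (\<lambda>x. 0) = (\<lambda>x. 0)"
proof -
  have pow: "(partial_deriv i ^^ k) (\<lambda>x. 0) = (\<lambda>x. 0)" for i k by (induction k) auto
  have "foldr (\<lambda>i. partial_deriv i ^^ \<gamma> i) is (\<lambda>x. 0) = (\<lambda>x. 0)" for "is"
    by (induction "is") (auto simp: pow)
  then show ?thesis by (simp add: mpartial_def)
qed

end

lemma mcoeff_up: "mcoeff F (up \<gamma> i) = mcoeff (mderiv i F) \<gamma> / real (Suc (\<gamma> i))"
  by (simp add: mcoeff_mderiv del: of_nat_Suc)

lemma tendsto_line:
  assumes "openin (Euclidean_space n) U" "smooth_on n U f" "i < n" "x \<in> U"
  shows "((\<lambda>t. f (x(i := t))) \<longlongrightarrow> f x) (at (x i))"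
  using DERIV_isCont[OF smooth_on_deriv[OF assms(2,3,4)]] by (simp add: isCont_def)

context quasianalytic_class
begin

text \<open>The difference \<open>f(x + t e\<^sub>i) - f(x)\<close> vanishes for \<open>t = 0\<close>, hence equals
  \<open>t h(x, t)\<close> with a function \<open>h\<close> of the class in one more variable, and the partial
  derivative is \<open>h(x, 0)\<close>.\<close>

theorem Q_partial:
  assumes U: "openin (Euclidean_space n) U" and f: "f \<in> Q n U" and i: "i < n"
  shows "partial_deriv i f \<in> Q n U"
proof -
  \<comment> \<open>Coordinate number \<open>n\<close> of R^(n+1) plays the role of
    \<open>t\<close>: \<open>\<phi>\<close> forgets it, \<open>\<psi>\<close> adds it to coordinate
    \<open>i\<close>.\<close>
  define \<phi> where "\<phi> z = z(n := 0)" for z :: "nat \<Rightarrow> real"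
  define \<psi> where "\<psi> z = z(i := z i + z n, n := 0)" for z :: "nat \<Rightarrow> real"
  define W where "W = {z. (\<forall>k\<ge>Suc n. z k = 0) \<and> \<phi> z \<in> U} \<inter> {z. (\<forall>k\<ge>Suc n. z k = 0) \<and> \<psi> z \<in> U}"
  have coord: "continuous_on S (\<lambda>z. z k)" for S :: "(nat \<Rightarrow> real) set" and k
    by (rule continuous_on_product_then_coordinatewise[OF continuous_on_id])
  have "openin (Euclidean_space (Suc n)) {z. (\<forall>k\<ge>Suc n. z k = 0) \<and> \<phi> z \<in> U}"
  proof (rule openin_Euclidean_space_preimage[OF U])
    show "continuous_on {z. \<forall>k\<ge>Suc n. z k = 0} (\<lambda>z. \<phi> z k)" for k
      by (cases "k = n") (auto simp: \<phi>_def intro: coord)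
  qed (auto simp: \<phi>_def)
  moreover have "openin (Euclidean_space (Suc n)) {z. (\<forall>k\<ge>Suc n. z k = 0) \<and> \<psi> z \<in> U}"
  proof (rule openin_Euclidean_space_preimage[OF U])
    show "continuous_on {z. \<forall>k\<ge>Suc n. z k = 0} (\<lambda>z. \<psi> z k)" for k
      by (cases "k = n"; cases "k = i") (auto simp: \<psi>_def intro!: continuous_intros coord)
  qed (use i in \<open>auto simp: \<psi>_def\<close>)
  ultimately have W: "openin (Euclidean_space (Suc n)) W" unfolding W_def by (rule openin_Int)
  have "Q_mapping Q (Suc n) W n U \<phi>"
    unfolding Q_mapping_def by (auto simp: W_def \<phi>_def intro!: Q_var[OF W, unfolded W_def \<phi>_def])
  moreover have "Q_mapping Q (Suc n) W n U \<psi>"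
  proof -
    have "(\<lambda>z. \<psi> z k) \<in> Q (Suc n) W" if "k < n" for k
      using that i by (cases "k = i") (auto simp: \<psi>_def intro!: add Q_var W)
    then show ?thesis by (auto simp: Q_mapping_def W_def)
  qed
  ultimately have "(\<lambda>z. f (\<psi> z) - f (\<phi> z)) \<in> Q (Suc n) W"
    using compose[OF W U _ f] by (intro Q_diff W) auto
  moreover have "f (\<psi> z) - f (\<phi> z) = 0" if "z n = 0" for z
    using that by (simp add: \<phi>_def \<psi>_def)
  ultimately obtain h where h: "h \<in> Q (Suc n) W" "\<And>z. z \<in> W \<Longrightarrow> f (\<psi> z) - f (\<phi> z) = (z n - 0) * h z"
    using division[OF W, of n "\<lambda>z. f (\<psi> z) - f (\<phi> z)" 0] by auto
  have xn: "x n = 0" if "x \<in> U" for x using openin_Euclidean_space_zero[OF U that] by simp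
  have UW: "x \<in> W" if "x \<in> U" for x
    using that xn[OF that] openin_Euclidean_space_zero[OF U that] i
    by (auto simp: W_def \<phi>_def \<psi>_def fun_upd_idem)
  \<comment> \<open>A point of R^n already is a point of R^(n+1) with last coordinate 0, so the
    slice \<open>t = 0\<close> is embedded by the identity.\<close>
  have "Q_mapping Q n U (Suc n) W (\<lambda>x. x)"
    using UW by (auto simp: Q_mapping_def intro: Q_var U)
  from compose[OF U W this h(1)] have "h \<in> Q n U" by simp
  then show ?thesis
  proof (rule cong[OF U])
    fix x assume x: "x \<in> U"
    note xW = UW[OF x]
    show "partial_deriv i f x = h x"
    proof (rule partial_deriv_eqI, unfold DERIV_def)
      have "((\<lambda>t. h (x(n := t))) \<longlongrightarrow> h x) (at 0)"
        using tendsto_line[OF W smooth[OF W h(1)] _ xW, of n] xn[OF x] by simp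
      then show "((\<lambda>t. (f (x(i := x i + t)) - f (x(i := x i))) / t) \<longlongrightarrow> h x) (at 0)"
      proof (rule Lim_transform_eventually)
        have "eventually (\<lambda>t. x(n := t) \<in> W) (nhds 0)"
          using eventually_line_in_openin[OF W xW, of n] xn[OF x] by simp
        then have "eventually (\<lambda>t. x(n := t) \<in> W) (at 0)" 
          by (auto simp: eventually_at_filter elim: eventually_mono)
        then show "eventually (\<lambda>t. h (x(n := t)) = (f (x(i := x i + t)) - f (x(i := x i))) / t) (at 0)"
          using eventually_neq_at_within[of 0]
        proof eventually_elim
          case (elim t)
          have "\<psi> (x(n := t)) = x(i := x i + t)" "\<phi> (x(n := t)) = x"
            using i xn[OF x] by (auto simp: \<phi>_def \<psi>_def fun_eq_iff)
          with h(2)[OF elim(1)] elim(2) show ?case by simp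
        qed
      qed
    qed
  qed
qed

lemma Q_mpartial:
  assumes U: "openin (Euclidean_space n) U" and f: "f \<in> Q n U"
  shows "mpartial n \<gamma> f \<in> Q n U"
proof -
  have pow: "(partial_deriv i ^^ k) g \<in> Q n U" if "i < n" "g \<in> Q n U" for i k g
    using that by (induction k) (auto intro: Q_partial[OF U])
  have "foldr (\<lambda>i. partial_deriv i ^^ \<gamma> i) is f \<in> Q n U" if "set is \<subseteq> {..<n}" for "is"
    using that by (induction "is") (use f pow in auto)
  then show ?thesis by (simp add: mpartial_def lessThan_atLeast0)
qed

section \<open>Taylor expansion at a point as a ring homomorphism\<close>

context
  fixes n :: nat and U :: "(nat \<Rightarrow> real) set" and a :: "nat \<Rightarrow> real"
  assumes U: "openin (Euclidean_space n) U" and a: "a \<in> U"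
begin

lemma mderiv_tay_Q: "f \<in> Q n U \<Longrightarrow> i < n \<Longrightarrow> mderiv i (tay n f a) = tay n (partial_deriv i f) a"
  by (rule mderiv_tay[OF U smooth[OF U] _ a])

lemma tay_const: "tay n (\<lambda>x. c) a = mconst c"
proof (rule mderiv_eqI[of n])
  have zero: "mcoeff (tay n (\<lambda>x. 0) a) \<gamma> = 0" for \<gamma>
    by (simp add: tay_def mcoeff_trunc taylor_def)
  fix i assume "i < n"
  then have "mderiv i (tay n (\<lambda>x. c) a) = tay n (\<lambda>x. 0) a"
    by (simp add: mderiv_tay_Q[OF Q_const[OF U]])
  also have "\<dots> = mderiv i (mconst c)"
    by (rule mseries_eqI) (auto simp: zero mcoeff_mderiv mcoeff_mconst fun_eq_iff intro: exI[of _ i])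
  finally show "mderiv i (tay n (\<lambda>x. c) a) = mderiv i (mconst c)" .
qed (auto simp: mcoeff_mconst mcoeff_tay_zero mcoeff_tay_outside multiidx_def)

lemma tay_add:
  assumes "f \<in> Q n U" "g \<in> Q n U"
  shows "tay n (\<lambda>x. f x + g x) a = tay n f a + tay n g a"
proof (rule mseries_eqI)
  fix \<gamma> show "mcoeff (tay n (\<lambda>x. f x + g x) a) \<gamma> = mcoeff (tay n f a + tay n g a) \<gamma>"
  proof (cases "\<gamma> \<in> multiidx n")
    case True
    then show ?thesis using assms
    proof (induction \<gamma> arbitrary: f g rule: multiidx_induct)
      case (up i \<gamma>)
      have "mderiv i (tay n (\<lambda>x. f x + g x) a) =
          tay n (\<lambda>x. partial_deriv i f x + partial_deriv i g x) a"
        unfolding mderiv_tay_Q[OF add[OF U up.prems] up.hyps(1)]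
        by (rule tay_cong[OF U a]) (use up U in \<open>auto intro: partial_deriv_add\<close>)
      then show ?case
        using up.IH[OF Q_partial[OF U _ up.hyps(1)] Q_partial[OF U _ up.hyps(1)]] up.prems up.hyps
        by (simp only: mcoeff_up mderiv_add mderiv_tay_Q) 
    qed (simp add: mcoeff_tay_zero)
  qed (simp add: mcoeff_tay_outside)
qed

text \<open>Both sides obey the Leibniz rule, so a coefficient of the product reduces to lower
  coefficients of products in which one factor is differentiated. The induction therefore ranges
  over all pairs of functions and relies on the class being closed under derivatives.\<close>

lemma tay_mult:
  assumes "f \<in> Q n U" "g \<in> Q n U"
  shows "tay n (\<lambda>x. f x * g x) a = tay n f a * tay n g a"
proof (rule mseries_eqI)
  fix \<gamma> show "mcoeff (tay n (\<lambda>x. f x * g x) a) \<gamma> = mcoeff (tay n f a * tay n g a) \<gamma>"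
  proof (cases "\<gamma> \<in> multiidx n")
    case True
    then show ?thesis using assms
    proof (induction \<gamma> arbitrary: f g rule: multiidx_induct)
      case (up i \<gamma>)
      note d = Q_partial[OF U _ up.hyps(1)]
      have "mderiv i (tay n (\<lambda>x. f x * g x) a) =
          tay n (\<lambda>x. partial_deriv i f x * g x + f x * partial_deriv i g x) a"
        unfolding mderiv_tay_Q[OF mult[OF U up.prems] up.hyps(1)]
        by (rule tay_cong[OF U a]) (use up U in \<open>auto intro: partial_deriv_mult\<close>)
      also have "\<dots> = tay n (\<lambda>x. partial_deriv i f x * g x) a + tay n (\<lambda>x. f x * partial_deriv i g x) a"
        by (intro tay_add mult d U up.prems)
      finally show ?case
        using up.IH[OF d[OF up.prems(1)] up.prems(2)] up.IH[OF up.prems(1) d[OF up.prems(2)]] up.prems up.hyps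
        by (simp only: mcoeff_up mderiv_mult mderiv_tay_Q mcoeff_add)
    qed (simp add: mcoeff_tay_zero mcoeff_mult_zero)
  next
    case False
    have "trunc n (mps_mult (taylor n f a) (taylor n g a)) = tay n f a * tay n g a"
      by (simp add: trunc_mult tay_def)
    then have "mcoeff (tay n f a * tay n g a) \<gamma> = 0" using False by (metis mcoeff_trunc)
    then show ?thesis using False by (simp add: mcoeff_tay_outside)
  qed
qed

lemma tay_sum:
  assumes "finite A" "\<And>k. k \<in> A \<Longrightarrow> f k \<in> Q n U"
  shows "tay n (\<lambda>x. \<Sum>k\<in>A. f k x) a = (\<Sum>k\<in>A. tay n (f k) a)"
  using assms
proof (induction A rule: finite_induct)
  case empty
  show ?case by (rule mseries_eqI) (simp add: tay_const mcoeff_mconst)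
next
  case (insert k A)
  have "tay n (\<lambda>x. f k x + (\<Sum>k\<in>A. f k x)) a = tay n (f k) a + tay n (\<lambda>x. \<Sum>k\<in>A. f k x) a"
    using insert by (intro tay_add Q_sum U) auto
  then show ?case using insert by simp
qed

end

lemma tay_sum_mult:
  assumes U: "openin (Euclidean_space n) U" and a: "a \<in> U"
    and A: "finite A" "\<And>k. k \<in> A \<Longrightarrow> f k \<in> Q n U" "\<And>k. k \<in> A \<Longrightarrow> g k \<in> Q n U"
  shows "tay n (\<lambda>x. \<Sum>k\<in>A. f k x * g k x) a = (\<Sum>k\<in>A. tay n (f k) a * tay n (g k) a)"
proof -
  have "tay n (\<lambda>x. \<Sum>k\<in>A. f k x * g k x) a = (\<Sum>k\<in>A. tay n (\<lambda>x. f k x * g k x) a)"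
    by (intro tay_sum[OF U a A(1)] mult U A)
  also have "\<dots> = (\<Sum>k\<in>A. tay n (f k) a * tay n (g k) a)"
    by (intro sum.cong refl tay_mult[OF U a] A)
  finally show ?thesis .
qed

lemma tay_var_zero:
  assumes U: "openin (Euclidean_space n) U" "(\<lambda>_. 0) \<in> U" and i: "i < n"
  shows "tay n (\<lambda>x. x i) (\<lambda>_. 0) = mvar i"
proof (rule mderiv_eqI[of n])
  fix j assume j: "j < n"
  have pd: "partial_deriv j (\<lambda>x. x i) = (\<lambda>x. if j = i then 1 else 0)"
    by (rule ext) (rule partial_deriv_var)
  have one: "mconst 1 = 1" "mconst 0 = 0" by (rule mseries_eqI; simp add: mcoeff_mconst mcoeff_1)+
  show "mderiv j (tay n (\<lambda>x. x i) (\<lambda>_. 0)) = mderiv j (mvar i)"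
    unfolding mderiv_tay_Q[OF U Q_var[OF U(1)] j] mderiv_mvar pd
    by (auto simp: tay_const[OF U] one)
next
  fix \<gamma> assume "\<gamma> \<notin> multiidx n"
  moreover have "up (\<lambda>_. 0) i \<in> multiidx n" using i by (simp add: multiidx_def)
  ultimately show "mcoeff (tay n (\<lambda>x. x i) (\<lambda>_. 0)) \<gamma> = mcoeff (mvar i) \<gamma>"
    by (auto simp: mcoeff_mvar mcoeff_tay_outside)
qed (auto simp: mcoeff_mvar mcoeff_tay_zero fun_eq_iff)

section \<open>Restriction to hyperplanes and division by monomials\<close>

lemma mpartial_hyperplane_extension:
  assumes U: "openin (Euclidean_space n) U" and W: "openin (Euclidean_space n) W"
    and WU: "\<And>y. y \<in> W \<Longrightarrow> y(i := 0) \<in> U" and i: "i < n" and y: "y \<in> W"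
  shows "mpartial n \<gamma> (\<lambda>y. f (y(i := 0))) y = (if \<gamma> i = 0 then mpartial n \<gamma> f (y(i := 0)) else 0)"
proof -
  have zero: "\<forall>y\<in>W. (partial_deriv j ^^ k) g y = 0" if "\<forall>y\<in>W. g y = 0" "j < n" for g j k
  proof (induction k)
    case (Suc k)
    then have "partial_deriv j ((partial_deriv j ^^ k) g) y = partial_deriv j (\<lambda>_. 0) y" if "y \<in> W" for y
      using that \<open>j < n\<close> by (intro partial_deriv_cong[OF W]) auto
    then show ?case by simp
  qed (use that in auto)
  have step: "\<forall>y\<in>W. partial_deriv j g y = (if j = i then 0 else partial_deriv j h (y(i := 0)))"
    if gh: "\<forall>y\<in>W. g y = h (y(i := 0))" and j: "j < n" for g h j
  proof
    fix y assume y: "y \<in> W"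
    have "partial_deriv j g y = partial_deriv j (\<lambda>y. h (y(i := 0))) y"
      by (rule partial_deriv_cong[OF W y j]) (use gh in auto)
    also have "\<dots> = (if j = i then 0 else partial_deriv j h (y(i := 0)))"
      by (auto simp: partial_deriv_def fun_upd_twist[of i j])
    finally show "partial_deriv j g y = (if j = i then 0 else partial_deriv j h (y(i := 0)))" .
  qed
  have pow: "\<forall>y\<in>W. (partial_deriv j ^^ k) g y = (if j = i \<and> k \<noteq> 0 then 0 else (partial_deriv j ^^ k) h (y(i := 0)))"
    if gh: "\<forall>y\<in>W. g y = h (y(i := 0))" and j: "j < n" for g h j k
  proof (induction k)
    case (Suc k)
    show ?case
    proof (cases "j = i")
      case True
      have "\<forall>y\<in>W. (partial_deriv i ^^ k) (partial_deriv i g) y = 0"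
        by (rule zero) (use step[OF gh j] True i in auto)
      then show ?thesis using True by (simp add: funpow_swap1)
    next
      case False
      then show ?thesis using step[OF _ j, of "(partial_deriv j ^^ k) g" "(partial_deriv j ^^ k) h"] Suc by simp
    qed
  qed (use gh in auto)
  let ?F = "foldr (\<lambda>j. partial_deriv j ^^ \<gamma> j)"
  define g where "g y = f (y(i := 0))" for y
  have "\<forall>y\<in>W. ?F js g y = (if i \<in> set js \<and> \<gamma> i \<noteq> 0 then 0 else ?F js f (y(i := 0)))"
    if "set js \<subseteq> {..<n}" for js
    using that
  proof (induction js)
    case (Cons j js)
    then show ?case
    proof (cases "i \<in> set js \<and> \<gamma> i \<noteq> 0")
      case True
      then show ?thesis using Cons zero[of "?F js g" j "\<gamma> j"] by simp
    next
      case False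
      then show ?thesis
        using Cons pow[of "?F js g" "?F js f" j "\<gamma> j"] by (auto simp del: fun_upd_apply)
    qed
  qed (simp add: g_def)
  from this[of "[0..<n]"] have "\<forall>y\<in>W. ?F [0..<n] g y = (if \<gamma> i \<noteq> 0 then 0 else ?F [0..<n] f (y(i := 0)))"
    using i by (simp add: lessThan_atLeast0)
  then show ?thesis
    using y by (auto simp: mpartial_def g_def[abs_def])
qed

text \<open>An identity theorem on the hyperplane: the points where the restriction of
  \<open>f\<close> is flat form a closed set by continuity and an open one by quasianalyticity, and
  the origin is among them.\<close>

theorem vanishes_on_hyperplane:
  assumes U: "openin (Euclidean_space n) U" "(\<lambda>_. 0) \<in> U" and i: "i < n"
    and conn: "connected {x \<in> U. x i = 0}" and f: "f \<in> Q n U"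
    and coeffs: "\<And>\<gamma>. \<gamma> i = 0 \<Longrightarrow> mcoeff (tay n f (\<lambda>_. 0)) \<gamma> = 0"
    and x: "x \<in> U" "x i = 0"
  shows "f x = 0"
proof -
  define W where "W = {y. (\<forall>k\<ge>n. y k = 0) \<and> y(i := 0) \<in> U}"
  \<comment> \<open>Being constant in direction \<open>i\<close>, \<open>g\<close> has at points of
    the hyperplane only the Taylor coefficients of \<open>f\<close> that are free of
    \<open>x i\<close>. So the restriction of \<open>f\<close> is handled by quasianalyticity in
    \<open>n\<close> variables, without a change of dimension.\<close>
  define g where "g y = f (y(i := 0))" for y :: "nat \<Rightarrow> real"
  define Z where "Z = {x \<in> U. x i = 0}"
  define A where "A = {x \<in> Z. \<forall>\<gamma>\<in>multiidx n. mpartial n \<gamma> g x = 0}"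
  have coord: "continuous_on S (\<lambda>z. z k)" for S :: "(nat \<Rightarrow> real) set" and k
    by (rule continuous_on_product_then_coordinatewise[OF continuous_on_id])
  have W: "openin (Euclidean_space n) W" unfolding W_def
  proof (rule openin_Euclidean_space_preimage[OF U(1)])
    show "continuous_on {z. \<forall>k\<ge>n. z k = 0} (\<lambda>z :: nat \<Rightarrow> real. (z(i := 0)) k)" for k
      by (cases "k = i") (simp_all add: coord)
  qed auto
  have ZW: "Z \<subseteq> W"
    using openin_Euclidean_space_zero[OF U(1)] by (auto simp: Z_def W_def fun_upd_idem)
  have "Q_mapping Q n W n U (\<lambda>y. y(i := 0))"
  proof -
    have "(\<lambda>y. (y(i := 0)) k) \<in> Q n W" for k
      by (cases "k = i") (auto intro: Q_var Q_const W)
    then show ?thesis by (auto simp: Q_mapping_def W_def)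
  qed
  from compose[OF W U(1) this f] have g: "g \<in> Q n W" unfolding g_def .
  have zero: "(\<lambda>_. 0) \<in> A"
  proof -
    have "mpartial n \<gamma> g (\<lambda>_. 0) = 0" if "\<gamma> \<in> multiidx n" for \<gamma>
    proof -
      have "(\<lambda>_. 0) \<in> W" using ZW U(2) by (auto simp: Z_def)
      from mpartial_hyperplane_extension[OF U(1) W _ i this, of \<gamma> f]
      show ?thesis
        using coeffs[of \<gamma>] that by (auto simp: W_def g_def[abs_def] tay_def mcoeff_trunc taylor_def fun_upd_idem)
    qed
    then show ?thesis using U(2) by (simp add: A_def Z_def)
  qed
  have "closedin (top_of_set Z) (\<Inter>\<gamma>\<in>multiidx n. {x \<in> Z. mpartial n \<gamma> g x = 0})"
  proof (rule closedin_INT)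
    show "multiidx n \<noteq> {}" by (auto simp: multiidx_def)
    show "closedin (top_of_set Z) {x \<in> Z. mpartial n \<gamma> g x = 0}" for \<gamma>
      by (rule continuous_closedin_preimage_constant, rule continuous_on_subset[OF smooth_on_continuous ZW])
        (rule smooth[OF W Q_mpartial[OF W g]])
  qed
  moreover have "(\<Inter>\<gamma>\<in>multiidx n. {x \<in> Z. mpartial n \<gamma> g x = 0}) = A"
    by (auto simp: A_def multiidx_def)
  ultimately have closed: "closedin (top_of_set Z) A" by simp
  have "openin (top_of_set Z) A"
  proof (subst openin_subopen, intro ballI)
    fix p assume p: "p \<in> A"
    then have "mps_eq n (taylor n g p) (\<lambda>_. 0)" by (simp add: mps_eq_def taylor_def A_def)
    moreover have "p \<in> W" using p ZW by (auto simp: A_def)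
    ultimately obtain N where N: "openin (Euclidean_space n) N" "p \<in> N" "N \<subseteq> W" "\<forall>x\<in>N. g x = 0"
      using quasianalytic[OF W g] by blast
    have "mpartial n \<gamma> g x = 0" if "x \<in> N" for \<gamma> x
      using mpartial_cong[OF N(1) that, of g "\<lambda>_. 0" \<gamma>] N(4) by simp
    then have "Z \<inter> N \<subseteq> A" by (auto simp: A_def)
    moreover have "openin (top_of_set Z) (Z \<inter> N)"
    proof -
      obtain T where "open T" "N = {x. \<forall>i\<ge>n. x i = 0} \<inter> T"
        using N(1) by (auto simp: openin_Euclidean_space_iff)
      moreover from this have "Z \<inter> N = Z \<inter> T"
        using openin_Euclidean_space_zero[OF U(1)] by (auto simp: Z_def)
      ultimately show ?thesis by (auto simp: openin_open)
    qed
    ultimately show "\<exists>T. openin (top_of_set Z) T \<and> p \<in> T \<and> T \<subseteq> A"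
      using p N(2) by (intro exI[of _ "Z \<inter> N"]) (auto simp: A_def)
  qed
  with closed zero conn have "A = Z"
    unfolding connected_clopen Z_def[symmetric] by blast
  then have "x \<in> A" using x by (simp add: Z_def)
  then have "mpartial n (\<lambda>_. 0) g x = 0" by (auto simp: A_def multiidx_def)
  then show ?thesis using x(2) by (simp add: g_def fun_upd_idem)
qed

text \<open>One variable at a time: a factor \<open>mvar i\<close> in the expansion makes the
  function vanish on the hyperplane, the division axiom gives a quotient on all of \<open>U\<close>,
  and cancelling \<open>mvar i\<close> leaves the same situation for a smaller monomial. The
  cofactor \<open>S\<close> is carried along because the expansion of the final quotient decides
  whether it is again a formal composite.\<close>

theorem monomial_division:
  assumes U: "openin (Euclidean_space n) U" "(\<lambda>_. 0) \<in> U"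
    and conn: "\<And>i. i < n \<Longrightarrow> connected {x \<in> U. x i = 0}"
    and \<mu>: "\<mu> \<in> multiidx n" and f: "f \<in> Q n U"
    and S: "tay n f (\<lambda>_. 0) = tay n (\<lambda>x. mpow n x \<mu>) (\<lambda>_. 0) * S"
  obtains g where "g \<in> Q n U" "\<And>x. x \<in> U \<Longrightarrow> f x = mpow n x \<mu> * g x" "tay n g (\<lambda>_. 0) = S"
proof -
  have "\<exists>g\<in>Q n U. (\<forall>x\<in>U. f x = mpow n x \<mu> * g x) \<and> tay n g (\<lambda>_. 0) = S"
    using \<mu> f S
  proof (induction \<mu> arbitrary: f rule: multiidx_induct)
    case zero
    have "mconst 1 = 1" by (rule mseries_eqI) (simp add: mcoeff_mconst mcoeff_1)
    with zero show ?case by (intro bexI[of _ f]) (auto simp: mpow_def tay_const[OF U])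
  next
    case (up i \<mu>)
    have mpow_up: "mpow n x (up \<mu> i) = x i * mpow n x \<mu>" for x
      using up.hyps(1) by (simp add: mpow_def prod.remove[of "{..<n}" i] mult.assoc)
    have tay_f: "tay n f (\<lambda>_. 0) = mvar i * (tay n (\<lambda>x. mpow n x \<mu>) (\<lambda>_. 0) * S)"
      using up.prems(2) tay_mult[OF U Q_var[OF U(1)] Q_mpow[OF U(1)], of i \<mu>]
      by (simp add: mpow_up tay_var_zero[OF U up.hyps(1)] mult.assoc del: fun_upd_apply)
    have "f x = 0" if "x \<in> U" "x i = 0" for x
      by (rule vanishes_on_hyperplane[OF U up.hyps(1) conn up.prems(1) _ that])
        (use up.hyps in \<open>auto simp: tay_f mcoeff_mvar_mult\<close>)
    then obtain h where h: "h \<in> Q n U" "\<And>x. x \<in> U \<Longrightarrow> f x = (x i - 0) * h x"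
      using division[OF U(1) up.hyps(1) up.prems(1), of 0] by blast
    have "tay n f (\<lambda>_. 0) = tay n (\<lambda>x. x i * h x) (\<lambda>_. 0)"
      by (rule tay_cong[OF U]) (simp add: h)
    also have "\<dots> = mvar i * tay n h (\<lambda>_. 0)"
      by (simp add: tay_mult[OF U Q_var[OF U(1)] h(1)] tay_var_zero[OF U up.hyps(1)])
    finally have "tay n h (\<lambda>_. 0) = tay n (\<lambda>x. mpow n x \<mu>) (\<lambda>_. 0) * S"
      using tay_f by (metis mvar_mult_cancel)
    from up.IH[OF h(1) this] obtain g where "g \<in> Q n U" "\<forall>x\<in>U. h x = mpow n x \<mu> * g x"
      "tay n g (\<lambda>_. 0) = S" by blast
    then show ?case using h(2) by (intro bexI[of _ g]) (auto simp: mpow_up mult.assoc simp del: fun_upd_apply)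
  qed
  then show ?thesis using that by blast
qed

text \<open>Where the variable \<open>x i\<close> is nonzero it can be divided out; a point with
  \<open>x i = 0\<close> is reached as a limit along the coordinate line through it.\<close>

lemma monomial_mult_eq_zero:
  assumes U: "openin (Euclidean_space n) U" and \<mu>: "\<mu> \<in> multiidx n" and f: "f \<in> Q n U"
    and zero: "\<And>x. x \<in> U \<Longrightarrow> mpow n x \<mu> * f x = 0" and x: "x \<in> U"
  shows "f x = 0"
  using \<mu> f zero x
proof (induction \<mu> arbitrary: f x rule: multiidx_induct)
  case zero
  then show ?case by (simp add: mpow_def)
next
  case (up i \<mu>)
  let ?g = "\<lambda>x. x i * f x"
  have mpow_up: "mpow n x (up \<mu> i) = mpow n x \<mu> * x i" for x
    using up.hyps(1) by (simp add: mpow_def prod.remove[of "{..<n}" i] mult.assoc)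
  have g: "?g x = 0" if "x \<in> U" for x
    using up.IH[of ?g x] up.prems(1,2) that mult[OF U Q_var[OF U] up.prems(1)]
    by (simp add: mpow_up mult.assoc del: fun_upd_apply)
  show ?case
  proof (cases "x i = 0")
    case True
    have "eventually (\<lambda>t. x(i := t) \<in> U) (at (x i))"
      using eventually_line_in_openin[OF U up.prems(3) up.hyps(1)]
      by (auto simp: eventually_at_filter elim: eventually_mono)
    then have "eventually (\<lambda>t. f (x(i := t)) = 0) (at (x i))"
      using eventually_neq_at_within[of "x i"]
    proof eventually_elim
      case (elim t)
      then show ?case using g[OF elim(1)] True by simp
    qed
    then have "((\<lambda>t. f (x(i := t))) \<longlongrightarrow> 0) (at (x i))" by (rule tendsto_eventually)
    with tendsto_line[OF U smooth[OF U up.prems(1)] up.hyps(1) up.prems(3)] show ?thesis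
      using tendsto_unique[of "at (x i)"] by (metis trivial_limit_at)
  qed (use g[OF up.prems(3)] in simp)
qed

end

section \<open>Flat functions on connected sets\<close>

text \<open>The length of a path that changes one coordinate after the other, which is how points
  are joined in \<open>box_mean_value_bound\<close>.\<close>

definition dist1 :: "nat \<Rightarrow> (nat \<Rightarrow> real) \<Rightarrow> (nat \<Rightarrow> real) \<Rightarrow> real" where
  "dist1 n x y = (\<Sum>i<n. \<bar>x i - y i\<bar>)"

lemma dist1_nonneg [simp]: "dist1 n x y \<ge> 0"
  by (simp add: dist1_def sum_nonneg)

text \<open>The covering argument of Sard's theorem: \<open>N\<^sup>n\<close> cells of side \<open>2 r / N\<close> have
  images of length \<open>O(N\<^sup>-\<^sup>n\<^sup>-\<^sup>1)\<close>.\<close>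

lemma negligible_image_of_flat_function:
  fixes g :: "(nat \<Rightarrow> real) \<Rightarrow> real"
  assumes X: "X \<subseteq> box_nbhd n p r" and r: "r > 0"
    and flat: "\<And>x y. x \<in> X \<Longrightarrow> y \<in> X \<Longrightarrow> \<bar>g x - g y\<bar> \<le> C * dist1 n x y ^ Suc n"
  shows "negligible (g ` X)"
  unfolding negligible_outer_le
proof (intro allI impI)
  fix e :: real assume e: "e > 0"
  define C' where "C' = max C 0"
  \<comment> \<open>Chosen so that \<open>K / N\<close> is the total length of the covering
    intervals.\<close>
  define K where "K = 2 * C' * (real n * (2 * r)) ^ Suc n"
  have K: "K \<ge> 0" using r by (simp add: K_def C'_def)
  obtain N0 where N0: "real N0 > K / e" using reals_Archimedean2 by blast
  define N where "N = Suc N0"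
  have N: "N > 0" "K / real N \<le> e"
  proof -
    have "K < real N0 * e" using N0 e by (simp add: field_simps)
    also have "\<dots> \<le> real N * e" using e by (simp add: N_def)
    finally show "K / real N \<le> e" by (simp add: N_def field_simps)
  qed (simp add: N_def)
  \<comment> \<open>The flatness bound for two points of one cell, whose \<open>dist1\<close> is at
    most \<open>n\<close> times the side \<open>2 r / N\<close>.\<close>
  define \<delta> where "\<delta> = C' * (real n * (2 * r / real N)) ^ Suc n"
  have \<delta>: "\<delta> \<ge> 0" using r by (simp add: \<delta>_def C'_def)
  \<comment> \<open>The integer coordinates of the cell containing \<open>x\<close>, counted from
    the corner \<open>p - r\<close> of the cube.\<close>
  define c where "c x = restrict (\<lambda>i. nat \<lfloor>(x i - p i + r) * (real N / (2 * r))\<rfloor>) {..<n}" for x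
  define rep where "rep = inv_into X c"
  have c_mem: "c x \<in> {..<n} \<rightarrow>\<^sub>E {..<N}" if "x \<in> X" for x
  proof -
    have "nat \<lfloor>(x i - p i + r) * (real N / (2 * r))\<rfloor> < N" if "i < n" for i
    proof -
      have "\<bar>x i - p i\<bar> < r" using X \<open>x \<in> X\<close> that by (auto simp: box_nbhd_def)
      then have "x i - p i + r < 2 * r" by linarith
      then have "(x i - p i + r) * (real N / (2 * r)) < 2 * r * (real N / (2 * r))"
        using r N(1) by (intro mult_strict_right_mono) auto
      also have "\<dots> = real N" using r by simp
      finally have "\<lfloor>(x i - p i + r) * (real N / (2 * r))\<rfloor> < int N" by (simp add: floor_less_iff)
      then show ?thesis using N(1) by linarith
    qed
    then show ?thesis by (auto simp: c_def)
  qed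
  have c_dist: "dist1 n x y \<le> real n * (2 * r / real N)" if "x \<in> X" "y \<in> X" "c x = c y" for x y
  proof -
    have "\<bar>x i - y i\<bar> \<le> 2 * r / real N" if i: "i < n" for i
    proof -
      let ?k = "\<lambda>x. (x i - p i + r) * (real N / (2 * r))"
      have "\<bar>x i - p i\<bar> < r" "\<bar>y i - p i\<bar> < r"
        using X \<open>x \<in> X\<close> \<open>y \<in> X\<close> i by (auto simp: box_nbhd_def subset_iff)
      then have "0 \<le> x i - p i + r" "0 \<le> y i - p i + r" by linarith+
      then have "0 \<le> ?k x" "0 \<le> ?k y" using r by simp_all
      moreover have "nat \<lfloor>?k x\<rfloor> = nat \<lfloor>?k y\<rfloor>"
        using \<open>c x = c y\<close> i by (auto simp: c_def fun_eq_iff restrict_def split: if_splits)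
      ultimately have "\<lfloor>?k x\<rfloor> = \<lfloor>?k y\<rfloor>" by (simp add: nat_eq_iff)
      then have "\<bar>?k x - ?k y\<bar> \<le> 1" by linarith
      moreover have "?k x - ?k y = (x i - y i) * (real N / (2 * r))"
        unfolding left_diff_distrib[symmetric] by simp
      ultimately have "\<bar>x i - y i\<bar> * (real N / (2 * r)) \<le> 1"
        using r by (simp add: abs_mult)
      then show ?thesis using r N by (simp add: field_simps)
    qed
    then have "dist1 n x y \<le> (\<Sum>i<n. 2 * r / real N)" unfolding dist1_def by (intro sum_mono) auto
    then show ?thesis by simp
  qed
  have fin: "finite (c ` X)"
    by (rule finite_subset[of _ "{..<n} \<rightarrow>\<^sub>E {..<N}"]) (use c_mem in \<open>auto intro: finite_PiE\<close>)
  have card: "card (c ` X) \<le> N ^ n"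
  proof -
    have "card (c ` X) \<le> card ({..<n} \<rightarrow>\<^sub>E {..<N})"
      by (rule card_mono) (use c_mem in \<open>auto intro: finite_PiE\<close>)
    then show ?thesis by (simp add: card_PiE)
  qed
  \<comment> \<open>One interval for each occupied cell, centred at the value at a chosen point of
    \<open>X\<close> in it, since flatness is only available between points of
    \<open>X\<close>.\<close>
  define T where "T = (\<Union>k\<in>c ` X. cbox (g (rep k) - \<delta>) (g (rep k) + \<delta>))"
  have "g ` X \<subseteq> T"
  proof clarify
    fix x assume x: "x \<in> X"
    have rep: "rep (c x) \<in> X" "c (rep (c x)) = c x"
      using x by (auto simp: rep_def inv_into_into f_inv_into_f)
    have "\<bar>g x - g (rep (c x))\<bar> \<le> C * dist1 n x (rep (c x)) ^ Suc n" by (rule flat[OF x rep(1)])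
    also have "\<dots> \<le> C' * dist1 n x (rep (c x)) ^ Suc n"
      by (intro mult_right_mono) (auto simp: C'_def)
    also have "\<dots> \<le> \<delta>" unfolding \<delta>_def
      by (intro mult_left_mono power_mono c_dist x rep) (use rep in \<open>auto simp: C'_def\<close>)
    finally have "g x \<in> cbox (g (rep (c x)) - \<delta>) (g (rep (c x)) + \<delta>)" by (auto simp: abs_le_iff)
    then show "g x \<in> T" using x by (auto simp: T_def)
  qed
  moreover have "T \<in> lmeasurable" unfolding T_def by (intro fmeasurable.finite_UN fin) auto
  moreover have "measure lebesgue T \<le> e"
  proof -
    have "measure lebesgue T \<le> (\<Sum>k\<in>c ` X. measure lebesgue (cbox (g (rep k) - \<delta>) (g (rep k) + \<delta>)))"
      unfolding T_def by (intro measure_UNION_le fin) auto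
    also have "\<dots> = real (card (c ` X)) * (2 * \<delta>)" using \<delta> by simp
    also have "\<dots> \<le> real (N ^ n) * (2 * \<delta>)" using card \<delta> by (intro mult_right_mono) (auto simp del: of_nat_power)
    also have "\<dots> = K / real N" using N(1)
      by (simp add: \<delta>_def K_def power_divide power_mult_distrib field_simps)
    finally show ?thesis using N(2) by linarith
  qed
  ultimately show "\<exists>T. g ` X \<subseteq> T \<and> T \<in> lmeasurable \<and> measure lebesgue T \<le> e" by blast
qed

text \<open>Lindelof's theorem reduces the local hypothesis to a countable union of null sets. A
  connected image with two values would contain the interval between them.\<close>

lemma constant_on_connected_if_locally_negligible:
  fixes g :: "(nat \<Rightarrow> real) \<Rightarrow> real"
  assumes conn: "connected S" and cont: "continuous_on S g"
    and S: "S \<subseteq> {x. \<forall>i\<ge>n. x i = 0}"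
    and loc: "\<And>p. p \<in> S \<Longrightarrow> \<exists>r>0. negligible (g ` (S \<inter> box_nbhd n p r))"
  shows "g constant_on S"
proof -
  obtain r where r: "\<And>p. p \<in> S \<Longrightarrow> r p > 0" "\<And>p. p \<in> S \<Longrightarrow> negligible (g ` (S \<inter> box_nbhd n p (r p)))"
    using loc by metis
  \<comment> \<open>Open in the whole sequence space, as Lindelof's theorem requires; on
    \<open>S\<close> it cuts out the same set as the cube.\<close>
  define T where "T p = {x :: nat \<Rightarrow> real. \<forall>i<n. \<bar>x i - p i\<bar> < r p}" for p
  obtain \<F> where \<F>: "\<F> \<subseteq> T ` S" "countable \<F>" "\<Union>\<F> = \<Union>(T ` S)"
  proof (rule Lindelof)
    show "open X" if "X \<in> T ` S" for X using that open_coordinate_box by (auto simp: T_def)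
  qed blast
  have neg: "negligible (g ` (S \<inter> X))" if X: "X \<in> \<F>" for X
  proof -
    obtain p where "p \<in> S" "X = T p" using X \<F>(1) by auto
    then have "S \<inter> X = S \<inter> box_nbhd n p (r p)" using S by (auto simp: T_def box_nbhd_def)
    then show ?thesis using r(2) \<open>p \<in> S\<close> by simp
  qed
  have "S \<subseteq> \<Union>\<F>" using r(1) unfolding \<F>(3) by (auto simp: T_def)
  then have "g ` S = \<Union>((\<lambda>X. g ` (S \<inter> X)) ` \<F>)" by auto
  moreover have "negligible \<dots>"
    by (rule negligible_countable_Union) (use \<F>(2) neg in auto)
  ultimately have neg: "negligible (g ` S)" by simp
  have "g x = g y" if xy: "x \<in> S" "y \<in> S" for x y
  proof (rule ccontr)
    assume "g x \<noteq> g y"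
    define s t where "s = min (g x) (g y)" and "t = max (g x) (g y)"
    have "s < t" using \<open>g x \<noteq> g y\<close> by (auto simp: s_def t_def)
    have "s \<in> g ` S" "t \<in> g ` S" using xy by (auto simp: s_def t_def min_def max_def)
    then have "{s..t} \<subseteq> g ` S"
      using connected_continuous_image[OF cont conn] by (simp add: connected_contains_Icc)
    then have "negligible (cbox s t)" using neg negligible_subset by (metis box_real(2))
    then have "{s<..<t} = {}" by (metis box_real(1) negligible_interval(1))
    then show False using \<open>s < t\<close> by simp
  qed
  then show ?thesis unfolding constant_on_def by blast
qed

text \<open>Finitely many local estimates share one cube and one constant: radii are minimised and
  constants maximised, the latter being allowed because \<open>\<Psi>\<close> is
  nonnegative.\<close>

lemma uniform_box_bound:
  fixes \<Phi> :: "'a \<Rightarrow> (nat \<Rightarrow> real) \<Rightarrow> (nat \<Rightarrow> real) \<Rightarrow> real"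
  assumes "finite A"
    and "\<And>k. k \<in> A \<Longrightarrow> \<exists>r>0. \<exists>C. \<forall>x\<in>box_nbhd n p r. \<forall>y\<in>box_nbhd n p r. \<Phi> k x y \<le> C * \<Psi> x y"
    and "\<And>x y. \<Psi> x y \<ge> 0"
  shows "\<exists>r>0. \<exists>C\<ge>0. \<forall>k\<in>A. \<forall>x\<in>box_nbhd n p r. \<forall>y\<in>box_nbhd n p r. \<Phi> k x y \<le> C * \<Psi> x y"
  using assms(1,2)
proof (induction A rule: finite_induct)
  case empty
  show ?case by (intro exI[of _ 1] conjI exI[of _ 0]) auto
next
  case (insert k A)
  obtain r C where r: "r > 0" "C \<ge> 0"
    "\<forall>k\<in>A. \<forall>x\<in>box_nbhd n p r. \<forall>y\<in>box_nbhd n p r. \<Phi> k x y \<le> C * \<Psi> x y"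
    using insert by auto
  obtain s D where s: "s > 0" "\<forall>x\<in>box_nbhd n p s. \<forall>y\<in>box_nbhd n p s. \<Phi> k x y \<le> D * \<Psi> x y"
    using insert.prems by blast
  have "\<Phi> j x y \<le> max C D * \<Psi> x y"
    if "j \<in> insert k A" "x \<in> box_nbhd n p (min r s)" "y \<in> box_nbhd n p (min r s)" for j x y
  proof -
    have "C * \<Psi> x y \<le> max C D * \<Psi> x y" "D * \<Psi> x y \<le> max C D * \<Psi> x y"
      using assms(3) by (auto intro: mult_right_mono)
    moreover have "x \<in> box_nbhd n p r" "y \<in> box_nbhd n p r" "x \<in> box_nbhd n p s" "y \<in> box_nbhd n p s"
      using that by (auto simp: box_nbhd_def)
    ultimately show ?thesis using r(3) s(2) that(1) by (metis insert_iff order_trans)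
  qed
  then show ?case using r s by (intro exI[of _ "min r s"] conjI exI[of _ "max C D"]) auto
qed

text \<open>The path from \<open>a\<close> to \<open>x\<close> replaces one coordinate at a time. It
  stays in the cube and never gets farther from \<open>a\<close> than \<open>x\<close>; asking for
  the derivative bound only at such points lets \<open>B\<close> depend on
  \<open>dist1 n x a\<close>.\<close>

lemma box_mean_value_bound:
  assumes U: "openin (Euclidean_space n) U" and g: "smooth_on n U g" and box: "box_nbhd n p r \<subseteq> U"
    and x: "x \<in> box_nbhd n p r" and a: "a \<in> box_nbhd n p r"
    and bound: "\<And>z i. \<lbrakk>z \<in> box_nbhd n p r; dist1 n z a \<le> dist1 n x a; i < n\<rbrakk> \<Longrightarrow> \<bar>partial_deriv i g z\<bar> \<le> B"
  shows "\<bar>g x - g a\<bar> \<le> B * dist1 n x a"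
proof -
  define z where "z k j = (if j < k then x j else a j)" for k j :: nat
  have "\<bar>g (z k) - g a\<bar> \<le> B * (\<Sum>j<k. \<bar>x j - a j\<bar>)" if "k \<le> n" for k
    using that
  proof (induction k)
    case 0
    have "z 0 = a" by (auto simp: z_def)
    then show ?case by simp
  next
    case (Suc k)
    have z: "z (Suc k) = (z k)(k := x k)" "z k = (z k)(k := a k)"
      by (auto simp: z_def fun_eq_iff less_Suc_eq)
    have seg: "(z k)(k := t) \<in> box_nbhd n p r" "dist1 n ((z k)(k := t)) a \<le> dist1 n x a"
      if t: "t \<in> closed_segment (a k) (x k)" for t
    proof -
      have t': "\<bar>t - a k\<bar> \<le> \<bar>x k - a k\<bar>" "min (a k) (x k) \<le> t" "t \<le> max (a k) (x k)"
        using t by (auto simp: closed_segment_eq_real_ivl split: if_splits)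
      have "\<bar>x k - p k\<bar> < r" "\<bar>a k - p k\<bar> < r" using x a Suc.prems by (auto simp: box_nbhd_def)
      then have "\<bar>t - p k\<bar> < r" using t'(2,3) by (auto simp: min_def max_def split: if_splits)
      then show "(z k)(k := t) \<in> box_nbhd n p r"
        using x a Suc.prems by (auto simp: box_nbhd_def z_def)
      show "dist1 n ((z k)(k := t)) a \<le> dist1 n x a"
        unfolding dist1_def by (intro sum_mono) (use t'(1) in \<open>auto simp: z_def\<close>)
    qed
    have "norm (g ((z k)(k := x k)) - g ((z k)(k := a k))) \<le> B * norm (x k - a k)"
    proof (rule field_differentiable_bound[of "closed_segment (a k) (x k)"
          "\<lambda>t. g ((z k)(k := t))" "\<lambda>t. partial_deriv k g ((z k)(k := t))"])
      fix t assume t: "t \<in> closed_segment (a k) (x k)"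
      show "((\<lambda>t. g ((z k)(k := t))) has_field_derivative partial_deriv k g ((z k)(k := t)))
          (at t within closed_segment (a k) (x k))"
        by (rule has_field_derivative_at_within, rule smooth_on_line_deriv[OF g])
          (use seg[OF t] box Suc.prems in auto)
      show "norm (partial_deriv k g ((z k)(k := t))) \<le> B"
        using bound[OF seg[OF t]] Suc.prems by simp
    qed auto
    then have "\<bar>g (z (Suc k)) - g (z k)\<bar> \<le> B * \<bar>x k - a k\<bar>" using z by simp
    moreover have "\<bar>g (z k) - g a\<bar> \<le> B * (\<Sum>j<k. \<bar>x j - a j\<bar>)" using Suc by simp
    ultimately show ?case by (simp add: distrib_left)
  qed
  moreover have "z n = x" using x a by (auto simp: z_def box_nbhd_def fun_eq_iff)
  ultimately show ?thesis by (metis dist1_def order_refl)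
qed

section \<open>Mappings with monomial Jacobian determinant\<close>

locale monomial_jacobian_map = quasianalytic_class +
  fixes n :: nat and U :: "(nat \<Rightarrow> real) set" and \<sigma> :: "(nat \<Rightarrow> real) \<Rightarrow> nat \<Rightarrow> real"
    and \<mu> :: "nat \<Rightarrow> nat" and u :: "(nat \<Rightarrow> real) \<Rightarrow> real"
  assumes U: "openin (Euclidean_space n) U" and zero_mem: "(\<lambda>_. 0) \<in> U"
    and hyperplanes: "\<And>i. i < n \<Longrightarrow> connected {x \<in> U. x i = 0}"
    and \<sigma>: "\<And>l. l < n \<Longrightarrow> (\<lambda>x. \<sigma> x l) \<in> Q n U"
    and \<mu>: "\<mu> \<in> multiidx n" and u: "unit_in Q n U u"
    and det: "\<And>x. x \<in> U \<Longrightarrow> Determinant.det (jacobian_matrix n \<sigma> x) = mpow n x \<mu> * u x"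
begin

section \<open>The Jacobian matrix, its adjugate, and cancellation\<close>

abbreviation J :: "nat \<Rightarrow> nat \<Rightarrow> (nat \<Rightarrow> real) \<Rightarrow> real" where
  "J l i \<equiv> partial_deriv i (\<lambda>x. \<sigma> x l)"

definition adj :: "nat \<Rightarrow> nat \<Rightarrow> (nat \<Rightarrow> real) \<Rightarrow> real" where
  "adj i j x = adj_mat (jacobian_matrix n \<sigma> x) $$ (i, j)"

lemma Q_J: "l < n \<Longrightarrow> i < n \<Longrightarrow> J l i \<in> Q n U"
  by (intro Q_partial U \<sigma>)

lemma Q_adj_jacobian: "i < n \<Longrightarrow> j < n \<Longrightarrow> adj i j \<in> Q n U"
  unfolding adj_def[abs_def] jacobian_matrix_def by (intro Q_adj U Q_J)

lemma J_adj:
  assumes "l < n" "j < n"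
  shows "(\<Sum>i<n. J l i x * adj i j x) = (if l = j then Determinant.det (jacobian_matrix n \<sigma> x) else 0)"
proof -
  let ?A = "jacobian_matrix n \<sigma> x"
  have A: "?A \<in> carrier_mat n n" by (simp add: jacobian_matrix_def)
  have "(?A * adj_mat ?A) $$ (l, j) = (\<Sum>i<n. J l i x * adj i j x)"
    using assms adj_mat(1)[OF A] A
    by (auto simp: scalar_prod_def adj_def lessThan_atLeast0 jacobian_matrix_def intro!: sum.cong)
  then show ?thesis using assms by (cases "l = j") (simp_all add: adj_mat(2)[OF A])
qed

lemma adj_J:
  assumes "m < n" "i < n"
  shows "(\<Sum>l<n. adj m l x * J l i x) = (if m = i then Determinant.det (jacobian_matrix n \<sigma> x) else 0)"
proof -
  let ?A = "jacobian_matrix n \<sigma> x"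
  have A: "?A \<in> carrier_mat n n" by (simp add: jacobian_matrix_def)
  have "(adj_mat ?A * ?A) $$ (m, i) = (\<Sum>l<n. adj m l x * J l i x)"
    using assms adj_mat(1)[OF A] A
    by (auto simp: scalar_prod_def adj_def lessThan_atLeast0 jacobian_matrix_def intro!: sum.cong)
  then show ?thesis using assms by (cases "m = i") (simp_all add: adj_mat(3)[OF A])
qed

lemma det_cancel:
  assumes "d \<in> Q n U" "\<And>x. x \<in> U \<Longrightarrow> Determinant.det (jacobian_matrix n \<sigma> x) * d x = 0" "x \<in> U"
  shows "d x = 0"
proof -
  obtain v where v: "\<And>x. x \<in> U \<Longrightarrow> u x * v x = 1" and uQ: "u \<in> Q n U"
    using u by (auto simp: unit_in_def)
  have "u x * d x = 0"
    by (rule monomial_mult_eq_zero[OF U \<mu> _ _ assms(3)])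
      (use assms(2) det in \<open>auto intro!: mult U uQ assms(1)\<close>)
  then show ?thesis using v[OF assms(3)] by auto
qed

text \<open>At a point where the Jacobian matrix is singular the relation does not force
  \<open>d\<close> to vanish. Multiplying by the adjugate turns it into a relation with the
  determinant alone, which cancels on all of \<open>U\<close>.\<close>

lemma J_cancel:
  assumes d: "\<And>l. l < n \<Longrightarrow> d l \<in> Q n U"
    and zero: "\<And>i x. \<lbrakk>i < n; x \<in> U\<rbrakk> \<Longrightarrow> (\<Sum>l<n. d l x * J l i x) = 0"
    and j: "j < n" and x: "x \<in> U"
  shows "d j x = 0"
proof (rule det_cancel[OF d[OF j] _ x])
  fix x assume x: "x \<in> U"
  have "0 = (\<Sum>i<n. (\<Sum>l<n. d l x * J l i x) * adj i j x)" using zero x by simp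
  also have "\<dots> = (\<Sum>l<n. d l x * (\<Sum>i<n. J l i x * adj i j x))"
    unfolding sum_distrib_right sum_distrib_left by (subst sum.swap) (simp add: mult.assoc)
  also have "\<dots> = (\<Sum>l<n. if l = j then d j x * Determinant.det (jacobian_matrix n \<sigma> x) else 0)"
    by (rule sum.cong) (auto simp: J_adj j)
  also have "\<dots> = Determinant.det (jacobian_matrix n \<sigma> x) * d j x" using j by simp
  finally show "Determinant.det (jacobian_matrix n \<sigma> x) * d j x = 0" by simp
qed

section \<open>Formal composites and derivation along the target coordinates\<close>

lemma mderiv_taylor_map:
  assumes "a \<in> U" "l < n" "i < n"
  shows "mderiv i (trunc n (taylor_map n \<sigma> a l)) = tay n (J l i) a"
proof -
  have *: "(\<lambda>x. \<sigma> x l - \<sigma> a l) \<in> Q n U" by (intro Q_diff Q_const U \<sigma> assms)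
  have "trunc n (taylor_map n \<sigma> a l) = tay n (\<lambda>x. \<sigma> x l - \<sigma> a l) a"
    by (simp add: tay_def taylor_map_def)
  then have "mderiv i (trunc n (taylor_map n \<sigma> a l)) = tay n (partial_deriv i (\<lambda>x. \<sigma> x l - \<sigma> a l)) a"
    by (simp add: mderiv_tay_Q[OF U assms(1) * assms(3)])
  also have "\<dots> = tay n (J l i) a"
  proof (rule tay_cong[OF U assms(1)], rule partial_deriv_eqI)
    fix y assume "y \<in> U"
    from DERIV_diff[OF smooth_on_deriv[OF smooth[OF U \<sigma>[OF assms(2)]] assms(3) this] DERIV_const]
    show "((\<lambda>t. \<sigma> (y(i := t)) l - \<sigma> a l) has_real_derivative J l i y) (at (y i))" by simp
  qed
  finally show ?thesis .
qed

lemma taylor_map_zero: "taylor_map n \<sigma> a l (\<lambda>_. 0) = 0"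
  by (simp add: taylor_map_def taylor_def)

lemma mderiv_mcompose_taylor_map:
  assumes "a \<in> U" "i < n"
  shows "mderiv i (mcompose n H (taylor_map n \<sigma> a)) =
    (\<Sum>l<n. mcompose n (mps_deriv l H) (taylor_map n \<sigma> a) * tay n (J l i) a)"
  unfolding mderiv_mcompose[where G = "taylor_map n \<sigma> a", OF taylor_map_zero assms(2)]
  by (rule sum.cong) (use assms in \<open>simp_all add: mderiv_taylor_map\<close>)

text \<open>The hypothesis on \<open>f\<close> with the outer series left unspecified: a target
  derivation replaces it by its derivative, so a fixed series would not give a stable set.\<close>

definition formally_composite :: "((nat \<Rightarrow> real) \<Rightarrow> real) set" where
  "formally_composite =
     {g \<in> Q n U. \<exists>H. tay n g (\<lambda>_. 0) = mcompose n H (taylor_map n \<sigma> (\<lambda>_. 0))}"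

text \<open>Membership of each \<open>G j\<close> in \<open>formally_composite\<close> is what
  allows the construction to be repeated.\<close>

definition target_partials ::
  "((nat \<Rightarrow> real) \<Rightarrow> real) \<Rightarrow> (nat \<Rightarrow> (nat \<Rightarrow> real) \<Rightarrow> real) \<Rightarrow> bool" where
  "target_partials g G \<longleftrightarrow> (\<forall>j<n. G j \<in> formally_composite) \<and>
     (\<forall>i<n. \<forall>x\<in>U. partial_deriv i g x = (\<Sum>l<n. G l x * J l i x))"

lemma target_partials_exist:
  assumes "g \<in> formally_composite"
  shows "\<exists>G. target_partials g G"
proof -
  let ?z = "\<lambda>_ :: nat. 0 :: real" and ?det = "\<lambda>x. Determinant.det (jacobian_matrix n \<sigma> x)"
  let ?C = "\<lambda>H. mcompose n H (taylor_map n \<sigma> ?z)"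
  obtain H where g: "g \<in> Q n U" and H: "tay n g ?z = ?C H"
    using assms by (auto simp: formally_composite_def)
  obtain v where v: "\<And>x. x \<in> U \<Longrightarrow> u x * v x = 1" "v \<in> Q n U" and uQ: "u \<in> Q n U"
    using u by (auto simp: unit_in_def)
  note hom = tay_mult[OF U zero_mem]
  \<comment> \<open>The numerators of Cramer's rule: for any solution \<open>G\<close> of the
    system, \<open>K j\<close> is the determinant times \<open>G j\<close>.\<close>
  define K where "K j x = (\<Sum>i<n. partial_deriv i g x * adj i j x)" for j x
  have KQ: "K j \<in> Q n U" if "j < n" for j
    unfolding K_def by (intro Q_sum mult U Q_partial g Q_adj_jacobian) (use that in auto)
  have tay_det: "tay n ?det ?z = tay n (\<lambda>x. mpow n x \<mu>) ?z * tay n u ?z"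
  proof -
    have "tay n ?det ?z = tay n (\<lambda>x. mpow n x \<mu> * u x) ?z"
      by (rule tay_cong[OF U zero_mem]) (rule det)
    then show ?thesis by (simp add: hom Q_mpow U uQ)
  qed
  \<comment> \<open>At the origin the chain rule supplies a formal solution, the derivatives of
    \<open>H\<close> composed with \<open>\<sigma>\<close>; the adjugate identity isolates its
    \<open>j\<close>-th component.\<close>
  have tay_K: "tay n (K j) ?z = tay n (\<lambda>x. mpow n x \<mu>) ?z * (tay n u ?z * ?C (mps_deriv j H))"
    if j: "j < n" for j
  proof -
    have "tay n (K j) ?z = (\<Sum>i<n. tay n (partial_deriv i g) ?z * tay n (adj i j) ?z)"
        unfolding K_def by (intro tay_sum_mult[OF U zero_mem] Q_partial U g Q_adj_jacobian j) auto
    also have "\<dots> = (\<Sum>i<n. (\<Sum>l<n. ?C (mps_deriv l H) * tay n (J l i) ?z) * tay n (adj i j) ?z)"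
      by (rule sum.cong)
        (simp_all flip: mderiv_tay_Q[OF U zero_mem g] mderiv_mcompose_taylor_map[OF zero_mem] add: H)
    also have "\<dots> = (\<Sum>l<n. ?C (mps_deriv l H) * (\<Sum>i<n. tay n (J l i) ?z * tay n (adj i j) ?z))"
      unfolding sum_distrib_right sum_distrib_left by (subst sum.swap) (simp add: mult.assoc)
    also have "\<dots> = (\<Sum>l<n. ?C (mps_deriv l H) * tay n (\<lambda>x. \<Sum>i<n. J l i x * adj i j x) ?z)"
      by (intro sum.cong refl arg_cong2[where f = "(*)"] tay_sum_mult[OF U zero_mem, symmetric]
          Q_J Q_adj_jacobian j) auto
    also have "\<dots> = (\<Sum>l<n. if l = j then ?C (mps_deriv j H) * tay n ?det ?z else 0)"
    proof (rule sum.cong[OF refl])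
      have "mconst 0 = 0" by (rule mseries_eqI) (simp add: mcoeff_mconst)
      then show "?C (mps_deriv l H) * tay n (\<lambda>x. \<Sum>i<n. J l i x * adj i j x) ?z =
          (if l = j then ?C (mps_deriv j H) * tay n ?det ?z else 0)" if "l \<in> {..<n}" for l
        using that j by (simp add: J_adj tay_const[OF U zero_mem])
    qed
    also have "\<dots> = ?C (mps_deriv j H) * tay n ?det ?z" using j by simp
    finally show ?thesis by (simp add: tay_det mult_ac)
  qed
  have "\<exists>g'. g' \<in> Q n U \<and> (\<forall>x\<in>U. K j x = mpow n x \<mu> * g' x) \<and> tay n g' ?z = tay n u ?z * ?C (mps_deriv j H)"
    if "j < n" for j
    using monomial_division[OF U zero_mem hyperplanes \<mu> KQ[OF that] tay_K[OF that]] by metis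
  then obtain G' where G': "\<And>j. j < n \<Longrightarrow> G' j \<in> Q n U"
    "\<And>j x. j < n \<Longrightarrow> x \<in> U \<Longrightarrow> K j x = mpow n x \<mu> * G' j x"
    "\<And>j. j < n \<Longrightarrow> tay n (G' j) ?z = tay n u ?z * ?C (mps_deriv j H)"
    by metis
  \<comment> \<open>Division removed only the monomial; the other factor \<open>u\<close> of the
    determinant is removed by its inverse \<open>v\<close>, both in the function and in its
    expansion.\<close>
  define G where "G j x = G' j x * v x" for j x
  have GQ: "G j \<in> Q n U" if "j < n" for j
    unfolding G_def by (intro mult U G' v that)
  have K_G: "K j x = ?det x * G j x" if "j < n" "x \<in> U" for j x
    using G'(2)[OF that] v(1)[OF that(2)] det[OF that(2)] by (simp add: G_def mult_ac) 
  have one: "tay n u ?z * tay n v ?z = 1"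
  proof -
    have "tay n u ?z * tay n v ?z = tay n (\<lambda>x. u x * v x) ?z" by (simp add: hom uQ v)
    also have "\<dots> = tay n (\<lambda>x. 1) ?z" by (rule tay_cong[OF U zero_mem]) (rule v)
    also have "\<dots> = 1" 
      unfolding tay_const[OF U zero_mem] by (rule mseries_eqI) (simp add: mcoeff_mconst mcoeff_1)
    finally show ?thesis .
  qed
  have "G j \<in> formally_composite" if "j < n" for j
  proof -
    have "tay n (G j) ?z = (tay n u ?z * tay n v ?z) * ?C (mps_deriv j H)"
      unfolding G_def by (simp add: hom G' v that mult_ac)
    then show ?thesis using GQ[OF that] one by (auto simp: formally_composite_def)
  qed
  \<comment> \<open>So far \<open>G\<close> satisfies the system only after contraction with the
    adjugate. Multiplied by the determinant, the system follows from the adjugate identity on the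
    other side.\<close>
  moreover have "partial_deriv i g x = (\<Sum>l<n. G l x * J l i x)" if i: "i < n" and x: "x \<in> U" for i x
  proof -
    let ?d = "\<lambda>x. partial_deriv i g x - (\<Sum>l<n. G l x * J l i x)"
    have "?d x = 0"
    proof (rule det_cancel[OF _ _ x])
      show "?d \<in> Q n U" by (intro Q_diff Q_sum mult U GQ Q_J Q_partial g i; simp)
      fix x assume x: "x \<in> U"
      have "?det x * (\<Sum>l<n. G l x * J l i x) = (\<Sum>l<n. K l x * J l i x)"
        by (simp add: sum_distrib_left K_G x mult.assoc)
      also have "\<dots> = (\<Sum>m<n. partial_deriv m g x * (\<Sum>l<n. adj m l x * J l i x))"
        unfolding K_def sum_distrib_right sum_distrib_left by (subst sum.swap) (simp add: mult.assoc)
      also have "\<dots> = (\<Sum>m<n. if m = i then partial_deriv i g x * ?det x else 0)"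
        by (rule sum.cong) (auto simp: adj_J i)
      also have "\<dots> = ?det x * partial_deriv i g x" using i by simp
      finally show "?det x * ?d x = 0" by (simp only: right_diff_distrib)
    qed
    then show ?thesis by simp
  qed
  ultimately show ?thesis unfolding target_partials_def by blast
qed

text \<open>A choice of representatives: solutions of the system are determined on \<open>U\<close>
  only, so everything below is stated as equality on \<open>U\<close>.\<close>

definition tderiv :: "nat \<Rightarrow> ((nat \<Rightarrow> real) \<Rightarrow> real) \<Rightarrow> (nat \<Rightarrow> real) \<Rightarrow> real" where
  "tderiv j g = (SOME G. target_partials g G) j"

lemma
  assumes "g \<in> formally_composite"
  shows tderiv_formally_composite: "j < n \<Longrightarrow> tderiv j g \<in> formally_composite"
    and partial_deriv_tderiv:
      "\<lbrakk>i < n; x \<in> U\<rbrakk> \<Longrightarrow> partial_deriv i g x = (\<Sum>l<n. tderiv l g x * J l i x)"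
proof -
  define G where "G = (SOME G. target_partials g G)"
  have G: "target_partials g G"
    unfolding G_def using target_partials_exist[OF assms] by (rule someI_ex)
  have "tderiv j g = G j" for j by (rule ext) (simp add: tderiv_def G_def)
  with G show "j < n \<Longrightarrow> tderiv j g \<in> formally_composite"
    "\<lbrakk>i < n; x \<in> U\<rbrakk> \<Longrightarrow> partial_deriv i g x = (\<Sum>l<n. tderiv l g x * J l i x)"
    by (simp_all add: target_partials_def)
qed

lemma formally_composite_Q: "g \<in> formally_composite \<Longrightarrow> g \<in> Q n U"
  by (simp add: formally_composite_def)

lemma Q_tderiv: "g \<in> formally_composite \<Longrightarrow> j < n \<Longrightarrow> tderiv j g \<in> Q n U"
  by (intro formally_composite_Q tderiv_formally_composite)

text \<open>The difference of the two solutions satisfies the homogeneous system, which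
  \<open>J_cancel\<close> makes trivial.\<close>

lemma tderiv_cong:
  assumes "j < n" "g \<in> formally_composite" "h \<in> formally_composite" "\<And>x. x \<in> U \<Longrightarrow> g x = h x" "x \<in> U"
  shows "tderiv j g x = tderiv j h x"
proof -
  have "(\<lambda>x. tderiv j g x - tderiv j h x) x = 0"
  proof (rule J_cancel[where d = "\<lambda>j x. tderiv j g x - tderiv j h x", OF _ _ assms(1,5)])
    fix i x assume i: "i < n" and x: "x \<in> U"
    have "partial_deriv i g x = partial_deriv i h x" by (rule partial_deriv_cong[OF U x i]) (rule assms)
    then show "(\<Sum>l<n. (tderiv l g x - tderiv l h x) * J l i x) = 0"
      using partial_deriv_tderiv[OF assms(2) i x] partial_deriv_tderiv[OF assms(3) i x]
      by (simp add: left_diff_distrib sum_subtractf)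
  qed (intro Q_diff U Q_tderiv assms)
  then show ?thesis by simp
qed

text \<open>Differentiating the defining relation once more and using the symmetry of second derivatives,
  the antisymmetric matrix \<open>A\<close> of the commutators satisfies \<open>J\<^sup>T A J = 0\<close>.\<close>

lemma tderiv_commute:
  assumes jk: "j < n" "k < n" and g: "g \<in> formally_composite" and x: "x \<in> U"
  shows "tderiv j (tderiv k g) x = tderiv k (tderiv j g) x"
proof -
  define A where "A k l x = tderiv k (tderiv l g) x - tderiv l (tderiv k g) x" for k l x
  have AQ: "A k l \<in> Q n U" if "k < n" "l < n" for k l
    unfolding A_def by (intro Q_diff U Q_tderiv tderiv_formally_composite g that)
  \<comment> \<open>The part of the second derivative of \<open>g\<close> that contains second
    target derivatives. The other part contains second derivatives of \<open>\<sigma>\<close> and is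
    symmetric in \<open>m\<close> and \<open>i\<close>, hence so is \<open>S\<close>.\<close>
  define S where "S m i x = (\<Sum>l<n. \<Sum>k<n. tderiv k (tderiv l g) x * J k m x * J l i x)" for m i x
  have second: "partial_deriv m (partial_deriv i g) x =
      S m i x + (\<Sum>l<n. tderiv l g x * partial_deriv m (J l i) x)"
    if mi: "m < n" "i < n" and x: "x \<in> U" for m i x
  proof -
    have "partial_deriv m (partial_deriv i g) x = partial_deriv m (\<lambda>x. \<Sum>l<n. tderiv l g x * J l i x) x"
      by (rule partial_deriv_cong[OF U x mi(1)]) (rule partial_deriv_tderiv[OF g mi(2)])
    also have "\<dots> = (\<Sum>l<n. partial_deriv m (\<lambda>x. tderiv l g x * J l i x) x)"
      by (rule partial_deriv_sum[OF U _ _ mi(1) x]) (auto intro!: mult U Q_tderiv g Q_J mi)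
    also have "\<dots> = (\<Sum>l<n. partial_deriv m (tderiv l g) x * J l i x + tderiv l g x * partial_deriv m (J l i) x)"
      by (intro sum.cong refl partial_deriv_mult[OF U _ _ mi(1) x] Q_tderiv Q_J g mi) auto
    also have "\<dots> = (\<Sum>l<n. (\<Sum>k<n. tderiv k (tderiv l g) x * J k m x) * J l i x
        + tderiv l g x * partial_deriv m (J l i) x)"
      by (intro sum.cong refl) (simp add: partial_deriv_tderiv[OF tderiv_formally_composite[OF g] mi(1) x])
    finally show ?thesis by (simp add: S_def sum.distrib sum_distrib_right)
  qed
  have S_sym: "S m i x = S i m x" if mi: "m < n" "i < n" and x: "x \<in> U" for m i x
  proof -
    have "partial_deriv m (J l i) x = partial_deriv i (J l m) x" if "l < n" for l
      by (rule partial_deriv_commute[OF U smooth[OF U \<sigma>[OF that]] mi x])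
    then show ?thesis
      using second[OF mi x] second[OF mi(2,1) x] 
        partial_deriv_commute[OF U smooth[OF U formally_composite_Q[OF g]] mi x] by simp
  qed
  \<comment> \<open>One Jacobian factor is cancelled here for fixed \<open>m\<close>, the other one
    afterwards.\<close>
  have "(\<Sum>k<n. A k l x * J k m x) = 0" if lm: "l < n" "m < n" and x: "x \<in> U" for l m x
  proof (rule J_cancel[where d = "\<lambda>l x. \<Sum>k<n. A k l x * J k m x", OF _ _ lm(1) x])
    show "(\<lambda>x. \<Sum>k<n. A k l x * J k m x) \<in> Q n U" if "l < n" for l
      by (intro Q_sum mult U AQ Q_J that lm) auto
    fix i x assume i: "i < n" and x: "x \<in> U"
    have "S i m x = (\<Sum>l<n. \<Sum>k<n. tderiv l (tderiv k g) x * J k m x * J l i x)"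
      unfolding S_def by (subst sum.swap) (simp add: mult_ac)
    then have "(\<Sum>l<n. (\<Sum>k<n. A k l x * J k m x) * J l i x) = S m i x - S i m x"
      unfolding A_def S_def by (simp add: sum_distrib_right left_diff_distrib sum_subtractf)
    then show "(\<Sum>l<n. (\<Sum>k<n. A k l x * J k m x) * J l i x) = 0" using S_sym[OF lm(2) i x] by simp
  qed
  then have "A j k x = 0"
    using J_cancel[where d = "\<lambda>j x. A j k x", OF AQ[OF _ jk(2)] _ jk(1) x] jk(2) by blast
  then show ?thesis by (simp add: A_def)
qed

section \<open>Iterated target derivatives and their expansions at arbitrary points\<close>

context
  fixes f :: "(nat \<Rightarrow> real) \<Rightarrow> real"
  assumes f: "f \<in> formally_composite"
begin

definition tpartial :: "(nat \<Rightarrow> nat) \<Rightarrow> (nat \<Rightarrow> real) \<Rightarrow> real" where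
  "tpartial \<beta> = foldr (\<lambda>i. tderiv i ^^ \<beta> i) [0..<n] f"

lemma tpartial_formally_composite: "tpartial \<beta> \<in> formally_composite"
  and tderiv_tpartial: "j < n \<Longrightarrow> x \<in> U \<Longrightarrow> tderiv j (tpartial \<beta>) x = tpartial (up \<beta> j) x"
proof -
  have closed: "\<And>i g. \<lbrakk>i < n; g \<in> formally_composite\<rbrakk> \<Longrightarrow> tderiv i g \<in> formally_composite"
    by (rule tderiv_formally_composite)
  note foldr = commuting_operators_foldr
    [where n = n and S = formally_composite and D = tderiv and U = U and f = f and \<beta> = \<beta>]
  show "tpartial \<beta> \<in> formally_composite" unfolding tpartial_def
    by (rule foldr(1); fact closed tderiv_cong tderiv_commute f)
  show "tderiv j (tpartial \<beta>) x = tpartial (up \<beta> j) x" if "j < n" "x \<in> U" unfolding tpartial_def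
    by (rule foldr(2); fact closed tderiv_cong tderiv_commute f that)
qed

lemma Q_tpartial: "tpartial \<beta> \<in> Q n U"
  by (rule formally_composite_Q[OF tpartial_formally_composite])

lemma partial_deriv_tpartial:
  assumes "i < n" "x \<in> U"
  shows "partial_deriv i (tpartial \<beta>) x = (\<Sum>l<n. tpartial (up \<beta> l) x * J l i x)"
  using partial_deriv_tderiv[OF tpartial_formally_composite assms] assms by (simp add: tderiv_tpartial)

lemma tpartial_zero: "tpartial (\<lambda>_. 0) = f"
proof -
  have "foldr (\<lambda>i. tderiv i ^^ 0) is f = f" for "is" by (induction "is") auto
  then show ?thesis by (simp add: tpartial_def)
qed

text \<open>The induction on the degree of the coefficient treats all \<open>\<beta>\<close> at
  once: the system expresses a coefficient for \<open>\<beta>\<close> through coefficients of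
  smaller degree for the indices \<open>up \<beta> l\<close>.\<close>

lemma tay_tpartial:
  assumes a: "a \<in> U"
  shows "tay n (tpartial \<beta>) a =
    mcompose n (\<lambda>\<gamma>. tpartial (\<lambda>i. \<beta> i + \<gamma> i) a / mfact n \<gamma>) (taylor_map n \<sigma> a)"
proof -
  define H where "H \<beta> \<gamma> = tpartial (\<lambda>i. \<beta> i + \<gamma> i) a / mfact n \<gamma>" for \<beta> \<gamma>
  \<comment> \<open>Raising the base index is the same as differentiating the outer series; hence
    the composites satisfy the system of the functions.\<close>
  have H_deriv: "mps_deriv l (H \<beta>) = H (up \<beta> l)" if "l < n" for \<beta> l
  proof
    fix \<gamma>
    have "(\<lambda>i. \<beta> i + up \<gamma> l i) = (\<lambda>i. up \<beta> l i + \<gamma> i)" by auto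
    then show "mps_deriv l (H \<beta>) \<gamma> = H (up \<beta> l) \<gamma>"
      unfolding mps_deriv_def H_def mfact_up[OF that] by (simp del: fun_upd_apply of_nat_Suc)
  qed
  let ?C = "\<lambda>H. mcompose n H (taylor_map n \<sigma> a)"
  have *: "mcoeff (tay n (tpartial \<beta>) a) \<gamma> = mcoeff (?C (H \<beta>)) \<gamma>" if "\<gamma> \<in> multiidx n" for \<beta> \<gamma>
    using that
  proof (induction "mdeg n \<gamma>" arbitrary: \<beta> \<gamma> rule: less_induct)
    case less
    from less.prems show ?case
    proof (cases rule: multiidx_cases)
      case 1
      then show ?thesis by (simp add: mcoeff_tay_zero mcompose_const H_def mfact_def)
    next
      case (2 i \<delta>)
      have "tay n (partial_deriv i (tpartial \<beta>)) a = tay n (\<lambda>x. \<Sum>l<n. tpartial (up \<beta> l) x * J l i x) a"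
        by (rule tay_cong[OF U a]) (rule partial_deriv_tpartial[OF 2(1)])
      also have "\<dots> = (\<Sum>l<n. tay n (tpartial (up \<beta> l)) a * tay n (J l i) a)"
        by (intro tay_sum_mult[OF U a] Q_tpartial Q_J 2(1)) auto
      finally have "mderiv i (tay n (tpartial \<beta>) a) = (\<Sum>l<n. tay n (tpartial (up \<beta> l)) a * tay n (J l i) a)"
        unfolding mderiv_tay_Q[OF U a Q_tpartial 2(1)] .
      then have "mcoeff (mderiv i (tay n (tpartial \<beta>) a)) \<delta> =
          (\<Sum>l<n. mcoeff (tay n (tpartial (up \<beta> l)) a * tay n (J l i) a) \<delta>)"
        by (simp only: mcoeff_sum)
      also have "\<dots> = (\<Sum>l<n. mcoeff (?C (H (up \<beta> l)) * tay n (J l i) a) \<delta>)"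
      proof (intro sum.cong refl mcoeff_mult_cong less.hyps)
        fix \<alpha> assume "\<alpha> \<le> \<delta>"
        then show "mdeg n \<alpha> < mdeg n \<gamma>" "\<alpha> \<in> multiidx n"
          unfolding 2(3) using mdeg_mono[of \<alpha> \<delta> n] multiidx_le[OF 2(2), of \<alpha>]
          by (simp_all add: mdeg_up[OF 2(1)] less_Suc_eq_le del: fun_upd_apply)
      qed
      also have "\<dots> = mcoeff (mderiv i (?C (H \<beta>))) \<delta>"
        unfolding mderiv_mcompose_taylor_map[OF a 2(1)] mcoeff_sum
        by (rule sum.cong) (simp_all only: H_deriv lessThan_iff)
      finally have "mcoeff (mderiv i (tay n (tpartial \<beta>) a)) \<delta> = mcoeff (mderiv i (?C (H \<beta>))) \<delta>" .
      then show ?thesis unfolding 2(3) mcoeff_up[of _ \<delta> i] by (rule arg_cong)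
    qed
  qed
  have "tay n (tpartial \<beta>) a = ?C (H \<beta>)"
  proof (rule mseries_eqI)
    show "mcoeff (tay n (tpartial \<beta>) a) \<gamma> = mcoeff (?C (H \<beta>)) \<gamma>" for \<gamma>
    proof (cases "\<gamma> \<in> multiidx n")
      case False
      then show ?thesis by (simp add: mcoeff_tay_outside mcompose_def mcoeff_trunc)
    qed (rule *)
  qed
  also have "H \<beta> = (\<lambda>\<gamma>. tpartial (\<lambda>i. \<beta> i + \<gamma> i) a / mfact n \<gamma>)"
    by (rule ext) (simp only: H_def)
  finally show ?thesis .
qed

text \<open>\<open>hom_part m \<beta> a y\<close> is \<open>\<Sum>\<gamma>. f\<^bsub>\<beta>+\<gamma>\<^esub>(a) y\<^sup>\<gamma> / \<gamma>!\<close>, summed over the \<open>\<gamma>\<close> of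
  degree \<open>m\<close>, by Euler's relation.\<close>

fun hom_part :: "nat \<Rightarrow> (nat \<Rightarrow> nat) \<Rightarrow> (nat \<Rightarrow> real) \<Rightarrow> (nat \<Rightarrow> real) \<Rightarrow> real" where
  "hom_part 0 \<beta> a y = tpartial \<beta> a"
| "hom_part (Suc m) \<beta> a y = (\<Sum>j<n. y j * hom_part m (up \<beta> j) a y) / real (Suc m)"

text \<open>The error of the Taylor polynomial of degree below \<open>m\<close> in the target
  coordinates, pulled back by \<open>\<sigma>\<close>. The polynomial makes sense although
  \<open>f\<close> need not come from a function on the target. For \<open>m = 0\<close> nothing is
  subtracted, where the induction for the bound starts.\<close>

definition remainder :: "nat \<Rightarrow> (nat \<Rightarrow> nat) \<Rightarrow> (nat \<Rightarrow> real) \<Rightarrow> (nat \<Rightarrow> real) \<Rightarrow> real" where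
  "remainder m \<beta> a x = tpartial \<beta> x - (\<Sum>k<m. hom_part k \<beta> a (\<lambda>l. \<sigma> x l - \<sigma> a l))"

lemma Q_hom_part: "(\<lambda>x. hom_part m \<beta> a (\<lambda>l. \<sigma> x l - \<sigma> a l)) \<in> Q n U"
proof (induction m arbitrary: \<beta>)
  case (Suc m)
  have "(\<lambda>x. (1 / real (Suc m)) * (\<Sum>j<n. (\<sigma> x j - \<sigma> a j) * hom_part m (up \<beta> j) a (\<lambda>l. \<sigma> x l - \<sigma> a l))) \<in> Q n U"
    by (intro scale Q_sum mult Q_diff Q_const U Suc \<sigma>) auto
  then show ?case by simp
qed (simp add: Q_const U)

lemma Q_remainder: "remainder m \<beta> a \<in> Q n U"
  unfolding remainder_def[abs_def] by (intro Q_diff Q_tpartial Q_sum Q_hom_part U)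

lemma up_commute: "up (up \<beta> i) j = up (up \<beta> j) i"
  by auto

lemma hom_part_deriv:
  assumes "i < n" "x \<in> U"
  shows "((\<lambda>t. hom_part m \<beta> a (\<lambda>l. \<sigma> (x(i := t)) l - \<sigma> a l)) has_real_derivative
    (case m of 0 \<Rightarrow> 0 | Suc k \<Rightarrow> \<Sum>l<n. J l i x * hom_part k (up \<beta> l) a (\<lambda>l. \<sigma> x l - \<sigma> a l))) (at (x i))"
proof (induction m arbitrary: \<beta>)
  case (Suc m)
  let ?y = "\<lambda>l. \<sigma> x l - \<sigma> a l"
  let ?D = "\<lambda>\<beta>. case m of 0 \<Rightarrow> 0 | Suc k \<Rightarrow> \<Sum>l<n. J l i x * hom_part k (up \<beta> l) a ?y"
  have \<sigma>d: "((\<lambda>t. \<sigma> (x(i := t)) l) has_real_derivative J l i x) (at (x i))" if "l < n" for l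
    by (rule smooth_on_deriv[OF smooth[OF U \<sigma>[OF that]] assms])
  have "((\<lambda>t. (\<Sum>j<n. (\<sigma> (x(i := t)) j - \<sigma> a j) * hom_part m (up \<beta> j) a (\<lambda>l. \<sigma> (x(i := t)) l - \<sigma> a l)) / real (Suc m))
      has_real_derivative (\<Sum>j<n. J j i x * hom_part m (up \<beta> j) a ?y + ?D (up \<beta> j) * ?y j) / real (Suc m)) (at (x i))"
  proof (intro DERIV_cdivide DERIV_sum)
    fix j assume "j \<in> {..<n}"
    then have "((\<lambda>t. \<sigma> (x(i := t)) j - \<sigma> a j) has_real_derivative J j i x) (at (x i))"
      using DERIV_diff[OF \<sigma>d DERIV_const, of j] by simp
    from DERIV_mult[OF this Suc[of "up \<beta> j"]]
    show "((\<lambda>t. (\<sigma> (x(i := t)) j - \<sigma> a j) * hom_part m (up \<beta> j) a (\<lambda>l. \<sigma> (x(i := t)) l - \<sigma> a l))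
        has_real_derivative J j i x * hom_part m (up \<beta> j) a ?y + ?D (up \<beta> j) * ?y j) (at (x i))"
      by (simp del: fun_upd_apply add: fun_upd_triv)
  qed
  also have "(\<Sum>j<n. J j i x * hom_part m (up \<beta> j) a ?y + ?D (up \<beta> j) * ?y j) / real (Suc m) =
      (\<Sum>l<n. J l i x * hom_part m (up \<beta> l) a ?y)"
  proof -
    \<comment> \<open>Euler's count: differentiating the inner parts yields \<open>m\<close> copies
      of the claimed sum and the explicit factor \<open>y j\<close> one more, against the
      denominator \<open>m + 1\<close>.\<close>
    have "(\<Sum>j<n. ?D (up \<beta> j) * ?y j) = real m * (\<Sum>l<n. J l i x * hom_part m (up \<beta> l) a ?y)"
    proof (cases m)
      case (Suc k)
      have "(\<Sum>j<n. ?D (up \<beta> j) * ?y j) = (\<Sum>l<n. J l i x * (\<Sum>j<n. ?y j * hom_part k (up (up \<beta> l) j) a ?y))"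
        unfolding Suc nat.case sum_distrib_left sum_distrib_right
        by (subst sum.swap) (simp add: up_commute[of \<beta>] mult_ac del: fun_upd_apply)
      also have "\<dots> = (\<Sum>l<n. J l i x * (real m * hom_part m (up \<beta> l) a ?y))"
        by (simp add: Suc del: fun_upd_apply of_nat_Suc)
      finally show ?thesis by (simp add: sum_distrib_left mult_ac)
    qed simp
    moreover have "(A + real m * A) / real (Suc m) = A" for A by (simp add: field_simps)
    ultimately show ?thesis by (simp only: sum.distrib)
  qed
  finally show ?case unfolding hom_part.simps nat.case .
qed simp

text \<open>Differentiation lowers the degree of each homogeneous part and raises its base index,
  and the degree 0 part, constant in \<open>x\<close>, drops out. So remainders of order
  \<open>m + 1\<close> differentiate into remainders of order \<open>m\<close>.\<close>

lemma partial_deriv_remainder: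
  assumes "i < n" "x \<in> U"
  shows "partial_deriv i (remainder (Suc m) \<beta> a) x = (\<Sum>l<n. J l i x * remainder m (up \<beta> l) a x)"
proof (rule partial_deriv_eqI)
  let ?y = "\<lambda>l. \<sigma> x l - \<sigma> a l"
  let ?D = "\<lambda>k. case k of 0 \<Rightarrow> 0 | Suc k \<Rightarrow> \<Sum>l<n. J l i x * hom_part k (up \<beta> l) a ?y"
  have "((\<lambda>t. remainder (Suc m) \<beta> a (x(i := t))) has_real_derivative
      partial_deriv i (tpartial \<beta>) x - (\<Sum>k<Suc m. ?D k)) (at (x i))"
    unfolding remainder_def
    by (intro DERIV_diff DERIV_sum hom_part_deriv smooth_on_deriv[OF smooth[OF U Q_tpartial]] assms)
  also have "(\<Sum>k<Suc m. ?D k) = (\<Sum>k<m. \<Sum>l<n. J l i x * hom_part k (up \<beta> l) a ?y)"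
    by (simp add: sum.lessThan_Suc_shift del: fun_upd_apply sum.lessThan_Suc)
  also have "partial_deriv i (tpartial \<beta>) x - \<dots> = (\<Sum>l<n. J l i x * remainder m (up \<beta> l) a x)"
    unfolding partial_deriv_tpartial[OF assms] remainder_def
    by (subst sum.swap) (simp add: sum_subtractf[symmetric] right_diff_distrib sum_distrib_left mult.commute del: fun_upd_apply)
  finally show "((\<lambda>t. remainder (Suc m) \<beta> a (x(i := t))) has_real_derivative
      (\<Sum>l<n. J l i x * remainder m (up \<beta> l) a x)) (at (x i))" .
qed

text \<open>The parts of positive degree vanish at \<open>\<sigma> x - \<sigma> a = 0\<close>. An
  estimate obtained on a full cube thus becomes one for differences of values along a fibre.\<close>

lemma remainder_on_fibre:
  assumes "\<And>l. l < n \<Longrightarrow> \<sigma> x l = \<sigma> a l"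
  shows "remainder (Suc m) \<beta> a x = tpartial \<beta> x - tpartial \<beta> a"
proof -
  have "hom_part (Suc k) \<beta> a (\<lambda>l. \<sigma> x l - \<sigma> a l) = 0" for k using assms by simp
  then show ?thesis by (simp add: remainder_def sum.lessThan_Suc_shift del: hom_part.simps(2) sum.lessThan_Suc)
qed

section \<open>Local estimates and constancy on fibres\<close>

lemma Q_locally_bounded:
  assumes "g \<in> Q n U" "p \<in> U"
  shows "\<exists>r>0. \<exists>C. \<forall>x\<in>box_nbhd n p r. \<bar>g x\<bar> \<le> C"
proof -
  obtain r where r: "r > 0" "\<And>x. x \<in> box_nbhd n p r \<Longrightarrow> \<bar>g x - g p\<bar> < 1"
    by (rule continuous_on_box_nbhd[OF U smooth_on_continuous[OF smooth[OF U assms(1)]] assms(2), of 1])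
      (simp, blast)
  have "\<bar>g x\<bar> \<le> \<bar>g p\<bar> + 1" if "x \<in> box_nbhd n p r" for x using r(2)[OF that] by linarith
  with r(1) show ?thesis by blast
qed

text \<open>The remainder of order \<open>m + 1\<close> vanishes at \<open>x = a\<close>, and its
  gradient combines the bounded entries of the Jacobian matrix with \<open>n\<close> remainders of
  order \<open>m\<close>. The mean value bound then adds one power of the distance. The base point
  \<open>a\<close> varies over the cube as well, since the covering argument compares arbitrary
  pairs.\<close>

lemma remainder_bound:
  assumes p: "p \<in> U"
  shows "\<exists>r>0. \<exists>C. \<forall>x\<in>box_nbhd n p r. \<forall>a\<in>box_nbhd n p r. \<bar>remainder m \<beta> a x\<bar> \<le> C * dist1 n x a ^ m"
proof (induction m arbitrary: \<beta>)
  case 0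
  show ?case using Q_locally_bounded[OF Q_tpartial p, of \<beta>] by (auto simp: remainder_def)
next
  case (Suc m)
  have "\<exists>r>0. \<exists>C\<ge>0. \<forall>l\<in>{..<n}. \<forall>x\<in>box_nbhd n p r. \<forall>a\<in>box_nbhd n p r.
      \<bar>remainder m (up \<beta> l) a x\<bar> \<le> C * dist1 n x a ^ m"
    by (rule uniform_box_bound[OF finite_lessThan]) (rule Suc, simp)
  then obtain r1 C1 where 1: "r1 > 0" "C1 \<ge> 0" "\<forall>l\<in>{..<n}. \<forall>x\<in>box_nbhd n p r1. \<forall>a\<in>box_nbhd n p r1.
      \<bar>remainder m (up \<beta> l) a x\<bar> \<le> C1 * dist1 n x a ^ m" by metis
  have "\<exists>r>0. \<exists>C\<ge>0. \<forall>k\<in>{..<n} \<times> {..<n}. \<forall>x\<in>box_nbhd n p r. \<forall>a\<in>box_nbhd n p r.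
      \<bar>J (fst k) (snd k) x\<bar> \<le> C * 1"
  proof (rule uniform_box_bound)
    fix k assume "k \<in> {..<n} \<times> {..<n}"
    then have "J (fst k) (snd k) \<in> Q n U" by (intro Q_J) auto
    from Q_locally_bounded[OF this p]
    show "\<exists>r>0. \<exists>C. \<forall>x\<in>box_nbhd n p r. \<forall>a\<in>box_nbhd n p r. \<bar>J (fst k) (snd k) x\<bar> \<le> C * 1"
      by (simp only: mult_1_right) blast
  qed simp_all
  then obtain r2 C2 where 2: "r2 > 0" "C2 \<ge> 0"
    "\<forall>k\<in>{..<n} \<times> {..<n}. \<forall>x\<in>box_nbhd n p r2. \<forall>a\<in>box_nbhd n p r2. \<bar>J (fst k) (snd k) x\<bar> \<le> C2 * 1"
    by metis
  obtain r3 where 3: "r3 > 0" "box_nbhd n p r3 \<subseteq> U" using openin_imp_box_nbhd[OF U p] by blast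
  define r where "r = min r1 (min r2 r3)"
  have r: "r > 0" "box_nbhd n p r \<subseteq> box_nbhd n p r1" "box_nbhd n p r \<subseteq> box_nbhd n p r2" "box_nbhd n p r \<subseteq> U"
  proof -
    show "r > 0" using 1(1) 2(1) 3(1) by (simp add: r_def)
    show "box_nbhd n p r \<subseteq> box_nbhd n p r1" "box_nbhd n p r \<subseteq> box_nbhd n p r2"
      by (rule box_nbhd_mono, simp add: r_def)+
    have "box_nbhd n p r \<subseteq> box_nbhd n p r3" by (rule box_nbhd_mono) (simp add: r_def)
    then show "box_nbhd n p r \<subseteq> U" using 3(2) by blast
  qed
  have "\<bar>remainder (Suc m) \<beta> a x\<bar> \<le> (real n * (C2 * C1)) * dist1 n x a ^ Suc m"
    if x: "x \<in> box_nbhd n p r" and a: "a \<in> box_nbhd n p r" for x a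
  proof -
    have "\<bar>remainder (Suc m) \<beta> a x - remainder (Suc m) \<beta> a a\<bar> \<le> (real n * (C2 * (C1 * dist1 n x a ^ m))) * dist1 n x a"
    proof (rule box_mean_value_bound[OF U smooth[OF U Q_remainder] r(4) x a])
      fix z i assume z: "z \<in> box_nbhd n p r" "dist1 n z a \<le> dist1 n x a" and i: "i < n"
      have "\<bar>partial_deriv i (remainder (Suc m) \<beta> a) z\<bar> \<le> (\<Sum>l<n. \<bar>J l i z\<bar> * \<bar>remainder m (up \<beta> l) a z\<bar>)"
      proof -
        have "z \<in> U" using z r(4) by blast
        then show ?thesis
          unfolding partial_deriv_remainder[OF i \<open>z \<in> U\<close>] abs_mult[symmetric] by (intro sum_abs)
      qed
      also have "\<dots> \<le> (\<Sum>l<n. C2 * (C1 * dist1 n x a ^ m))"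
      proof (rule sum_mono, rule mult_mono)
        fix l assume l: "l \<in> {..<n}"
        have "z \<in> box_nbhd n p r1" "z \<in> box_nbhd n p r2" "a \<in> box_nbhd n p r1"
          using z(1) a r by blast+
        then show "\<bar>J l i z\<bar> \<le> C2" using 2(3)[rule_format, of "(l, i)" z z] l i by simp
        have "\<bar>remainder m (up \<beta> l) a z\<bar> \<le> C1 * dist1 n z a ^ m" by (rule 1(3)[rule_format]) fact+
        also have "\<dots> \<le> C1 * dist1 n x a ^ m" using 1(2) z by (intro mult_left_mono power_mono) auto
        finally show "\<bar>remainder m (up \<beta> l) a z\<bar> \<le> C1 * dist1 n x a ^ m" .
      qed (use 2 in auto)
      finally show "\<bar>partial_deriv i (remainder (Suc m) \<beta> a) z\<bar> \<le> real n * (C2 * (C1 * dist1 n x a ^ m))"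
        by simp
    qed
    moreover have "remainder (Suc m) \<beta> a a = 0" by (simp add: remainder_on_fibre)
    ultimately show ?thesis by (simp add: mult_ac)
  qed
  with r(1) show ?case by blast
qed

lemma tpartial_constant_on_fibre_component:
  assumes S: "connected S" "S \<subseteq> {x \<in> U. \<sigma> x = b}"
  shows "tpartial \<beta> constant_on S"
proof (rule constant_on_connected_if_locally_negligible[OF S(1), of _ n])
  show "continuous_on S (tpartial \<beta>)"
    using smooth_on_continuous[OF smooth[OF U Q_tpartial]] S(2) by (auto intro: continuous_on_subset)
  show "S \<subseteq> {x. \<forall>i\<ge>n. x i = 0}" using S(2) openin_Euclidean_space_zero[OF U] by auto
  fix p assume "p \<in> S"
  then have "p \<in> U" using S(2) by auto
  from remainder_bound[OF this, of "Suc n" \<beta>]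
  obtain r C where r: "r > 0" "\<And>x a. x \<in> box_nbhd n p r \<Longrightarrow> a \<in> box_nbhd n p r \<Longrightarrow>
      \<bar>remainder (Suc n) \<beta> a x\<bar> \<le> C * dist1 n x a ^ Suc n" by blast
  have "negligible (tpartial \<beta> ` (S \<inter> box_nbhd n p r))"
  proof (rule negligible_image_of_flat_function[OF _ r(1)])
    fix x y assume "x \<in> S \<inter> box_nbhd n p r" "y \<in> S \<inter> box_nbhd n p r"
    then show "\<bar>tpartial \<beta> x - tpartial \<beta> y\<bar> \<le> C * dist1 n x y ^ Suc n"
      using r(2)[of x y] remainder_on_fibre[of x y n \<beta>] S(2) by (auto simp: subset_iff)
  qed auto
  with r(1) show "\<exists>r>0. negligible (tpartial \<beta> ` (S \<inter> box_nbhd n p r))" by blast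
qed

end

end

theorem theorem4p1:
  fixes Q :: fun_class and n :: nat
    and U V :: "(nat \<Rightarrow> real) set"
    and \<sigma> :: "(nat \<Rightarrow> real) \<Rightarrow> nat \<Rightarrow> real"
    and f :: "(nat \<Rightarrow> real) \<Rightarrow> real"
    and H :: mps
  assumes "quasianalytic_class Q"
    and "openin (Euclidean_space n) U" and "(\<lambda>_. 0) \<in> U"
    and "openin (Euclidean_space n) V" and "(\<lambda>_. 0) \<in> V"
    and "\<And>i. i < n \<Longrightarrow> connected {x \<in> U. x i = 0}"
    and "Q_mapping Q n U n V \<sigma>" and "\<sigma> (\<lambda>_. 0) = (\<lambda>_. 0)"
    and "\<exists>\<mu>\<in>multiidx n. \<exists>u. unit_in Q n U u \<and>
           (\<forall>x\<in>U. Determinant.det (jacobian_matrix n \<sigma> x) = mpow n x \<mu> * u x)"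
    and "f \<in> Q n U"
    and "mps_eq n (taylor n f (\<lambda>_. 0)) (mps_compose n H (taylor_map n \<sigma> (\<lambda>_. 0)))"
  shows "\<exists>F :: (nat \<Rightarrow> nat) \<Rightarrow> (nat \<Rightarrow> real) \<Rightarrow> real.
           let H' = (\<lambda>a. (\<lambda>\<beta>. F \<beta> a / mfact n \<beta>)) in
           (\<forall>\<beta>\<in>multiidx n. F \<beta> \<in> Q n U) \<and>
           (\<forall>x\<in>U. F (\<lambda>_. 0) x = f x) \<and>
           (\<forall>a\<in>U. mps_eq n (taylor n f a) (mps_compose n (H' a) (taylor_map n \<sigma> a))) \<and>
           (\<forall>b\<in>V. \<forall>C\<in>components {x \<in> U. \<sigma> x = b}.
              (\<forall>\<beta>\<in>multiidx n. F \<beta> constant_on C) \<and>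
              (\<forall>a\<in>C. \<forall>a'\<in>C. mps_eq n (H' a) (H' a')))"
proof -
  obtain \<mu> u where \<mu>: "\<mu> \<in> multiidx n" and u: "unit_in Q n U u"
    and det: "\<And>x. x \<in> U \<Longrightarrow> Determinant.det (jacobian_matrix n \<sigma> x) = mpow n x \<mu> * u x"
    using assms(9) by blast
  interpret quasianalytic_class Q by fact
  interpret monomial_jacobian_map Q n U \<sigma> \<mu> u
    by unfold_locales (use assms(2,3,6,7) \<mu> u det in \<open>auto simp: Q_mapping_def\<close>)
  have f: "f \<in> formally_composite"
    using assms(10,11) by (auto simp: formally_composite_def mps_eq_iff_trunc tay_def mcompose_def)
  let ?F = "tpartial f"
  have const: "?F \<beta> constant_on C" if "C \<in> components {x \<in> U. \<sigma> x = b}" for \<beta> b C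
    using that in_components_connected in_components_subset
    by (intro tpartial_constant_on_fibre_component[OF f]) blast+
  show ?thesis
  proof (rule exI[of _ ?F], unfold Let_def, intro conjI ballI)
    show "?F \<beta> \<in> Q n U" for \<beta> by (rule Q_tpartial[OF f])
    show "?F (\<lambda>_. 0) x = f x" for x by (simp add: tpartial_zero[OF f])
    \<comment> \<open>The expansion formula for base index 0, where
      \<open>\<beta> + \<gamma>\<close> is just \<open>\<gamma>\<close>.\<close>
    show "mps_eq n (taylor n f a) (mps_compose n (\<lambda>\<beta>. ?F \<beta> a / mfact n \<beta>) (taylor_map n \<sigma> a))"
      if "a \<in> U" for a
      using tay_tpartial[OF f that, of "\<lambda>_. 0"]
      by (simp add: mps_eq_iff_trunc tay_def mcompose_def tpartial_zero[OF f])
    fix b C assume C: "C \<in> components {x \<in> U. \<sigma> x = b}"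
    show "?F \<beta> constant_on C" for \<beta> by (rule const[OF C])
    show "mps_eq n (\<lambda>\<beta>. ?F \<beta> a / mfact n \<beta>) (\<lambda>\<beta>. ?F \<beta> a' / mfact n \<beta>)" if "a \<in> C" "a' \<in> C" for a a'
    proof -
      have "?F \<beta> a = ?F \<beta> a'" for \<beta> using const[OF C, of \<beta>] that by (auto simp: constant_on_def)
      then show ?thesis by (simp add: mps_eq_def)
    qed
  qed
qed

end
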